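(* Let $0\le\alpha<mn$, let $1<p_1,\dots,p_m<\infty$ with $\frac1p=\frac1{p_1}+\cdots+\frac1{p_m}$, and let $0<p\le q<\infty$. Let $\vec w=(w_1,\dots,w_m)$ and $v$ be weights on $\mathbb{R}^n$ such that $v\in A_{\infty,\mathcal{R}}$ and, for some $r>1$, $$\sup_{R\in\mathcal{R}}|R|^{\frac\alpha n+\frac1q-\frac1p}\Big(\frac1{|R|}\int_Rv\,dx\Big)^{\frac1q}\prod_{i=1}^m\Big(\frac1{|R|}\int_Rw_i^{(1-p_i')r}dx\Big)^{\frac1{rp_i'}}<\infty .$$ Then $\mathcal{M}_{\mathcal{R},\alpha}$ is bounded from $L^{p_1}(w_1)\times\cdots\times L^{p_m}(w_m)$ to $L^q(v)$; that is, there is $C>0$ such that for all $\vec f=(f_1,\dots,f_m)$, $$\Big(\int_{\mathbb{R}^n}\mathcal{M}_{\mathcal{R},\alpha}(\vec f)^q\,v\,dx\Big)^{1/q}\le C\prod_{i=1}^m\Big(\int_{\mathbb{R}^n}|f_i|^{p_i}w_i\,dx\Big)^{1/p_i}.$$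
   Context: $\mathcal{R}$ is the collection of all rectangles in $\mathbb{R}^n$ with sides parallel to the coordinate axes; $p_i'=p_i/(p_i-1)$. A weight is a nonnegative measurable function $w$ with $\int_Rw\,dx<\infty$ for each $R\in\mathcal{R}$. For $1<s<\infty$, $w\in A_{s,\mathcal{R}}$ means $\sup_{R\in\mathcal{R}}\big(\frac1{|R|}\int_Rw\,dx\big)\big(\frac1{|R|}\int_Rw^{1-s'}dx\big)^{s/s'}<\infty$, and $A_{\infty,\mathcal{R}}=\bigcup_{1<s<\infty}A_{s,\mathcal{R}}$. The multilinear fractional strong maximal operator is $$\mathcal{M}_{\mathcal{R},\alpha}(\vec f)(x)=\sup_{R\in\mathcal{R},R\ni x}\prod_{i=1}^m\frac1{|R|^{1-\frac\alpha{mn}}}\int_R|f_i(y)|dy .$$ *)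

theory Defs
  imports "HOL-Analysis.Analysis"
begin

(* Real powers of extended nonnegative reals.  The point is 0 powr a = \<infinity> for a < 0, so that
   a negative power of a weight is infinite where the weight vanishes; the real-valued powr
   would give 0 there.  For a = 0 the value is 1 throughout. *)
definition epowr :: "ennreal \<Rightarrow> real \<Rightarrow> ennreal"  (infixr "epowr" 80) where
  "x epowr a =
     (if a = 0 then 1
      else if x = 0 then (if a < 0 then \<infinity> else 0)
      else if x = \<infinity> then (if a < 0 then 0 else \<infinity>)
      else ennreal (enn2real x powr a))"

(* Nondegenerate closed rectangles with sides parallel to the axes. *)
definition rectangles :: "(real ^ 'n) set set" where
  "rectangles = {cbox a b | a b. \<forall>i. a $ i < b $ i}"

definition is_weight :: "(real ^ 'n \<Rightarrow> real) \<Rightarrow> bool" where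
  "is_weight w \<longleftrightarrow> w \<in> borel_measurable lebesgue \<and> (\<forall>x. 0 \<le> w x) \<and>
     (\<forall>R \<in> rectangles. (\<integral>\<^sup>+ x \<in> R. ennreal (w x) \<partial>lebesgue) < \<infinity>)"

definition average :: "(real ^ 'n) set \<Rightarrow> (real ^ 'n \<Rightarrow> ennreal) \<Rightarrow> ennreal" where
  "average R g = (\<integral>\<^sup>+ x \<in> R. g x \<partial>lebesgue) / emeasure lebesgue R"

definition conj_exp :: "real \<Rightarrow> real" where
  "conj_exp s = s / (s - 1)"

definition A_class :: "real \<Rightarrow> (real ^ 'n \<Rightarrow> real) set" where
  "A_class s = {w. is_weight w \<and>
     (SUP R \<in> rectangles.
        average R (\<lambda>x. ennreal (w x)) *
        (average R (\<lambda>x. ennreal (w x) epowr (1 - conj_exp s))) epowr (s / conj_exp s)) < \<infinity>}"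

definition A_infty :: "(real ^ 'n \<Rightarrow> real) set" where
  "A_infty = (\<Union>s \<in> {1<..}. A_class s)"

definition frac_strong_max ::
    "real \<Rightarrow> nat \<Rightarrow> (nat \<Rightarrow> real ^ 'n \<Rightarrow> real) \<Rightarrow> real ^ 'n \<Rightarrow> ennreal" where
  "frac_strong_max \<alpha> m f x =
     (SUP R \<in> {R \<in> rectangles. x \<in> R}.
        \<Prod>i = 1..m. (\<integral>\<^sup>+ y \<in> R. ennreal \<bar>f i y\<bar> \<partial>lebesgue) /
          (emeasure lebesgue R) epowr (1 - \<alpha> / (real m * real CARD('n))))"

definition weighted_norm ::
    "real \<Rightarrow> (real ^ 'n \<Rightarrow> real) \<Rightarrow> (real ^ 'n \<Rightarrow> ennreal) \<Rightarrow> ennreal" where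
  "weighted_norm p w g = (\<integral>\<^sup>+ x. (g x) epowr p * ennreal (w x) \<partial>lebesgue) epowr (1 / p)"

end

(* Hoelder's inequality and the bump exponent r > 1 bound the average of each f_i over a rectangle R
   by the 1/s_i-th power of the average of g_i = (|f_i| w_i^(1/p_i))^s_i, for some s_i < p_i; so for
   c(R), the product defining the maximal operator, the hypothesis gives
   c(R) v(R)^(1/q) <= K |R|^(1/p) prod_i (average of g_i over R)^(1/s_i).
   From finitely many rectangles, taken in order of decreasing c(R), one keeps R if at least half of it
   is not yet covered. A discarded rectangle lies where the strong maximal function of the union of the
   earlier kept ones is at least 1/2, and that function is bounded on L^s(v) when v is in A_s, so the
   L^q(v) norm of the maximum is controlled by the sum of c(R)^q v(R) over the kept R. Each of these
   contains a set E_R of measure at least |R|/2, the E_R being disjoint, so, as p <= q, the sum is at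
   most a power of the integral of prod_i (M g_i)^(p/s_i), and Hoelder's inequality and the unweighted
   strong maximal theorem finish the estimate.

   The combinatorics takes place on finite grids of cubes of side 1/D, where the strong maximal theorem
   for A_s weights follows by iterating the one-dimensional case (Lerner's argument) without any
   differentiation theorem; Fatou's lemma then lets D tend to infinity. *)

theory Submission
  imports Defs
begin

section \<open>Elementary inequalities\<close>

text \<open>Rectangles of arbitrary eccentricity have no Vitali covering property, so the selection
  can only keep disjoint portions E_R. The v-mass of the discarded rectangles has to come from an
  L^s(v) bound, which is where v in A_infinity enters. The bump r > 1 leaves the room needed for the
  g_i: with \<kappa>_i = 1/(r p_i') and s_i = 1/(1 - \<kappa>_i) one gets p_i/s_i = p_i - (p_i -
  1)/r > 1. For r = 1 this exponent would be 1, where the strong maximal operator is unbounded. On a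
  grid a row of cells is itself a box, so A_s on boxes contains A_s along every coordinate line,
  which is what the iteration uses. In R^n the restriction to lines would require shrinking
  rectangles and differentiating. In return every discrete constant must be independent of D;
  Hoelder's inequality on single cells ensures this. Extended values shape the case analysis. The
  weight v = 0 lies in A_infinity and is treated apart; otherwise v > 0 a.e., and then a finite bump
  condition forces w_i > 0 a.e., because a negative power of 0 is infinite.\<close>

lemma layer_cake_powr:
  fixes F M a :: real
  assumes "0 \<le> F" "F \<le> M" "0 < a"
  shows "((\<lambda>t. if t < F then t powr (a - 1) else 0) has_integral F powr a / a) {0..M}"
proof -
  have "((\<lambda>t. t powr (a - 1)) has_integral F powr a / a) {0..F}"
    using has_integral_powr_from_0[of "a - 1" F] assms by simp
  then have "((\<lambda>t. if t \<in> {0..F} then t powr (a - 1) else 0) has_integral F powr a / a) {0..M}"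
    by (subst has_integral_restrict) (use assms in auto)
  \<comment> \<open>The interval \<open>{0..F}\<close> contains t = F while the condition
    \<open>t < F\<close> does not; a single point is negligible.\<close>
  then show ?thesis
    by (rule has_integral_spike_finite[of "{F}", rotated 2]) auto
qed

text \<open>The inequality between level sums is multiplied by \<open>t powr (a - 1)\<close> and
  integrated over \<open>{0..M}\<close>, where \<open>M\<close> bounds all values, so that finitely
  many layer-cake integrals share one range. It serves with d = 1 in the one-dimensional maximal
  inequality and with d = 0 for the selected rectangles.\<close>

lemma layer_cake_comparison:
  fixes F u :: "'a \<Rightarrow> real" and G b :: "'b \<Rightarrow> real" and a d :: real
  assumes fin: "finite I" "finite J"
    and F: "\<And>i. i \<in> I \<Longrightarrow> 0 \<le> F i" and G: "\<And>j. j \<in> J \<Longrightarrow> 0 \<le> G j"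
    and a: "0 < a" and d: "0 \<le> d"
    and le: "\<And>t. 0 < t \<Longrightarrow> (\<Sum>i\<in>{i\<in>I. t < F i}. u i) * t powr d \<le> (\<Sum>j\<in>{j\<in>J. t < G j}. b j)"
  shows "(\<Sum>i\<in>I. u i * F i powr (a + d)) / (a + d) \<le> (\<Sum>j\<in>J. b j * G j powr a) / a"
proof -
  define M where "M = sum F I + sum G J"
  have FM: "F i \<le> M" if "i \<in> I" for i
    unfolding M_def using member_le_sum[of i I F] F G fin that
    by (smt (verit, best) sum_nonneg DiffD1)
  have GM: "G j \<le> M" if "j \<in> J" for j
    unfolding M_def using member_le_sum[of j J G] F G fin that
    by (smt (verit, best) sum_nonneg DiffD1)
  have 1: "((\<lambda>t. \<Sum>i\<in>I. u i * (if t < F i then t powr (a + d - 1) else 0)) has_integral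
      (\<Sum>i\<in>I. u i * (F i powr (a + d) / (a + d)))) {0..M}"
    by (intro has_integral_sum has_integral_mult_right layer_cake_powr) (use fin F FM a d in auto)
  have 2: "((\<lambda>t. \<Sum>j\<in>J. b j * (if t < G j then t powr (a - 1) else 0)) has_integral
      (\<Sum>j\<in>J. b j * (G j powr a / a))) {0..M}"
    by (intro has_integral_sum has_integral_mult_right layer_cake_powr) (use fin G GM a in auto)
  have "(\<Sum>i\<in>I. u i * (F i powr (a + d) / (a + d))) \<le> (\<Sum>j\<in>J. b j * (G j powr a / a))"
  proof (rule has_integral_le[OF 1 2])
    fix t assume t: "t \<in> {0..M}"
    show "(\<Sum>i\<in>I. u i * (if t < F i then t powr (a + d - 1) else 0))
      \<le> (\<Sum>j\<in>J. b j * (if t < G j then t powr (a - 1) else 0))"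
    proof (cases "t = 0")
      case False
      then have t: "t > 0" using t by auto
      have "(\<Sum>i\<in>I. u i * (if t < F i then t powr (a + d - 1) else 0))
          = (\<Sum>i\<in>I. if t < F i then u i * t powr (a + d - 1) else 0)"
        by (intro sum.cong) auto
      also have "\<dots> = (\<Sum>i\<in>{i\<in>I. t < F i}. u i * t powr (a + d - 1))"
        by (rule sum.inter_filter[symmetric, OF fin(1)])
      also have "\<dots> = t powr (a - 1) * ((\<Sum>i\<in>{i\<in>I. t < F i}. u i) * t powr d)"
        using t by (simp add: sum_distrib_right sum_distrib_left mult_ac flip: powr_add)
          (simp add: algebra_simps)
      also have "\<dots> \<le> t powr (a - 1) * (\<Sum>j\<in>{j\<in>J. t < G j}. b j)"
        by (intro mult_left_mono le t) auto
      also have "\<dots> = (\<Sum>j\<in>{j\<in>J. t < G j}. b j * t powr (a - 1))"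
        by (simp add: sum_distrib_left mult_ac)
      also have "\<dots> = (\<Sum>j\<in>J. if t < G j then b j * t powr (a - 1) else 0)"
        by (rule sum.inter_filter[OF fin(2)])
      also have "\<dots> = (\<Sum>j\<in>J. b j * (if t < G j then t powr (a - 1) else 0))"
        by (intro sum.cong) auto
      finally show ?thesis .
    next
      \<comment> \<open>\<open>0 powr x\<close> is 0 for every x, so both sides vanish at t = 0 even
        for negative exponents.\<close>
      case True
      show ?thesis unfolding True by (simp cong: if_cong)
    qed
  qed
  then show ?thesis by (simp add: sum_divide_distrib)
qed

lemma weighted_arith_geom_mean:
  fixes x \<theta> :: "'a \<Rightarrow> real"
  assumes "finite S" "\<And>i. i \<in> S \<Longrightarrow> 0 \<le> x i" "\<And>i. i \<in> S \<Longrightarrow> 0 \<le> \<theta> i" "sum \<theta> S = 1"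
  shows "(\<Prod>i\<in>S. x i powr \<theta> i) \<le> (\<Sum>i\<in>S. \<theta> i * x i)"
proof (cases "\<exists>i\<in>S. x i = 0")
  case True
  then have 0: "(\<Prod>i\<in>S. x i powr \<theta> i) = 0" using assms(1) by auto
  show ?thesis unfolding 0 using assms by (auto intro!: sum_nonneg)
next
  case False
  then have pos: "\<And>i. i \<in> S \<Longrightarrow> 0 < x i" using assms(2) by force
  have "S \<noteq> {}" using assms(4) by auto
  have "(\<Prod>i\<in>S. x i powr \<theta> i) = exp (\<Sum>i\<in>S. \<theta> i *\<^sub>R ln (x i))"
    unfolding exp_sum[OF assms(1)] by (intro prod.cong) (auto simp: powr_def dest: pos)
  also have "\<dots> \<le> (\<Sum>i\<in>S. \<theta> i * exp (ln (x i)))"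
    by (rule convex_on_sum[OF assms(1) \<open>S \<noteq> {}\<close> exp_convex]) (use assms in auto)
  also have "\<dots> = (\<Sum>i\<in>S. \<theta> i * x i)"
    using pos by (intro sum.cong) auto
  finally show ?thesis .
qed

text \<open>Dividing each family by its total \<open>A i\<close> reduces the claim to the weighted
  arithmetic-geometric mean inequality at every k; summed over k, the right sides add up to
  \<open>sum \<theta> S = 1\<close>.\<close>

lemma Hoelder_sum:
  fixes a :: "'a \<Rightarrow> 'b \<Rightarrow> real" and \<theta> :: "'a \<Rightarrow> real"
  assumes "finite S" "finite X" "\<And>i k. i \<in> S \<Longrightarrow> k \<in> X \<Longrightarrow> 0 \<le> a i k"
    "\<And>i. i \<in> S \<Longrightarrow> 0 < \<theta> i" "sum \<theta> S = 1"
  shows "(\<Sum>k\<in>X. \<Prod>i\<in>S. a i k powr \<theta> i) \<le> (\<Prod>i\<in>S. (\<Sum>k\<in>X. a i k) powr \<theta> i)"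
proof (cases "\<exists>i\<in>S. (\<Sum>k\<in>X. a i k) = 0")
  case True
  then obtain i where i: "i \<in> S" "\<And>k. k \<in> X \<Longrightarrow> a i k = 0"
    using assms by (auto simp: sum_nonneg_eq_0_iff)
  have "(\<Sum>k\<in>X. \<Prod>i\<in>S. a i k powr \<theta> i) = 0"
    by (intro sum.neutral ballI prod_zero assms bexI[OF _ i(1)]) (simp add: i)
  then show ?thesis by (simp add: prod_nonneg)
next
  case False
  define A where "A i = (\<Sum>k\<in>X. a i k)" for i
  have A: "A i > 0" if "i \<in> S" for i
    using False that assms unfolding A_def by (smt (verit, best) sum_nonneg)
  have "(\<Sum>k\<in>X. \<Prod>i\<in>S. a i k powr \<theta> i)
      = (\<Sum>k\<in>X. (\<Prod>i\<in>S. A i powr \<theta> i) * (\<Prod>i\<in>S. (a i k / A i) powr \<theta> i))"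
  proof (intro sum.cong refl)
    fix k assume k: "k \<in> X"
    show "(\<Prod>i\<in>S. a i k powr \<theta> i) = (\<Prod>i\<in>S. A i powr \<theta> i) * (\<Prod>i\<in>S. (a i k / A i) powr \<theta> i)"
      unfolding prod.distrib[symmetric]
      by (intro prod.cong refl, subst powr_mult[symmetric]) (use A k assms in \<open>auto simp: less_imp_le dest: A\<close>)
  qed
  also have "\<dots> \<le> (\<Sum>k\<in>X. (\<Prod>i\<in>S. A i powr \<theta> i) * (\<Sum>i\<in>S. \<theta> i * (a i k / A i)))"
    by (intro sum_mono mult_left_mono weighted_arith_geom_mean prod_nonneg)
      (use assms A in \<open>auto simp: less_imp_le\<close>)
  also have "\<dots> = (\<Prod>i\<in>S. A i powr \<theta> i) * (\<Sum>i\<in>S. \<theta> i * (A i / A i))"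
    unfolding sum_distrib_left[symmetric]
    by (subst sum.swap) (simp add: A_def if_distrib flip: sum_distrib_left sum_divide_distrib cong: if_cong)
  also have "(\<Sum>i\<in>S. \<theta> i * (A i / A i)) = 1"
    using A assms(5) by (subst assms(5)[symmetric], intro sum.cong) (auto dest: A)
  finally show ?thesis by (simp add: A_def)
qed

lemma Hoelder_sum2:
  fixes f g :: "'b \<Rightarrow> real" and p :: real
  assumes "finite X" "\<And>k. k \<in> X \<Longrightarrow> 0 \<le> f k" "\<And>k. k \<in> X \<Longrightarrow> 0 \<le> g k" "0 < \<theta>" "\<theta> < 1"
  shows "(\<Sum>k\<in>X. f k powr \<theta> * g k powr (1 - \<theta>)) \<le> (\<Sum>k\<in>X. f k) powr \<theta> * (\<Sum>k\<in>X. g k) powr (1 - \<theta>)"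
  using Hoelder_sum[of "UNIV :: bool set" X "\<lambda>i. if i then f else g" "\<lambda>i. if i then \<theta> else 1 - \<theta>"] assms
  by (auto simp: UNIV_bool mult_ac)

lemma powr_add_le:
  fixes x y p :: real
  assumes "0 \<le> x" "0 \<le> y" "0 \<le> p"
  shows "(x + y) powr p \<le> 2 powr p * (x powr p + y powr p)"
proof -
  have "(x + y) powr p \<le> (2 * max x y) powr p"
    using assms by (intro powr_mono2) auto
  also have "\<dots> = 2 powr p * (max x y) powr p" using assms by (simp add: powr_mult)
  also have "\<dots> \<le> 2 powr p * (x powr p + y powr p)"
    by (intro mult_left_mono) (auto simp: max_def)
  finally show ?thesis .
qed

text \<open>Superadditivity of t^e: each y^e is at most y Y^(e-1) with Y the total. With e = q/p
  this is the point where p \<le> q is used.\<close>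

lemma sum_powr_le_powr_sum:
  fixes y :: "'a \<Rightarrow> real"
  assumes "finite S" "\<And>i. i \<in> S \<Longrightarrow> 0 \<le> y i" "1 \<le> e"
  shows "(\<Sum>i\<in>S. y i powr e) \<le> (\<Sum>i\<in>S. y i) powr e"
proof -
  define Y where "Y = sum y S"
  have le: "y i \<le> Y" if "i \<in> S" for i
    unfolding Y_def using member_le_sum[of i S y] assms that by auto
  have Y: "Y \<ge> 0" unfolding Y_def using assms by (auto intro: sum_nonneg)
  have "y i powr e \<le> y i * Y powr (e - 1)" if "i \<in> S" for i
  proof (cases "y i = 0")
    case False
    then have "y i powr e = y i * y i powr (e - 1)"
      using assms that by (simp add: powr_mult_base less_le)
    also have "\<dots> \<le> y i * Y powr (e - 1)"
      using le assms that by (intro mult_left_mono powr_mono2) auto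
    finally show ?thesis .
  qed simp
  then have "(\<Sum>i\<in>S. y i powr e) \<le> (\<Sum>i\<in>S. y i * Y powr (e - 1))"
    by (intro sum_mono) auto
  also have "\<dots> = Y * Y powr (e - 1)" by (simp add: Y_def sum_distrib_right)
  also have "\<dots> = Y powr e" using Y by (cases "Y = 0") (auto simp: powr_mult_base)
  finally show ?thesis by (simp add: Y_def)
qed

lemma rising_sun:
  fixes h :: "int \<Rightarrow> real"
  defines "E \<equiv> \<lambda>a B. {x \<in> {a..B}. \<exists>b\<in>{x..B}. (\<Sum>j\<in>{x..b}. h j) > 0}"
  shows "(\<Sum>x\<in>E a B. h x) \<ge> 0"
proof (induction "nat (B - a + 1)" arbitrary: a rule: less_induct)
  case less
  consider "a > B" | "a \<le> B" "a \<notin> E a B" | "a \<in> E a B" by linarith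
  then show ?case
  proof cases
    case 1
    then have "E a B = {}" by (auto simp: E_def)
    then show ?thesis by simp
  next
    case 2
    have "a + 1 \<le> x" if "x \<in> E a B" for x
      using that 2(2) by (cases "x = a") (auto simp: E_def)
    then have "E a B = E (a + 1) B"
      unfolding E_def by auto
    then show ?thesis using less[of "a + 1"] 2 by simp
  next
    case 3
    define P where "P b \<longleftrightarrow> b \<le> B \<and> (\<Sum>j\<in>{a..b}. h j) > 0" for b
    obtain b0 where b0: "b0 \<ge> a" "P b0" using 3 by (auto simp: E_def P_def)
    define n where "n = (LEAST n. P (a + int n))"
    have ex: "P (a + int (nat (b0 - a)))" using b0 by simp
    define b where "b = a + int n"
    have Pb: "P b" unfolding b_def n_def by (rule LeastI, rule ex)
    have min: "\<not> P c" if "a \<le> c" "c < b" for c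
    proof
      assume "P c"
      then have "n \<le> nat (c - a)" unfolding n_def using that by (intro Least_le) simp
      then show False using that by (simp add: b_def)
    qed
    have bB: "a \<le> b" "b \<le> B" using Pb by (auto simp: P_def b_def)
    (* b is minimal, so the sums over {a..x-1} are nonpositive and those over {x..b} positive. *)
    have sub: "{a..b} \<subseteq> E a B"
    proof
      fix x assume x: "x \<in> {a..b}"
      have "(\<Sum>j\<in>{a..b}. h j) = (\<Sum>j\<in>{a..x-1}. h j) + (\<Sum>j\<in>{x..b}. h j)"
        using x by (subst sum.union_disjoint[symmetric]) (auto intro!: sum.cong)
      moreover have "(\<Sum>j\<in>{a..x-1}. h j) \<le> 0"
        using min[of "x - 1"] x bB by (cases "x = a") (auto simp: P_def not_less)
      ultimately have "(\<Sum>j\<in>{x..b}. h j) > 0" using Pb by (simp add: P_def)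
      then show "x \<in> E a B" using x bB unfolding E_def by auto
    qed
    have "E a B = {a..b} \<union> E (b + 1) B"
      using sub bB unfolding E_def by auto
    moreover have "{a..b} \<inter> E (b + 1) B = {}" unfolding E_def by auto
    moreover have "finite (E (b + 1) B)" unfolding E_def by (rule finite_subset[of _ "{b+1..B}"]) auto
    ultimately have "(\<Sum>x\<in>E a B. h x) = (\<Sum>x\<in>{a..b}. h x) + (\<Sum>x\<in>E (b + 1) B. h x)"
      by (simp add: sum.union_disjoint)
    moreover have "(\<Sum>x\<in>E (b + 1) B. h x) \<ge> 0" using bB by (intro less) auto
    ultimately show ?thesis using Pb by (simp add: P_def)
  qed
qed

section \<open>Maximal functions on the integers\<close>

lemma sum_int_reflect:
  fixes f :: "int \<Rightarrow> real"
  shows "(\<Sum>j\<in>{a..b}. f (- j)) = (\<Sum>j\<in>{- b..- a}. f j)"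
  by (rule sum.reindex_bij_witness[of _ uminus uminus]) auto

text \<open>F is the maximal function over intervals starting at x. The condition
  \<open>t < F x\<close> says that some sum of \<open>(g j - t) * \<mu> j\<close> starting at x is
  positive, so \<open>rising_sun\<close> bounds t times the measure of the level set by the integral
  of g over that same set. Layer cake and Hoelder then give Doob's constant, which does not depend
  on \<mu>. Only a majorant of the averages is exposed, because later stages need nothing
  else.\<close>

lemma right_maximal_bound:
  fixes \<mu> g :: "int \<Rightarrow> real" and p :: real
  assumes \<mu>: "\<And>x. x \<in> {A..B} \<Longrightarrow> 0 < \<mu> x" and g: "\<And>x. x \<in> {A..B} \<Longrightarrow> 0 \<le> g x" and p: "1 < p"
  shows "\<exists>F. (\<forall>x\<in>{A..B}. 0 \<le> F x) \<and>
    (\<forall>x\<in>{A..B}. \<forall>b\<in>{x..B}. (\<Sum>j\<in>{x..b}. g j * \<mu> j) \<le> F x * (\<Sum>j\<in>{x..b}. \<mu> j)) \<and>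
    (\<Sum>x\<in>{A..B}. F x powr p * \<mu> x) \<le> (p / (p - 1)) powr p * (\<Sum>x\<in>{A..B}. g x powr p * \<mu> x)"
proof -
  define av where "av x b = (\<Sum>j\<in>{x..b}. g j * \<mu> j) / (\<Sum>j\<in>{x..b}. \<mu> j)" for x b
  define F where "F x = Max (av x ` {x..B})" for x
  have pos: "(\<Sum>j\<in>{x..b}. \<mu> j) > 0" if "x \<in> {A..B}" "b \<in> {x..B}" for x b
    using that by (intro sum_pos \<mu>) auto
  have avF: "av x b \<le> F x" if "b \<in> {x..B}" for x b
    unfolding F_def using that by (intro Max_ge) auto
  have av0: "0 \<le> av x b" if "x \<in> {A..B}" "b \<in> {x..B}" for x b
    unfolding av_def using that pos[OF that] 
    by (intro divide_nonneg_pos sum_nonneg mult_nonneg_nonneg g less_imp_le[OF \<mu>]) auto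
  have F0: "0 \<le> F x" if "x \<in> {A..B}" for x
    using av0[OF that, of x] avF[of x x] that by auto
  have F1: "(\<Sum>j\<in>{x..b}. g j * \<mu> j) \<le> F x * (\<Sum>j\<in>{x..b}. \<mu> j)" if "x \<in> {A..B}" "b \<in> {x..B}" for x b
    using avF[OF that(2)] pos[OF that] unfolding av_def by (simp add: pos_divide_le_eq)
  have level: "(\<Sum>x\<in>{x\<in>{A..B}. t < F x}. \<mu> x) * t \<le> (\<Sum>x\<in>{x\<in>{A..B}. t < F x}. g x * \<mu> x)" for t
  proof -
    have E: "{x\<in>{A..B}. t < F x} = {x\<in>{A..B}. \<exists>b\<in>{x..B}. (\<Sum>j\<in>{x..b}. (g j - t) * \<mu> j) > 0}"
    proof (intro Collect_cong conj_cong refl)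
      fix x assume x: "x \<in> {A..B}"
      have "t < F x \<longleftrightarrow> (\<exists>b\<in>{x..B}. t < av x b)"
        unfolding F_def using x by (subst Max_gr_iff) auto
      also have "\<dots> \<longleftrightarrow> (\<exists>b\<in>{x..B}. (\<Sum>j\<in>{x..b}. (g j - t) * \<mu> j) > 0)"
        using pos[OF x]
        by (intro bex_cong refl) (simp add: av_def pos_less_divide_eq left_diff_distrib sum_subtractf sum_distrib_left)
      finally show "t < F x \<longleftrightarrow> (\<exists>b\<in>{x..B}. (\<Sum>j\<in>{x..b}. (g j - t) * \<mu> j) > 0)" .
    qed
    have "(\<Sum>x\<in>{x\<in>{A..B}. t < F x}. (g x - t) * \<mu> x) \<ge> 0"
      unfolding E by (rule rising_sun)
    then show ?thesis by (simp add: algebra_simps sum_subtractf sum_distrib_left)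
  qed
  have "(\<Sum>x\<in>{A..B}. \<mu> x * F x powr ((p - 1) + 1)) / ((p - 1) + 1)
      \<le> (\<Sum>x\<in>{A..B}. (g x * \<mu> x) * F x powr (p - 1)) / (p - 1)"
    by (rule layer_cake_comparison) (use p F0 level in auto)
  then have "(\<Sum>x\<in>{A..B}. \<mu> x * F x powr p) \<le> p / (p - 1) * (\<Sum>x\<in>{A..B}. (g x * \<mu> x) * F x powr (p - 1))"
    using p by (simp add: field_simps)
  also have "(\<Sum>x\<in>{A..B}. (g x * \<mu> x) * F x powr (p - 1)) =
     (\<Sum>x\<in>{A..B}. (g x powr p * \<mu> x) powr (1 / p) * (F x powr p * \<mu> x) powr (1 - 1 / p))"
  proof (intro sum.cong refl)
    fix x assume x: "x \<in> {A..B}"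
    have "\<mu> x = \<mu> x powr (1 / p) * \<mu> x powr (1 - 1 / p)"
      using \<mu>[OF x] by (simp flip: powr_add)
    moreover have "p * (1 - 1 / p) = p - 1" using p by (simp add: field_simps)
    ultimately show "(g x * \<mu> x) * F x powr (p - 1)
      = (g x powr p * \<mu> x) powr (1 / p) * (F x powr p * \<mu> x) powr (1 - 1 / p)"
      using g[OF x] \<mu>[OF x] F0[OF x] p by (simp add: powr_mult powr_powr)
  qed
  also have "p / (p - 1) * \<dots> \<le> p / (p - 1) * ((\<Sum>x\<in>{A..B}. g x powr p * \<mu> x) powr (1 / p) *
      (\<Sum>x\<in>{A..B}. F x powr p * \<mu> x) powr (1 - 1 / p))"
    by (intro mult_left_mono Hoelder_sum2 mult_nonneg_nonneg) (use p \<mu> in \<open>auto simp: less_imp_le\<close>)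
  finally have main: "S \<le> p / (p - 1) * (T powr (1 / p) * S powr (1 - 1 / p))"
    if "S = (\<Sum>x\<in>{A..B}. F x powr p * \<mu> x)" "T = (\<Sum>x\<in>{A..B}. g x powr p * \<mu> x)" for S T
    by (simp add: mult.commute that)
  define S where "S = (\<Sum>x\<in>{A..B}. F x powr p * \<mu> x)"
  define T where "T = (\<Sum>x\<in>{A..B}. g x powr p * \<mu> x)"
  have S0: "S \<ge> 0" and T0: "T \<ge> 0"
    unfolding S_def T_def by (intro sum_nonneg mult_nonneg_nonneg less_imp_le[OF \<mu>]; simp)+
  have "S \<le> (p / (p - 1)) powr p * T"
  proof (cases "S = 0")
    case False
    then have S: "S > 0" using S0 by simp
    \<comment> \<open>The factor S^(1-1/p) occurs on both sides of the estimate; it is finite and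
      positive, so it may be cancelled.\<close>
    have "S powr (1 / p) * S powr (1 - 1 / p) = S"
      using S by (simp flip: powr_add)
    then have "S powr (1 / p) * S powr (1 - 1 / p) \<le> (p / (p - 1) * T powr (1 / p)) * S powr (1 - 1 / p)"
      using main[OF S_def T_def] by (metis mult.assoc)
    then have "S powr (1 / p) \<le> p / (p - 1) * T powr (1 / p)"
      by (rule mult_right_le_imp_le) (use S in simp)
    then have "(S powr (1 / p)) powr p \<le> (p / (p - 1) * T powr (1 / p)) powr p"
      using p by (intro powr_mono2) auto
    moreover have "(p / (p - 1) * T powr (1 / p)) powr p = (p / (p - 1)) powr p * T"
      using p T0 by (subst powr_mult) (auto simp: powr_powr)
    ultimately show ?thesis using S p by (simp add: powr_powr)
  qed (use T0 in simp)
  then show ?thesis using F0 F1 unfolding S_def T_def by (intro exI[of _ F]) auto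
qed

text \<open>An interval around x is cut at x into a left and a right piece; the left maximal
  function is the right one after reflection. Since each piece is compared with its own measure,
  \<mu> need not be doubling. The constant is that of \<open>powr_add_le\<close> applied to the sum
  of the two majorants.\<close>

lemma uncentred_maximal_bound:
  fixes \<mu> g :: "int \<Rightarrow> real" and p :: real
  assumes \<mu>: "\<And>x. x \<in> {A..B} \<Longrightarrow> 0 < \<mu> x" and g: "\<And>x. x \<in> {A..B} \<Longrightarrow> 0 \<le> g x" and p: "1 < p"
  shows "\<exists>F. (\<forall>x\<in>{A..B}. 0 \<le> F x) \<and>
    (\<forall>x\<in>{A..B}. \<forall>a\<in>{A..x}. \<forall>b\<in>{x..B}. (\<Sum>j\<in>{a..b}. g j * \<mu> j) \<le> F x * (\<Sum>j\<in>{a..b}. \<mu> j)) \<and>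
    (\<Sum>x\<in>{A..B}. F x powr p * \<mu> x) \<le> 2 * (2 * p / (p - 1)) powr p * (\<Sum>x\<in>{A..B}. g x powr p * \<mu> x)"
proof -
  have "\<exists>F. (\<forall>x\<in>{A..B}. 0 \<le> F x) \<and>
    (\<forall>x\<in>{A..B}. \<forall>b\<in>{x..B}. (\<Sum>j\<in>{x..b}. g j * \<mu> j) \<le> F x * (\<Sum>j\<in>{x..b}. \<mu> j)) \<and>
    (\<Sum>x\<in>{A..B}. F x powr p * \<mu> x) \<le> (p / (p - 1)) powr p * (\<Sum>x\<in>{A..B}. g x powr p * \<mu> x)"
    by (rule right_maximal_bound) (use assms in auto)
  then obtain F1 where F1: "\<forall>x\<in>{A..B}. 0 \<le> F1 x"
     "\<forall>x\<in>{A..B}. \<forall>b\<in>{x..B}. (\<Sum>j\<in>{x..b}. g j * \<mu> j) \<le> F1 x * (\<Sum>j\<in>{x..b}. \<mu> j)"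
     "(\<Sum>x\<in>{A..B}. F1 x powr p * \<mu> x) \<le> (p / (p - 1)) powr p * (\<Sum>x\<in>{A..B}. g x powr p * \<mu> x)"
    by (elim exE conjE)
  have "\<exists>F. (\<forall>x\<in>{-B..-A}. 0 \<le> F x) \<and>
    (\<forall>x\<in>{-B..-A}. \<forall>b\<in>{x..-A}. (\<Sum>j\<in>{x..b}. g (-j) * \<mu> (-j)) \<le> F x * (\<Sum>j\<in>{x..b}. \<mu> (-j))) \<and>
    (\<Sum>x\<in>{-B..-A}. F x powr p * \<mu> (-x)) \<le> (p / (p - 1)) powr p * (\<Sum>x\<in>{-B..-A}. g (-x) powr p * \<mu> (-x))"
    by (rule right_maximal_bound) (use assms in auto)
  then obtain F2 where F2: "\<forall>x\<in>{-B..-A}. 0 \<le> F2 x"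
     "\<forall>x\<in>{-B..-A}. \<forall>b\<in>{x..-A}. (\<Sum>j\<in>{x..b}. g (-j) * \<mu> (-j)) \<le> F2 x * (\<Sum>j\<in>{x..b}. \<mu> (-j))"
     "(\<Sum>x\<in>{-B..-A}. F2 x powr p * \<mu> (-x)) \<le> (p / (p - 1)) powr p * (\<Sum>x\<in>{-B..-A}. g (-x) powr p * \<mu> (-x))"
    by (elim exE conjE)
  define F where "F x = F1 x + F2 (- x)" for x
  have F20: "0 \<le> F2 (- x)" if "x \<in> {A..B}" for x using F2(1) that by auto
  have "(\<Sum>j\<in>{a..b}. g j * \<mu> j) \<le> F x * (\<Sum>j\<in>{a..b}. \<mu> j)"
    if x: "x \<in> {A..B}" and a: "a \<in> {A..x}" and b: "b \<in> {x..B}" for x a b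
  proof -
    have \<mu>ab: "0 \<le> \<mu> j" "0 \<le> g j * \<mu> j" if "j \<in> {a..b}" for j
      using that a b \<mu>[of j] g[of j] by (auto simp: less_imp_le)
    have L: "(\<Sum>j\<in>{a..x}. g j * \<mu> j) \<le> F2 (-x) * (\<Sum>j\<in>{a..x}. \<mu> j)"
      using F2(2)[rule_format, of "-x" "-a"] x a sum_int_reflect[of "\<lambda>j. g j * \<mu> j" "-x" "-a"]
        sum_int_reflect[of \<mu> "-x" "-a"] by auto
    have R: "(\<Sum>j\<in>{x..b}. g j * \<mu> j) \<le> F1 x * (\<Sum>j\<in>{x..b}. \<mu> j)"
      using F1(2) x b by auto
    \<comment> \<open>The point x is counted in both pieces, which only enlarges the upper
      bound.\<close>
    have "(\<Sum>j\<in>{a..b}. g j * \<mu> j) \<le> (\<Sum>j\<in>{a..x} \<union> {x..b}. g j * \<mu> j)"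
      using a b by (intro sum_mono2) (auto intro!: \<mu>ab)
    also have "\<dots> \<le> (\<Sum>j\<in>{a..x}. g j * \<mu> j) + (\<Sum>j\<in>{x..b}. g j * \<mu> j)"
      by (subst sum_Un) (use a b \<mu>ab in \<open>auto intro!: sum_nonneg\<close>)
    also have "\<dots> \<le> F2 (-x) * (\<Sum>j\<in>{a..x}. \<mu> j) + F1 x * (\<Sum>j\<in>{x..b}. \<mu> j)"
      using L R by simp
    also have "\<dots> \<le> F2 (-x) * (\<Sum>j\<in>{a..b}. \<mu> j) + F1 x * (\<Sum>j\<in>{a..b}. \<mu> j)"
      using a b by (intro add_mono mult_left_mono sum_mono2 F1(1)[rule_format] F20 x) (auto intro!: \<mu>ab)
    finally show ?thesis by (simp add: F_def algebra_simps)
  qed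
  moreover have "(\<Sum>x\<in>{A..B}. F x powr p * \<mu> x) \<le> 2 * (2 * p / (p - 1)) powr p * (\<Sum>x\<in>{A..B}. g x powr p * \<mu> x)"
  proof -
    have "(\<Sum>x\<in>{A..B}. F x powr p * \<mu> x) \<le> (\<Sum>x\<in>{A..B}. 2 powr p * (F1 x powr p + F2 (-x) powr p) * \<mu> x)"
      unfolding F_def by (intro sum_mono mult_right_mono powr_add_le F1(1)[rule_format] F20 less_imp_le[OF \<mu>]) (use p in auto)
    also have "\<dots> = 2 powr p * ((\<Sum>x\<in>{A..B}. F1 x powr p * \<mu> x) + (\<Sum>x\<in>{A..B}. F2 (-x) powr p * \<mu> x))"
      by (simp add: sum.distrib sum_distrib_left algebra_simps)
    also have "\<dots> \<le> 2 powr p * ((p / (p - 1)) powr p * (\<Sum>x\<in>{A..B}. g x powr p * \<mu> x) + (p / (p - 1)) powr p * (\<Sum>x\<in>{A..B}. g x powr p * \<mu> x))"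
      using F1(3) F2(3) sum_int_reflect[of "\<lambda>x. F2 (-x) powr p * \<mu> x" "-B" "-A"]
        sum_int_reflect[of "\<lambda>x. g x powr p * \<mu> x" "-B" "-A"]
      by (intro mult_left_mono add_mono) auto
    also have "\<dots> = 2 * (2 powr p * (p / (p - 1)) powr p) * (\<Sum>x\<in>{A..B}. g x powr p * \<mu> x)" by simp
    also have "2 powr p * (p / (p - 1)) powr p = (2 * p / (p - 1)) powr p"
      using p by (subst powr_mult[symmetric]) (auto simp: algebra_simps)
    finally show ?thesis .
  qed
  ultimately show ?thesis using F1(1) F20 by (intro exI[of _ F]) (auto simp: F_def)
qed

section \<open>Discrete Muckenhoupt weights and the strong maximal function\<close>

text \<open>The p-th power of the norm bound in \<open>uncentred_maximal_bound\<close>, common to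
  all measures.\<close>

definition doob_const :: "real \<Rightarrow> real" where
  "doob_const p = 2 * (2 * p / (p - 1)) powr p"

text \<open>One Doob factor comes from the maximal function with respect to the dual weight
  (exponent s), one from that with respect to v (exponent s'), and the power of \<open>K\<close>
  from raising (K H)^(1/(s-1)) to the power s.\<close>

definition A_maximal_const :: "real \<Rightarrow> real \<Rightarrow> real" where
  "A_maximal_const s K = K powr (s / (s - 1)) * doob_const (s / (s - 1)) * doob_const s"

lemma doob_const_nonneg: "0 \<le> doob_const p" by (simp add: doob_const_def)

lemma A_maximal_const_nonneg: "0 \<le> A_maximal_const s K"
  by (simp add: A_maximal_const_def doob_const_nonneg)

(* Lerner's argument: with maximal functions F of f / sigma with respect to sigma and
   H of F^(s-1) / v with respect to v, the averages of f are at most (K H)^(1/(s-1)). *)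
lemma A_weight_maximal_bound_1d:
  fixes v f :: "int \<Rightarrow> real" and s K :: real
  assumes v: "\<And>x. x \<in> {A..B} \<Longrightarrow> 0 < v x" and f: "\<And>x. x \<in> {A..B} \<Longrightarrow> 0 \<le> f x"
    and s: "1 < s" and K: "0 < K"
    and Aw: "\<And>a b. \<lbrakk>A \<le> a; a \<le> b; b \<le> B\<rbrakk> \<Longrightarrow>
      (\<Sum>j\<in>{a..b}. v j) * (\<Sum>j\<in>{a..b}. v j powr (- 1 / (s - 1))) powr (s - 1)
        \<le> K * real_of_int (b - a + 1) powr s"
  shows "\<exists>G. (\<forall>x\<in>{A..B}. 0 \<le> G x) \<and>
    (\<forall>x\<in>{A..B}. \<forall>a\<in>{A..x}. \<forall>b\<in>{x..B}. (\<Sum>j\<in>{a..b}. f j) \<le> G x * real_of_int (b - a + 1)) \<and>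
    (\<Sum>x\<in>{A..B}. G x powr s * v x) \<le> A_maximal_const s K * (\<Sum>x\<in>{A..B}. f x powr s * v x)"
proof -
  define \<sigma> where "\<sigma> j = v j powr (- 1 / (s - 1))" for j
  have \<sigma>: "0 < \<sigma> x" if "x \<in> {A..B}" for x using v[OF that] by (simp add: \<sigma>_def)
  define s' where "s' = s / (s - 1)"
  have s': "1 < s'" using s by (simp add: s'_def field_simps)
  have "\<exists>F. (\<forall>x\<in>{A..B}. 0 \<le> F x) \<and>
    (\<forall>x\<in>{A..B}. \<forall>a\<in>{A..x}. \<forall>b\<in>{x..B}. (\<Sum>j\<in>{a..b}. f j / \<sigma> j * \<sigma> j) \<le> F x * (\<Sum>j\<in>{a..b}. \<sigma> j)) \<and>
    (\<Sum>x\<in>{A..B}. F x powr s * \<sigma> x) \<le> 2 * (2 * s / (s - 1)) powr s * (\<Sum>x\<in>{A..B}. (f x / \<sigma> x) powr s * \<sigma> x)"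
    by (rule uncentred_maximal_bound[OF \<sigma> _ s]) (use f \<sigma> in \<open>auto simp: less_imp_le\<close>)
  then obtain F where F0: "\<forall>x\<in>{A..B}. 0 \<le> F x"
    and F1: "\<forall>x\<in>{A..B}. \<forall>a\<in>{A..x}. \<forall>b\<in>{x..B}. (\<Sum>j\<in>{a..b}. f j / \<sigma> j * \<sigma> j) \<le> F x * (\<Sum>j\<in>{a..b}. \<sigma> j)"
    and F2: "(\<Sum>x\<in>{A..B}. F x powr s * \<sigma> x) \<le> doob_const s * (\<Sum>x\<in>{A..B}. (f x / \<sigma> x) powr s * \<sigma> x)"
    unfolding doob_const_def by (elim exE conjE)
  define h where "h x = F x powr (s - 1) / v x" for x
  have "\<exists>H. (\<forall>x\<in>{A..B}. 0 \<le> H x) \<and>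
    (\<forall>x\<in>{A..B}. \<forall>a\<in>{A..x}. \<forall>b\<in>{x..B}. (\<Sum>j\<in>{a..b}. h j * v j) \<le> H x * (\<Sum>j\<in>{a..b}. v j)) \<and>
    (\<Sum>x\<in>{A..B}. H x powr s' * v x) \<le> 2 * (2 * s' / (s' - 1)) powr s' * (\<Sum>x\<in>{A..B}. h x powr s' * v x)"
    by (rule uncentred_maximal_bound[OF v _ s']) (use v in \<open>auto simp: h_def less_imp_le\<close>)
  then obtain H where H0: "\<forall>x\<in>{A..B}. 0 \<le> H x"
    and H1: "\<forall>x\<in>{A..B}. \<forall>a\<in>{A..x}. \<forall>b\<in>{x..B}. (\<Sum>j\<in>{a..b}. h j * v j) \<le> H x * (\<Sum>j\<in>{a..b}. v j)"
    and H2: "(\<Sum>x\<in>{A..B}. H x powr s' * v x) \<le> doob_const s' * (\<Sum>x\<in>{A..B}. h x powr s' * v x)"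
    unfolding doob_const_def by (elim exE conjE)
  define G where "G x = (K * H x) powr (1 / (s - 1))" for x
  \<comment> \<open>Since \<sigma>^(1-s) = v, dividing by \<sigma> carries f from L^s(v) to
    L^s(\<sigma>) without changing the norm.\<close>
  have fv: "(f x / \<sigma> x) powr s * \<sigma> x = f x powr s * v x" if x: "x \<in> {A..B}" for x
  proof -
    have "\<sigma> x powr s = \<sigma> x * \<sigma> x powr (s - 1)"
      using \<sigma>[OF x] by (simp add: powr_mult_base)
    also have "\<sigma> x powr (s - 1) = v x powr (-1)"
      using s by (simp add: \<sigma>_def powr_powr)
    also have "\<dots> = 1 / v x" using v[OF x] by (simp add: powr_minus_divide)
    finally show ?thesis using \<sigma>[OF x] f[OF x] v[OF x]
      by (simp add: powr_divide field_simps)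
  qed
  \<comment> \<open>Since v^(1-s') = \<sigma>, the L^s'(v) sum of h is the L^s(\<sigma>) sum of F,
    so the two maximal inequalities can be chained.\<close>
  have hF: "h x powr s' * v x = F x powr s * \<sigma> x" if x: "x \<in> {A..B}" for x
  proof -
    have "h x powr s' = F x powr s / v x powr s'"
      using F0 x v[OF x] s by (simp add: h_def powr_divide powr_powr s'_def)
    moreover have "v x / v x powr s' = v x powr (1 - s')"
      using v[OF x] by (simp add: powr_diff)
    moreover have "1 - s' = -1 / (s - 1)" using s by (simp add: s'_def field_simps)
    ultimately show ?thesis unfolding \<sigma>_def by (metis times_divide_eq_left times_divide_eq_right)
  qed
  have maj: "(\<Sum>j\<in>{a..b}. f j) \<le> G x * real_of_int (b - a + 1)"
    if x: "x \<in> {A..B}" and a: "a \<in> {A..x}" and b: "b \<in> {x..B}" for x a b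
  proof -
    define N where "N = real_of_int (b - a + 1)"
    define f0 \<sigma>0 v0 where "f0 = (\<Sum>j\<in>{a..b}. f j)" and "\<sigma>0 = (\<Sum>j\<in>{a..b}. \<sigma> j)" and "v0 = (\<Sum>j\<in>{a..b}. v j)"
    have N: "N > 0" using a b by (simp add: N_def)
    have \<sigma>0: "\<sigma>0 > 0" unfolding \<sigma>0_def using a b by (intro sum_pos \<sigma>) auto
    have v0: "v0 > 0" unfolding v0_def using a b by (intro sum_pos v) auto
    have f0: "f0 \<ge> 0" unfolding f0_def using a b by (intro sum_nonneg f) auto
    \<comment> \<open>The lower bound for F holds at every y of the interval, not only at x;
      averaging its power over y produces a v-average of h, which H x controls.\<close>
    have fF: "f0 / \<sigma>0 \<le> F y" if y: "y \<in> {a..b}" for y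
    proof -
      have "(\<Sum>j\<in>{a..b}. f j / \<sigma> j * \<sigma> j) = f0"
        unfolding f0_def
      proof (intro sum.cong refl)
        fix j assume "j \<in> {a..b}"
        then have "\<sigma> j > 0" using a b by (intro \<sigma>) auto
        then show "f j / \<sigma> j * \<sigma> j = f j" by simp
      qed
      moreover have "(\<Sum>j\<in>{a..b}. f j / \<sigma> j * \<sigma> j) \<le> F y * \<sigma>0"
        unfolding \<sigma>0_def using F1 y a b by auto
      ultimately show ?thesis using \<sigma>0 by (simp add: pos_divide_le_eq)
    qed
    have "N * (f0 / \<sigma>0) powr (s - 1) = (\<Sum>y\<in>{a..b}. (f0 / \<sigma>0) powr (s - 1))"
      using a b by (simp add: N_def)
    also have "\<dots> \<le> (\<Sum>y\<in>{a..b}. F y powr (s - 1))"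
      by (intro sum_mono powr_mono2 fF) (use s f0 \<sigma>0 in auto)
    also have "\<dots> = (\<Sum>y\<in>{a..b}. h y * v y)"
    proof (intro sum.cong refl)
      fix j assume "j \<in> {a..b}"
      then have "v j > 0" using a b by (intro v) auto
      then show "F j powr (s - 1) = h j * v j" by (simp add: h_def)
    qed
    also have "\<dots> \<le> H x * v0" unfolding v0_def using H1 x a b by auto
    finally have "N * (f0 / \<sigma>0) powr (s - 1) \<le> H x * v0" .
    then have "N * f0 powr (s - 1) \<le> H x * (v0 * \<sigma>0 powr (s - 1))"
      using \<sigma>0 f0 by (simp add: powr_divide field_simps)
    also have "\<dots> \<le> H x * (K * N powr s)"
      using Aw[of a b] a b x H0 unfolding v0_def \<sigma>0_def N_def \<sigma>_def by (intro mult_left_mono) auto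
    also have "N powr s = N * N powr (s - 1)" using N by (simp add: powr_mult_base)
    finally have "f0 powr (s - 1) \<le> K * H x * N powr (s - 1)"
      using N by (simp add: mult.left_commute mult.assoc)
    then have "(f0 powr (s - 1)) powr (1 / (s - 1)) \<le> (K * H x * N powr (s - 1)) powr (1 / (s - 1))"
      using s by (intro powr_mono2) auto
    also have "\<dots> = G x * N"
      unfolding G_def using K H0 x N s by (subst powr_mult) (auto simp: powr_powr)
    finally show ?thesis using f0 s by (simp add: powr_powr f0_def N_def)
  qed
  have "(\<Sum>x\<in>{A..B}. G x powr s * v x) = K powr s' * (\<Sum>x\<in>{A..B}. H x powr s' * v x)"
    unfolding sum_distrib_left G_def using K H0
    by (intro sum.cong refl) (auto simp: powr_powr powr_mult s'_def)
  also have "\<dots> \<le> K powr s' * (doob_const s' * (\<Sum>x\<in>{A..B}. h x powr s' * v x))"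
    by (intro mult_left_mono H2) auto
  also have "(\<Sum>x\<in>{A..B}. h x powr s' * v x) = (\<Sum>x\<in>{A..B}. F x powr s * \<sigma> x)"
    by (intro sum.cong hF refl)
  also have "K powr s' * (doob_const s' * \<dots>) \<le> K powr s' * (doob_const s' *
      (doob_const s * (\<Sum>x\<in>{A..B}. (f x / \<sigma> x) powr s * \<sigma> x)))"
    by (intro mult_left_mono F2 doob_const_nonneg) auto
  also have "(\<Sum>x\<in>{A..B}. (f x / \<sigma> x) powr s * \<sigma> x) = (\<Sum>x\<in>{A..B}. f x powr s * v x)"
    by (intro sum.cong fv refl)
  finally have "(\<Sum>x\<in>{A..B}. G x powr s * v x) \<le> A_maximal_const s K * (\<Sum>x\<in>{A..B}. f x powr s * v x)"
    by (simp add: A_maximal_const_def s'_def mult_ac)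
  then show ?thesis using maj by (intro exI[of _ G]) (auto simp: G_def)
qed

section \<open>Boxes of lattice points as order intervals, and the iteration over
  coordinates\<close>

lemma fun_atLeastAtMost_eq_PiE:
  fixes a b :: "'n::finite \<Rightarrow> int"
  shows "{a..b} = (\<Pi>\<^sub>E i\<in>UNIV. {a i..b i})"
  by (auto simp: le_fun_def PiE_iff)

lemma finite_fun_atLeastAtMost [simp]:
  fixes a b :: "'n::finite \<Rightarrow> int"
  shows "finite {a..b}"
  unfolding fun_atLeastAtMost_eq_PiE by (intro finite_PiE) auto

lemma card_fun_atLeastAtMost:
  fixes a b :: "'n::finite \<Rightarrow> int"
  shows "card {a..b} = (\<Prod>i\<in>UNIV. nat (b i - a i + 1))"
  unfolding fun_atLeastAtMost_eq_PiE by (subst card_PiE) auto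

text \<open>The swap (k, j) to (k(i := j), k i) is an involution of box times side, so every point
  is met once for each point of its line. This allows summing over lines without choosing
  representatives; the side length cancels later.\<close>

lemma sum_lines:
  fixes \<Phi> :: "('n::finite \<Rightarrow> int) \<Rightarrow> real"
  shows "(\<Sum>k\<in>{lo..hi}. \<Sum>j\<in>{lo i..hi i}. \<Phi> (k(i := j))) = real (nat (hi i - lo i + 1)) * (\<Sum>k\<in>{lo..hi}. \<Phi> k)"
proof -
  have "(\<Sum>k\<in>{lo..hi}. \<Sum>j\<in>{lo i..hi i}. \<Phi> (k(i := j))) = (\<Sum>(k, j)\<in>{lo..hi} \<times> {lo i..hi i}. \<Phi> (k(i := j)))"
    by (simp add: sum.cartesian_product)
  also have "\<dots> = (\<Sum>(k, j)\<in>{lo..hi} \<times> {lo i..hi i}. \<Phi> k)"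
    by (rule sum.reindex_bij_witness[of _ "\<lambda>(k, j). (k(i := j), k i)" "\<lambda>(k, j). (k(i := j), k i)"])
      (auto simp: le_fun_def)
  also have "\<dots> = (\<Sum>k\<in>{lo..hi}. \<Sum>j\<in>{lo i..hi i}. \<Phi> k)"
    by (simp only: sum.cartesian_product)
  also have "\<dots> = real (nat (hi i - lo i + 1)) * (\<Sum>k\<in>{lo..hi}. \<Phi> k)"
    by (simp add: sum_distrib_left)
  finally show ?thesis .
qed

text \<open>The coordinates in \<open>S\<close> range over the box, the others are frozen at
  \<open>k\<close>. As an order interval with degenerate sides it interpolates between the point k
  (\<open>S\<close> empty) and the full box \<open>{a..b}\<close> (\<open>S = UNIV\<close>).\<close>

definition slab :: "'n set \<Rightarrow> ('n \<Rightarrow> int) \<Rightarrow> ('n \<Rightarrow> int) \<Rightarrow> ('n \<Rightarrow> int) \<Rightarrow> ('n \<Rightarrow> int) set" where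
  "slab S k a b = {(\<lambda>i. if i \<in> S then a i else k i)..(\<lambda>i. if i \<in> S then b i else k i)}"

lemma finite_slab [simp]: "finite (slab S k a b)" for k :: "'n::finite \<Rightarrow> int"
  by (simp add: slab_def)

lemma card_slab:
  fixes k :: "'n::finite \<Rightarrow> int"
  shows "card (slab S k a b) = (\<Prod>i\<in>S. nat (b i - a i + 1))"
proof -
  have "card (slab S k a b) = (\<Prod>i\<in>UNIV. if i \<in> S then nat (b i - a i + 1) else 1)"
    unfolding slab_def card_fun_atLeastAtMost by (intro prod.cong) auto
  also have "\<dots> = (\<Prod>i\<in>S. nat (b i - a i + 1))"
    by (subst prod.inter_restrict[symmetric]) auto
  finally show ?thesis .
qed

lemma mem_slab:
  "x \<in> slab S k a b \<longleftrightarrow> (\<forall>l. if l \<in> S then a l \<le> x l \<and> x l \<le> b l else x l = k l)"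
proof -
  have "x \<in> slab S k a b \<longleftrightarrow>
    (\<forall>l. (if l \<in> S then a l else k l) \<le> x l \<and> x l \<le> (if l \<in> S then b l else k l))"
    by (auto simp: slab_def le_fun_def)
  also have "\<dots> \<longleftrightarrow> (\<forall>l. if l \<in> S then a l \<le> x l \<and> x l \<le> b l else x l = k l)"
    by (intro all_cong1) auto
  finally show ?thesis .
qed

lemma slab_insert:
  assumes "i \<notin> S"
  shows "slab (insert i S) k a b = (\<Union>j\<in>{a i..b i}. slab S (k(i := j)) a b)"
proof (intro set_eqI iffI)
  fix x assume "x \<in> slab (insert i S) k a b"
  then have x: "\<And>l. if l \<in> insert i S then a l \<le> x l \<and> x l \<le> b l else x l = k l"
    by (simp add: mem_slab)
  have "x i \<in> {a i..b i}" using x[of i] by simp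
  moreover have "x \<in> slab S (k(i := x i)) a b"
    unfolding mem_slab using x assms by (metis fun_upd_apply insert_iff)
  ultimately show "x \<in> (\<Union>j\<in>{a i..b i}. slab S (k(i := j)) a b)" by blast
next
  fix x assume "x \<in> (\<Union>j\<in>{a i..b i}. slab S (k(i := j)) a b)"
  then obtain j where j: "j \<in> {a i..b i}"
    and x: "\<And>l. if l \<in> S then a l \<le> x l \<and> x l \<le> b l else x l = (k(i := j)) l"
    by (auto simp: mem_slab)
  show "x \<in> slab (insert i S) k a b"
    unfolding mem_slab
  proof
    fix l show "if l \<in> insert i S then a l \<le> x l \<and> x l \<le> b l else x l = k l"
      using x[of l] j assms by (cases "l = i") auto
  qed
qed

text \<open>Induction on the set of free directions: a new direction i applies the one-dimensional
  theorem on each i-line to the majorant \<open>G\<close> found so far, and costs one factor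
  \<open>A_maximal_const s K\<close>. The A_s condition on a line is the hypothesis for boxes that
  are one cell wide in all other directions.\<close>

lemma A_weight_slab_maximal_bound:
  fixes v f :: "('n::finite \<Rightarrow> int) \<Rightarrow> real" and s K :: real and lo hi :: "'n \<Rightarrow> int"
  assumes v: "\<And>k. k \<in> {lo..hi} \<Longrightarrow> 0 < v k" and f: "\<And>k. k \<in> {lo..hi} \<Longrightarrow> 0 \<le> f k"
    and s: "1 < s" and K: "0 < K"
    and Aw: "\<And>a b. \<lbrakk>lo \<le> a; a \<le> b; b \<le> hi\<rbrakk> \<Longrightarrow>
      (\<Sum>k\<in>{a..b}. v k) * (\<Sum>k\<in>{a..b}. v k powr (- 1 / (s - 1))) powr (s - 1)
        \<le> K * real (card {a..b}) powr s"
  shows "\<exists>G. (\<forall>k\<in>{lo..hi}. 0 \<le> G k) \<and>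
    (\<forall>k\<in>{lo..hi}. \<forall>a\<in>{lo..k}. \<forall>b\<in>{k..hi}. (\<Sum>j\<in>slab S k a b. f j) \<le> G k * real (card (slab S k a b))) \<and>
    (\<Sum>k\<in>{lo..hi}. G k powr s * v k) \<le> A_maximal_const s K ^ card S * (\<Sum>k\<in>{lo..hi}. f k powr s * v k)"
proof -
  have "finite S" by simp
  then show ?thesis
  proof (induction S)
    case empty
    have "slab {} k a b = {k}" for k a b :: "'n \<Rightarrow> int" by (simp add: slab_def)
    then show ?case using f by (intro exI[of _ f]) simp
  next
    case (insert i S)
    from insert.IH obtain G where G0: "\<forall>k\<in>{lo..hi}. 0 \<le> G k"
      and G1: "\<forall>k\<in>{lo..hi}. \<forall>a\<in>{lo..k}. \<forall>b\<in>{k..hi}. (\<Sum>j\<in>slab S k a b. f j) \<le> G k * real (card (slab S k a b))"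
      and G2: "(\<Sum>k\<in>{lo..hi}. G k powr s * v k) \<le> A_maximal_const s K ^ card S * (\<Sum>k\<in>{lo..hi}. f k powr s * v k)"
      by (elim exE conjE)
    \<comment> \<open>The choice below yields a majorant for each k, possibly different for two
      points of one line. Resetting the i-th coordinate to \<open>lo i\<close> selects a single
      majorant per line.\<close>
    define c0 where "c0 k = k(i := lo i)" for k :: "'n \<Rightarrow> int"
    have upd: "k(i := j) \<in> {lo..hi}" if "k \<in> {lo..hi}" "j \<in> {lo i..hi i}" for k j
      using that by (auto simp: le_fun_def)
    have "\<forall>k\<in>{lo..hi}. \<exists>H. (\<forall>x\<in>{lo i..hi i}. 0 \<le> H x) \<and>
      (\<forall>x\<in>{lo i..hi i}. \<forall>a\<in>{lo i..x}. \<forall>b\<in>{x..hi i}. (\<Sum>j\<in>{a..b}. G (k(i := j))) \<le> H x * real_of_int (b - a + 1)) \<and>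
      (\<Sum>x\<in>{lo i..hi i}. H x powr s * v (k(i := x))) \<le> A_maximal_const s K * (\<Sum>x\<in>{lo i..hi i}. G (k(i := x)) powr s * v (k(i := x)))"
    proof
      fix k assume k: "k \<in> {lo..hi}"
      have line: "(\<Sum>j\<in>{a..b}. \<phi> (k(i := j))) = (\<Sum>x\<in>{k(i := a)..k(i := b)}. \<phi> x)" for a b and \<phi> :: "('n \<Rightarrow> int) \<Rightarrow> real"
      proof (rule sum.reindex_bij_witness[of _ "\<lambda>x. x i" "\<lambda>j. k(i := j)"])
        fix x assume "x \<in> {k(i := a)..k(i := b)}"
        then have "\<And>j. (k(i := a)) j \<le> x j \<and> x j \<le> (k(i := b)) j" by (auto simp: le_fun_def)
        then show "k(i := x i) = x" "x i \<in> {a..b}"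
          by (auto simp: fun_eq_iff split: if_splits intro: antisym) (smt (verit, best))+
      qed (auto simp: le_fun_def)
      show "\<exists>H. (\<forall>x\<in>{lo i..hi i}. 0 \<le> H x) \<and>
        (\<forall>x\<in>{lo i..hi i}. \<forall>a\<in>{lo i..x}. \<forall>b\<in>{x..hi i}. (\<Sum>j\<in>{a..b}. G (k(i := j))) \<le> H x * real_of_int (b - a + 1)) \<and>
        (\<Sum>x\<in>{lo i..hi i}. H x powr s * v (k(i := x))) \<le> A_maximal_const s K * (\<Sum>x\<in>{lo i..hi i}. G (k(i := x)) powr s * v (k(i := x)))"
      proof (rule A_weight_maximal_bound_1d[OF _ _ s K])
        fix a b assume ab: "lo i \<le> a" "a \<le> b" "b \<le> hi i"
        have "card {k(i := a)..k(i := b)} = nat (b - a + 1)"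
          using line[of "\<lambda>_. 1" a b] ab by simp
        then show "(\<Sum>j = a..b. v (k(i := j))) * (\<Sum>j = a..b. v (k(i := j)) powr (- 1 / (s - 1))) powr (s - 1)
            \<le> K * real_of_int (b - a + 1) powr s"
          unfolding line[of v] line[of "\<lambda>x. v x powr (- 1 / (s - 1))"]
          using Aw[of "k(i := a)" "k(i := b)"] k ab by (auto simp: le_fun_def)
      qed (use upd[OF k] v G0 in auto)
    qed
    then obtain H where H: "\<forall>k\<in>{lo..hi}. (\<forall>x\<in>{lo i..hi i}. 0 \<le> H k x) \<and>
      (\<forall>x\<in>{lo i..hi i}. \<forall>a\<in>{lo i..x}. \<forall>b\<in>{x..hi i}. (\<Sum>j\<in>{a..b}. G (k(i := j))) \<le> H k x * real_of_int (b - a + 1)) \<and>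
      (\<Sum>x\<in>{lo i..hi i}. H k x powr s * v (k(i := x))) \<le> A_maximal_const s K * (\<Sum>x\<in>{lo i..hi i}. G (k(i := x)) powr s * v (k(i := x)))"
      by (rule bchoice[THEN exE])
    define G' where "G' k = H (c0 k) (k i)" for k
    have c0: "c0 k \<in> {lo..hi}" if "k \<in> {lo..hi}" for k
      unfolding c0_def using that order_trans[of "lo i" "k i" "hi i"] by (intro upd) (auto simp: le_fun_def)
    have ki: "k i \<in> {lo i..hi i}" if "k \<in> {lo..hi}" for k using that by (auto simp: le_fun_def)
    have c0u: "(c0 k)(i := j) = k(i := j)" for k j by (simp add: c0_def)
    have G'0: "\<forall>k\<in>{lo..hi}. 0 \<le> G' k" unfolding G'_def using H c0 ki by blast
    have maj: "(\<Sum>j\<in>slab (insert i S) k a b. f j) \<le> G' k * real (card (slab (insert i S) k a b))"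
      if k: "k \<in> {lo..hi}" and a: "a \<in> {lo..k}" and b: "b \<in> {k..hi}" for k a b
    proof -
      define N where "N = real (\<Prod>i\<in>S. nat (b i - a i + 1))"
      have ab: "a i \<in> {lo i..k i}" "b i \<in> {k i..hi i}" using a b by (auto simp: le_fun_def)
      have "(\<Sum>j\<in>slab (insert i S) k a b. f j) = (\<Sum>x\<in>{a i..b i}. \<Sum>j\<in>slab S (k(i := x)) a b. f j)"
        unfolding slab_insert[OF insert(2)]
      proof (rule sum.UNION_disjoint)
        have "y i = x" if "y \<in> slab S (k(i := x)) a b" for x y
        proof -
          have "(if i \<in> S then a i else (k(i := x)) i) \<le> y i" "y i \<le> (if i \<in> S then b i else (k(i := x)) i)"
            using that unfolding slab_def atLeastAtMost_iff le_fun_def by blast+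
          then show ?thesis using insert(2) by simp
        qed
        then show "\<forall>x\<in>{a i..b i}. \<forall>y\<in>{a i..b i}. x \<noteq> y \<longrightarrow> slab S (k(i := x)) a b \<inter> slab S (k(i := y)) a b = {}"
          by blast
      qed auto
      also have "\<dots> \<le> (\<Sum>x\<in>{a i..b i}. G (k(i := x)) * N)"
      proof (rule sum_mono)
        fix x assume x: "x \<in> {a i..b i}"
        have sl: "slab S (k(i := x)) a b = slab S (k(i := x)) (a(i := x)) (b(i := x))"
          unfolding slab_def by (intro arg_cong2[where f = atLeastAtMost] ext) (use insert(2) in auto)
        have "(\<Sum>j\<in>slab S (k(i := x)) (a(i := x)) (b(i := x)). f j)
          \<le> G (k(i := x)) * real (card (slab S (k(i := x)) (a(i := x)) (b(i := x))))"
        proof -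
          have "lo i \<le> x" "x \<le> hi i" using x ab by auto
          then show ?thesis using a b k by (intro G1[rule_format] upd) (auto simp: le_fun_def)
        qed
        then show "(\<Sum>j\<in>slab S (k(i := x)) a b. f j) \<le> G (k(i := x)) * N"
          unfolding sl[symmetric] card_slab N_def .
      qed
      also have "\<dots> = (\<Sum>x\<in>{a i..b i}. G ((c0 k)(i := x))) * N"
        by (simp add: sum_distrib_right c0u)
      also have "\<dots> \<le> (G' k * real_of_int (b i - a i + 1)) * N"
        unfolding G'_def using H c0[OF k] ki[OF k] ab by (intro mult_right_mono) (auto simp: N_def intro!: prod_nonneg)
      also have "\<dots> = G' k * real (card (slab (insert i S) k a b))"
        using ab insert(1,2) by (simp add: card_slab N_def)
      finally show ?thesis .
    qed
    \<comment> \<open>Summing the line estimates over all k counts each line as often as it has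
      points; this factor is the same on both sides and is cancelled when the box is
      nonempty.\<close>
    have "real (nat (hi i - lo i + 1)) * (\<Sum>k\<in>{lo..hi}. G' k powr s * v k)
      = (\<Sum>k\<in>{lo..hi}. \<Sum>x\<in>{lo i..hi i}. G' (k(i := x)) powr s * v (k(i := x)))"
      by (rule sum_lines[symmetric])
    also have "\<dots> \<le> (\<Sum>k\<in>{lo..hi}. A_maximal_const s K * (\<Sum>x\<in>{lo i..hi i}. G (k(i := x)) powr s * v (k(i := x))))"
    proof (rule sum_mono)
      fix k assume k: "k \<in> {lo..hi}"
      have "G' (k(i := x)) = H (c0 k) x" for x by (simp add: G'_def c0_def)
      then show "(\<Sum>x\<in>{lo i..hi i}. G' (k(i := x)) powr s * v (k(i := x)))
         \<le> A_maximal_const s K * (\<Sum>x\<in>{lo i..hi i}. G (k(i := x)) powr s * v (k(i := x)))"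
        using bspec[OF H c0[OF k]] unfolding c0u by simp
    qed
    also have "\<dots> = A_maximal_const s K * (real (nat (hi i - lo i + 1)) * (\<Sum>k\<in>{lo..hi}. G k powr s * v k))"
      unfolding sum_distrib_left[symmetric] sum_lines[where \<Phi> = "\<lambda>k. G k powr s * v k"] by (rule refl)
    finally have le: "real (nat (hi i - lo i + 1)) * (\<Sum>k\<in>{lo..hi}. G' k powr s * v k)
      \<le> real (nat (hi i - lo i + 1)) * (A_maximal_const s K * (\<Sum>k\<in>{lo..hi}. G k powr s * v k))"
      by (simp only: mult.left_commute)
    have "(\<Sum>k\<in>{lo..hi}. G' k powr s * v k) \<le> A_maximal_const s K * (\<Sum>k\<in>{lo..hi}. G k powr s * v k)"
    proof (cases "{lo..hi} = {}")
      case False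
      then have "lo i \<le> hi i" unfolding atLeastatMost_empty_iff by (simp add: le_fun_def)
      then show ?thesis using le by (subst (asm) mult_le_cancel_left_pos) auto
    qed simp
    also have "\<dots> \<le> A_maximal_const s K * (A_maximal_const s K ^ card S * (\<Sum>k\<in>{lo..hi}. f k powr s * v k))"
      by (intro mult_left_mono G2 A_maximal_const_nonneg)
    also have "\<dots> = A_maximal_const s K ^ card (insert i S) * (\<Sum>k\<in>{lo..hi}. f k powr s * v k)"
      using insert by simp
    finally show ?case using G'0 maj by (intro exI[of _ G']) auto
  qed
qed

text \<open>The case of all directions free. It is applied to an indicator function with an A_s
  weight, and to the g_i with weight 1 and \<open>K = 1\<close>.\<close>

lemma A_weight_strong_maximal_bound:
  fixes v f :: "('n::finite \<Rightarrow> int) \<Rightarrow> real" and s K :: real and lo hi :: "'n \<Rightarrow> int"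
  assumes "\<And>k. k \<in> {lo..hi} \<Longrightarrow> 0 < v k" and "\<And>k. k \<in> {lo..hi} \<Longrightarrow> 0 \<le> f k"
    and "1 < s" and "0 < K"
    and "\<And>a b. \<lbrakk>lo \<le> a; a \<le> b; b \<le> hi\<rbrakk> \<Longrightarrow>
      (\<Sum>k\<in>{a..b}. v k) * (\<Sum>k\<in>{a..b}. v k powr (- 1 / (s - 1))) powr (s - 1)
        \<le> K * real (card {a..b}) powr s"
  obtains G where "\<And>k. k \<in> {lo..hi} \<Longrightarrow> 0 \<le> G k"
    "\<And>k a b. \<lbrakk>lo \<le> a; a \<le> k; k \<le> b; b \<le> hi\<rbrakk> \<Longrightarrow> (\<Sum>j\<in>{a..b}. f j) \<le> G k * real (card {a..b})"
    "(\<Sum>k\<in>{lo..hi}. G k powr s * v k)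
      \<le> A_maximal_const s K ^ CARD('n) * (\<Sum>k\<in>{lo..hi}. f k powr s * v k)"
proof -
  have slab: "slab UNIV k a b = {a..b}" for k a b :: "'n \<Rightarrow> int" by (simp add: slab_def)
  have "\<exists>G. (\<forall>k\<in>{lo..hi}. 0 \<le> G k) \<and>
    (\<forall>k\<in>{lo..hi}. \<forall>a\<in>{lo..k}. \<forall>b\<in>{k..hi}. (\<Sum>j\<in>{a..b}. f j) \<le> G k * real (card {a..b})) \<and>
    (\<Sum>k\<in>{lo..hi}. G k powr s * v k) \<le> A_maximal_const s K ^ CARD('n) * (\<Sum>k\<in>{lo..hi}. f k powr s * v k)"
    by (rule A_weight_slab_maximal_bound[where S = "UNIV :: 'n set", unfolded slab]) (fact assms)+
  then obtain G where G: "\<forall>k\<in>{lo..hi}. 0 \<le> G k"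
    "\<forall>k\<in>{lo..hi}. \<forall>a\<in>{lo..k}. \<forall>b\<in>{k..hi}. (\<Sum>j\<in>{a..b}. f j) \<le> G k * real (card {a..b})"
    "(\<Sum>k\<in>{lo..hi}. G k powr s * v k) \<le> A_maximal_const s K ^ CARD('n) * (\<Sum>k\<in>{lo..hi}. f k powr s * v k)"
    by (elim exE conjE)
  show ?thesis
  proof (rule that[of G])
    fix k a b :: "'n \<Rightarrow> int" assume "lo \<le> a" "a \<le> k" "k \<le> b" "b \<le> hi"
    then show "(\<Sum>j\<in>{a..b}. f j) \<le> G k * real (card {a..b})"
      using G(2) by (meson atLeastAtMost_iff order_trans)
  qed (use G in auto)
qed

section \<open>Scattered families\<close>

(* Greedy selection in order of decreasing c. *)
lemma scattered_subfamily:
  fixes B :: "'j \<Rightarrow> 'k set" and c :: "'j \<Rightarrow> real"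
  assumes "finite J" and fin: "\<And>j. j \<in> J \<Longrightarrow> finite (B j)"
  obtains S E where "S \<subseteq> J" "disjoint_family_on E S"
    "\<And>j. j \<in> S \<Longrightarrow> E j \<subseteq> B j" "\<And>j. j \<in> S \<Longrightarrow> card (B j) \<le> 2 * card (E j)"
    "\<And>j. j \<in> J \<Longrightarrow> card (B j) \<le> 2 * card (B j \<inter> (\<Union>i\<in>{i\<in>S. c j \<le> c i}. B i))"
proof -
  let ?P = "\<lambda>J. \<exists>S E. S \<subseteq> J \<and> disjoint_family_on E S \<and> (\<forall>j\<in>S. E j \<subseteq> B j \<and> card (B j) \<le> 2 * card (E j)) \<and>
    (\<forall>j\<in>J. card (B j) \<le> 2 * card (B j \<inter> (\<Union>i\<in>{i\<in>S. c j \<le> c i}. B i)))"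
  have "(\<forall>j\<in>J. finite (B j)) \<longrightarrow> ?P J"
    using \<open>finite J\<close>
  \<comment> \<open>Ranking by \<open>- c\<close> makes the inserted x an element with least c, so
    all rectangles kept before it have at least the value c x. The rule allows x to be in J already,
    hence the disjunction in the case split below.\<close>
  proof (induction rule: finite_ranking_induct[where f = "\<lambda>j. - c j"])
    case empty
    then show ?case by (auto simp: disjoint_family_on_def)
  next
    case (insert x J)
    show ?case
    proof
      assume fin: "\<forall>j\<in>insert x J. finite (B j)"
      then obtain S E where S: "S \<subseteq> J" and dis: "disjoint_family_on E S"
        and E: "\<forall>j\<in>S. E j \<subseteq> B j \<and> card (B j) \<le> 2 * card (E j)"
        and cov: "\<forall>j\<in>J. card (B j) \<le> 2 * card (B j \<inter> (\<Union>i\<in>{i\<in>S. c j \<le> c i}. B i))"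
        using insert.IH by auto
      have cx: "c x \<le> c j" if "j \<in> J" for j using insert.hyps(2)[OF that] by simp
      show "?P (insert x J)"
      proof (cases "x \<in> J \<or> card (B x) \<le> 2 * card (B x \<inter> \<Union> (B ` S))")
        case True
        have "{i \<in> S. c x \<le> c i} = S" using S cx by auto
        then have "card (B x) \<le> 2 * card (B x \<inter> (\<Union>i\<in>{i\<in>S. c x \<le> c i}. B i))"
          using True cov by auto
        then show ?thesis using S dis E cov by (intro exI[of _ S] exI[of _ E]) auto
      next
        case False
        \<comment> \<open>Less than half of \<open>B x\<close> is covered, so the uncovered part has
          at least half the points; it avoids all earlier E j because these lie in the kept B
          j.\<close>
        define E' where "E' = E(x := B x - \<Union> (B ` S))"
        have xS: "x \<notin> S" using False S by auto
        have E'S: "E' j = E j" if "j \<in> S" for j using that xS by (auto simp: E'_def)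
        have "card (B x) = card (B x \<inter> \<Union> (B ` S)) + card (E' x)"
          using fin by (simp add: E'_def card_Diff_subset_Int card_mono Int_commute)
        then have "card (B x) \<le> 2 * card (E' x)" using False by simp
        moreover have "disjoint_family_on E' (insert x S)"
          unfolding disjoint_family_on_insert[OF xS]
        proof
          show "E' x \<inter> \<Union> (E' ` S) = {}" using E E'S by (force simp: E'_def)
          show "disjoint_family_on E' S" using dis E'S unfolding disjoint_family_on_def by auto
        qed
        moreover have "card (B j) \<le> 2 * card (B j \<inter> (\<Union>i\<in>{i\<in>insert x S. c j \<le> c i}. B i))"
          if j: "j \<in> insert x J" for j
        proof (cases "j \<in> J")
          case True
          have "card (B j \<inter> (\<Union>i\<in>{i\<in>S. c j \<le> c i}. B i)) \<le> card (B j \<inter> (\<Union>i\<in>{i\<in>insert x S. c j \<le> c i}. B i))"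
            using fin True by (intro card_mono) auto
          then show ?thesis using cov True by force
        next
          case False
          then have "B j \<inter> (\<Union>i\<in>{i\<in>insert x S. c j \<le> c i}. B i) = B j" using j by auto
          then show ?thesis by simp
        qed
        moreover have "E' x \<subseteq> B x" by (auto simp: E'_def)
        ultimately show ?thesis using S E E'S
          by (intro exI[of _ "insert x S"] exI[of _ E']) auto
      qed
    qed
  qed
  then have "?P J" using fin by blast
  then obtain S E where SE: "S \<subseteq> J" "disjoint_family_on E S"
    "\<forall>j\<in>S. E j \<subseteq> B j \<and> card (B j) \<le> 2 * card (E j)"
    "\<forall>j\<in>J. card (B j) \<le> 2 * card (B j \<inter> (\<Union>i\<in>{i\<in>S. c j \<le> c i}. B i))"
    by (elim exE conjE)
  show ?thesis
    by (rule that[OF SE(1,2)]) (use SE(3,4) in blast)+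
qed

lemma sum_UNION_le:
  fixes f :: "'k \<Rightarrow> real"
  assumes "finite I" "\<And>i. i \<in> I \<Longrightarrow> finite (A i)" "\<And>x. x \<in> \<Union> (A ` I) \<Longrightarrow> 0 \<le> f x"
  shows "sum f (\<Union> (A ` I)) \<le> (\<Sum>i\<in>I. sum f (A i))"
  using assms
proof (induction I)
  case (insert i I)
  have "sum f (A i \<union> \<Union> (A ` I)) \<le> sum f (A i) + sum f (\<Union> (A ` I))"
    by (subst sum_Un) (use insert in \<open>auto intro!: sum_nonneg\<close>)
  also have "sum f (\<Union> (A ` I)) \<le> (\<Sum>i\<in>I. sum f (A i))"
    by (rule insert.IH) (use insert.prems in auto)
  finally show ?case using insert.hyps by simp
qed simp

text \<open>If F k > t, a box \<open>B j\<close> with c j > t contains k, and it is half covered by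
  the kept boxes with c i \<ge> c j > t, whose union is U. The hypothesis \<open>weak\<close> then
  bounds the v-mass of the level set by C v(U), hence by C times the sum of v(B i) over kept i with
  c i > t. Integrating in t gives the claim.\<close>

lemma maximal_sum_le_scattered:
  fixes B :: "'j \<Rightarrow> 'k set" and c :: "'j \<Rightarrow> real" and v F :: "'k \<Rightarrow> real"
  assumes J: "finite J" and X: "finite X" and BX: "\<And>j. j \<in> J \<Longrightarrow> B j \<subseteq> X"
    and c: "\<And>j. j \<in> J \<Longrightarrow> 0 \<le> c j" and v: "\<And>k. k \<in> X \<Longrightarrow> 0 \<le> v k" and q: "0 < q" and C: "0 \<le> C"
    and F0: "\<And>k. k \<in> X \<Longrightarrow> 0 \<le> F k"
    and F: "\<And>k. \<lbrakk>k \<in> X; 0 < F k\<rbrakk> \<Longrightarrow> \<exists>j\<in>J. k \<in> B j \<and> F k \<le> c j"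
    and weak: "\<And>U. U \<subseteq> X \<Longrightarrow>
      (\<Sum>k\<in>{k\<in>X. \<exists>j\<in>J. k \<in> B j \<and> card (B j) \<le> 2 * card (B j \<inter> U)}. v k) \<le> C * (\<Sum>k\<in>U. v k)"
  obtains S E where "S \<subseteq> J" "disjoint_family_on E S"
    "\<And>j. j \<in> S \<Longrightarrow> E j \<subseteq> B j" "\<And>j. j \<in> S \<Longrightarrow> card (B j) \<le> 2 * card (E j)"
    "(\<Sum>k\<in>X. F k powr q * v k) \<le> C * (\<Sum>j\<in>S. c j powr q * (\<Sum>k\<in>B j. v k))"
proof -
  have fin: "finite (B j)" if "j \<in> J" for j using BX[OF that] X by (rule finite_subset)
  obtain S E where S: "S \<subseteq> J" "disjoint_family_on E S"
    "\<And>j. j \<in> S \<Longrightarrow> E j \<subseteq> B j" "\<And>j. j \<in> S \<Longrightarrow> card (B j) \<le> 2 * card (E j)"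
    and cov: "\<And>j. j \<in> J \<Longrightarrow> card (B j) \<le> 2 * card (B j \<inter> (\<Union>i\<in>{i\<in>S. c j \<le> c i}. B i))"
    by (rule scattered_subfamily[where B = B and c = c, OF J fin], assumption, rule that)
  have finS: "finite S" using S(1) J by (rule finite_subset)
  have level: "(\<Sum>k\<in>{k\<in>X. t < F k}. v k) * t powr 0 \<le> (\<Sum>j\<in>{j\<in>S. t < c j}. C * (\<Sum>k\<in>B j. v k))"
    if t: "0 < t" for t
  proof -
    define U where "U = (\<Union>i\<in>{i\<in>S. t < c i}. B i)"
    have UX: "U \<subseteq> X" unfolding U_def using BX S(1) by blast
    have sub: "{k\<in>X. t < F k} \<subseteq> {k\<in>X. \<exists>j\<in>J. k \<in> B j \<and> card (B j) \<le> 2 * card (B j \<inter> U)}"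
    proof safe
      fix k assume k: "k \<in> X" "t < F k"
      then obtain j where j: "j \<in> J" "k \<in> B j" "F k \<le> c j" using F[of k] t by force
      have "card (B j \<inter> (\<Union>i\<in>{i\<in>S. c j \<le> c i}. B i)) \<le> card (B j \<inter> U)"
        unfolding U_def using k j fin by (intro card_mono) force+
      then show "\<exists>j\<in>J. k \<in> B j \<and> card (B j) \<le> 2 * card (B j \<inter> U)"
        using cov[OF j(1)] j by (intro bexI[of _ j]) auto
    qed
    have "(\<Sum>k\<in>{k\<in>X. t < F k}. v k) \<le> (\<Sum>k\<in>{k\<in>X. \<exists>j\<in>J. k \<in> B j \<and> card (B j) \<le> 2 * card (B j \<inter> U)}. v k)"
      using X v by (intro sum_mono2 sub) auto
    also have "\<dots> \<le> C * (\<Sum>k\<in>U. v k)" by (rule weak[OF UX])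
    also have "(\<Sum>k\<in>U. v k) \<le> (\<Sum>i\<in>{i\<in>S. t < c i}. \<Sum>k\<in>B i. v k)"
      using UX finS fin S(1) v unfolding U_def
      by (intro sum_UNION_le) (auto 4 4)
    finally show ?thesis using C t by (simp add: mult_left_mono sum_distrib_left)
  qed
  have "(\<Sum>k\<in>X. v k * F k powr (q + 0)) / (q + 0) \<le> (\<Sum>j\<in>S. (C * (\<Sum>k\<in>B j. v k)) * c j powr q) / q"
    by (rule layer_cake_comparison[OF X finS]) (use F0 c S(1) q level in auto)
  then have "(\<Sum>k\<in>X. F k powr q * v k) \<le> C * (\<Sum>j\<in>S. c j powr q * (\<Sum>k\<in>B j. v k))"
    using q by (simp add: divide_le_cancel mult.commute mult.left_commute flip: sum_distrib_left)
  then show ?thesis by (intro that[of S E] S)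
qed

section \<open>The discrete two-weight inequality\<close>

lemma card_half_le_maximal:
  fixes U :: "'k set"
  assumes "finite B" "B \<noteq> {}" "card B \<le> 2 * card (B \<inter> U)" "(\<Sum>k\<in>B. indicat_real U k) \<le> G * real (card B)"
  shows "1 \<le> 2 * G"
proof -
  have "real (card (B \<inter> U)) = (\<Sum>k\<in>B. indicat_real U k)"
    using assms(1) by (simp add: indicator_def sum.If_cases Int_def)
  then have "real (card B) \<le> (2 * G) * real (card B)" using assms(3,4) by simp
  then show ?thesis using assms(1,2) by (simp add: card_gt_0_iff)
qed

text \<open>The sparse argument on the lattice. The g i stand for cell averages, \<theta> i for
  p/p_i and t i for p_i/s_i; \<open>test\<close> is the bump condition after Hoelder, raised to the
  power q. The factor \<open>2 powr s\<close> comes from Chebyshev at height 1/2, the inner 2 from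
  |B| \<le> 2|E|, and every strong maximal bound contributes one constant per dimension.\<close>

lemma discrete_two_weight_bound:
  fixes v F :: "('n::finite \<Rightarrow> int) \<Rightarrow> real" and g :: "'i \<Rightarrow> ('n \<Rightarrow> int) \<Rightarrow> real"
    and lo hi :: "'n \<Rightarrow> int" and s K p q L :: real and \<theta> t :: "'i \<Rightarrow> real"
    and a b :: "'j \<Rightarrow> 'n \<Rightarrow> int" and c :: "'j \<Rightarrow> real"
  assumes v: "\<And>k. k \<in> {lo..hi} \<Longrightarrow> 0 < v k" and s: "1 < s" and K: "0 < K"
    and Aw: "\<And>a b. \<lbrakk>lo \<le> a; a \<le> b; b \<le> hi\<rbrakk> \<Longrightarrow>
      (\<Sum>k\<in>{a..b}. v k) * (\<Sum>k\<in>{a..b}. v k powr (- 1 / (s - 1))) powr (s - 1)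
        \<le> K * real (card {a..b}) powr s"
    and J: "finite J" and ab: "\<And>j. j \<in> J \<Longrightarrow> lo \<le> a j \<and> a j \<le> b j \<and> b j \<le> hi"
    and c: "\<And>j. j \<in> J \<Longrightarrow> 0 \<le> c j" and p: "0 < p" and pq: "p \<le> q" and L: "0 \<le> L"
    and I: "finite I" and \<theta>: "\<And>i. i \<in> I \<Longrightarrow> 0 < \<theta> i" "sum \<theta> I = 1" and t: "\<And>i. i \<in> I \<Longrightarrow> 1 < t i"
    and g: "\<And>i k. \<lbrakk>i \<in> I; k \<in> {lo..hi}\<rbrakk> \<Longrightarrow> 0 \<le> g i k"
    and F0: "\<And>k. k \<in> {lo..hi} \<Longrightarrow> 0 \<le> F k"
    and F: "\<And>k. \<lbrakk>k \<in> {lo..hi}; 0 < F k\<rbrakk> \<Longrightarrow> \<exists>j\<in>J. k \<in> {a j..b j} \<and> F k \<le> c j"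
    and test: "\<And>j. j \<in> J \<Longrightarrow> c j powr q * (\<Sum>k\<in>{a j..b j}. v k) \<le>
      (L * (real (card {a j..b j}) *
        (\<Prod>i\<in>I. ((\<Sum>k\<in>{a j..b j}. g i k) / real (card {a j..b j})) powr (\<theta> i * t i)))) powr (q / p)"
  shows "(\<Sum>k\<in>{lo..hi}. F k powr q * v k) \<le>
    2 powr s * A_maximal_const s K ^ CARD('n) *
      (2 * (\<Prod>i\<in>I. (A_maximal_const (t i) 1 ^ CARD('n)) powr \<theta> i)) powr (q / p) *
      (L * (\<Prod>i\<in>I. (\<Sum>k\<in>{lo..hi}. g i k powr t i) powr \<theta> i)) powr (q / p)"
proof -
  define X where "X = {lo..hi}"
  define B where "B j = {a j..b j}" for j
  define C where "C = 2 powr s * A_maximal_const s K ^ CARD('n)"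
  have C0: "0 \<le> C" by (simp add: C_def A_maximal_const_nonneg)
  have q: "0 < q" using p pq by simp
  have BX: "B j \<subseteq> X" if "j \<in> J" for j using ab[OF that] by (auto simp: B_def X_def)
  have Bne: "B j \<noteq> {}" if "j \<in> J" for j using ab[OF that] by (auto simp: B_def)
  have finB: "finite (B j)" for j by (simp add: B_def)
  have weak: "(\<Sum>k\<in>{k\<in>X. \<exists>j\<in>J. k \<in> B j \<and> card (B j) \<le> 2 * card (B j \<inter> U)}. v k) \<le> C * (\<Sum>k\<in>U. v k)"
    if U: "U \<subseteq> X" for U
  proof -
    obtain G where G0: "\<And>k. k \<in> {lo..hi} \<Longrightarrow> 0 \<le> G k"
      and G1: "\<And>k a b. \<lbrakk>lo \<le> a; a \<le> k; k \<le> b; b \<le> hi\<rbrakk> \<Longrightarrow> (\<Sum>j\<in>{a..b}. indicat_real U j) \<le> G k * real (card {a..b})"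
      and G2: "(\<Sum>k\<in>{lo..hi}. G k powr s * v k)
        \<le> A_maximal_const s K ^ CARD('n) * (\<Sum>k\<in>{lo..hi}. indicat_real U k powr s * v k)"
      by (rule A_weight_strong_maximal_bound[where f = "indicat_real U", OF v _ s K Aw], assumption) (simp, assumption+, rule that)
    have "(\<Sum>k\<in>{k\<in>X. \<exists>j\<in>J. k \<in> B j \<and> card (B j) \<le> 2 * card (B j \<inter> U)}. v k)
      \<le> (\<Sum>k\<in>{k\<in>X. \<exists>j\<in>J. k \<in> B j \<and> card (B j) \<le> 2 * card (B j \<inter> U)}. 2 powr s * (G k powr s * v k))"
    proof (rule sum_mono)
      fix k assume "k \<in> {k\<in>X. \<exists>j\<in>J. k \<in> B j \<and> card (B j) \<le> 2 * card (B j \<inter> U)}"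
      then obtain j where k: "k \<in> X" and j: "j \<in> J" "k \<in> B j" "card (B j) \<le> 2 * card (B j \<inter> U)" by blast
      have "1 \<le> 2 * G k"
        by (rule card_half_le_maximal[OF finB Bne[OF j(1)] j(3)])
          (use G1[of "a j" k "b j"] ab[OF j(1)] j(2) in \<open>auto simp: B_def\<close>)
      \<comment> \<open>Chebyshev's inequality: at such k the majorant of the averages of the
        indicator of U is at least 1/2.\<close>
      then have "1 \<le> (2 * G k) powr s" using s by (intro ge_one_powr_ge_zero) auto
      also have "\<dots> = 2 powr s * G k powr s" using G0 k by (simp add: powr_mult X_def)
      finally show "v k \<le> 2 powr s * (G k powr s * v k)"
        using v k by (simp add: X_def mult.assoc[symmetric] less_imp_le)
    qed
    also have "\<dots> \<le> (\<Sum>k\<in>X. 2 powr s * (G k powr s * v k))"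
      by (intro sum_mono2) (auto simp: X_def intro!: mult_nonneg_nonneg less_imp_le[OF v])
    also have "\<dots> = 2 powr s * (\<Sum>k\<in>{lo..hi}. G k powr s * v k)"
      by (simp add: sum_distrib_left X_def)
    also have "\<dots> \<le> 2 powr s * (A_maximal_const s K ^ CARD('n) * (\<Sum>k\<in>{lo..hi}. indicat_real U k powr s * v k))"
      by (intro mult_left_mono G2) auto
    also have "(\<Sum>k\<in>{lo..hi}. indicat_real U k powr s * v k) = (\<Sum>k\<in>U. v k)"
      using U s by (intro sum.mono_neutral_cong_right) (auto simp: X_def)
    finally show ?thesis by (simp add: C_def mult.assoc)
  qed
  obtain S E where S: "S \<subseteq> J" "disjoint_family_on E S"
    and E: "\<And>j. j \<in> S \<Longrightarrow> E j \<subseteq> B j" "\<And>j. j \<in> S \<Longrightarrow> card (B j) \<le> 2 * card (E j)"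
    and Fle: "(\<Sum>k\<in>X. F k powr q * v k) \<le> C * (\<Sum>j\<in>S. c j powr q * (\<Sum>k\<in>B j. v k))"
  proof (rule maximal_sum_le_scattered[where B = B and c = c and v = v and F = F and C = C, OF J _ BX c _ q C0 _ _ weak])
    fix k assume "k \<in> X" "0 < F k"
    then show "\<exists>j\<in>J. k \<in> B j \<and> F k \<le> c j" using F by (auto simp: X_def B_def)
  qed (use v F0 in \<open>auto simp: X_def less_imp_le\<close>)
  have finS: "finite S" using S(1) J by (rule finite_subset)
  have "\<exists>G. (\<forall>k\<in>X. 0 \<le> G k) \<and> (\<forall>j\<in>J. \<forall>k\<in>B j. (\<Sum>k\<in>B j. g i k) \<le> G k * real (card (B j))) \<and>
     (\<Sum>k\<in>X. G k powr t i) \<le> A_maximal_const (t i) 1 ^ CARD('n) * (\<Sum>k\<in>X. g i k powr t i)" if i: "i \<in> I" for i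
  proof -
    obtain G where G0: "\<And>k. k \<in> {lo..hi} \<Longrightarrow> 0 \<le> G k"
      and G1: "\<And>k a b. \<lbrakk>lo \<le> a; a \<le> k; k \<le> b; b \<le> hi\<rbrakk> \<Longrightarrow> (\<Sum>j\<in>{a..b}. g i j) \<le> G k * real (card {a..b})"
      and G2: "(\<Sum>k\<in>{lo..hi}. G k powr t i * 1)
        \<le> A_maximal_const (t i) 1 ^ CARD('n) * (\<Sum>k\<in>{lo..hi}. g i k powr t i * 1)"
    proof (rule A_weight_strong_maximal_bound[where f = "g i" and v = "\<lambda>_. 1" and s = "t i" and K = 1 and lo = lo and hi = hi])
      fix a b :: "'n \<Rightarrow> int"
      assume "a \<le> b"
      then have "real (card {a..b}) > 0" by (subst of_nat_0_less_iff, subst card_gt_0_iff) auto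
      \<comment> \<open>The constant weight satisfies the condition with equality, N N^(t-1) =
        N^t.\<close>
      then show "(\<Sum>k\<in>{a..b}. 1) * (\<Sum>k\<in>{a..b}. 1 powr (- 1 / (t i - 1))) powr (t i - 1)
        \<le> 1 * real (card {a..b}) powr t i"
        by (simp add: powr_mult_base)
    qed (use t[OF i] g[OF i] in auto)
    have "(\<Sum>l\<in>B j. g i l) \<le> G k * real (card (B j))" if j: "j \<in> J" and k: "k \<in> B j" for j k
      using G1[of "a j" k "b j"] ab[OF j] k by (simp add: B_def)
    then show ?thesis using G0 G2 by (intro exI[of _ G]) (auto simp: X_def)
  qed
  then have "\<forall>i\<in>I. \<exists>G. (\<forall>k\<in>X. 0 \<le> G k) \<and> (\<forall>j\<in>J. \<forall>k\<in>B j. (\<Sum>k\<in>B j. g i k) \<le> G k * real (card (B j))) \<and>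
     (\<Sum>k\<in>X. G k powr t i) \<le> A_maximal_const (t i) 1 ^ CARD('n) * (\<Sum>k\<in>X. g i k powr t i)"
    by blast
  then obtain G where G: "\<forall>i\<in>I. (\<forall>k\<in>X. 0 \<le> G i k) \<and> (\<forall>j\<in>J. \<forall>k\<in>B j. (\<Sum>k\<in>B j. g i k) \<le> G i k * real (card (B j))) \<and>
     (\<Sum>k\<in>X. G i k powr t i) \<le> A_maximal_const (t i) 1 ^ CARD('n) * (\<Sum>k\<in>X. g i k powr t i)"
    by (rule bchoice[THEN exE])
  define y where "y j = real (card (B j)) * (\<Prod>i\<in>I. ((\<Sum>k\<in>B j. g i k) / real (card (B j))) powr (\<theta> i * t i))" for j
  have y0: "0 \<le> y j" for j by (simp add: y_def prod_nonneg)
  \<comment> \<open>The product of averages over \<open>B j\<close> is at most the product of the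
    majorants at every point of \<open>B j\<close>, in particular on \<open>E j\<close>. Replacing
    |B j| by 2|E j| makes it a sum over E j, and the disjointness of these sets lets the sums be
    added.\<close>
  have yE: "y j \<le> 2 * (\<Sum>k\<in>E j. \<Prod>i\<in>I. (G i k powr t i) powr \<theta> i)" if j: "j \<in> S" for j
  proof -
    have jJ: "j \<in> J" using j S(1) by blast
    have N: "real (card (B j)) > 0" using finB Bne[OF jJ] by (simp add: card_gt_0_iff)
    define P where "P = (\<Prod>i\<in>I. ((\<Sum>k\<in>B j. g i k) / real (card (B j))) powr (\<theta> i * t i))"
    have P0: "0 \<le> P" by (simp add: P_def prod_nonneg)
    have "P \<le> (\<Prod>i\<in>I. (G i k powr t i) powr \<theta> i)" if k: "k \<in> B j" for k
      unfolding P_def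
    proof (rule prod_mono)
      fix i assume i: "i \<in> I"
      have "(\<Sum>k\<in>B j. g i k) / real (card (B j)) \<le> G i k"
        using G i jJ k N by (simp add: pos_divide_le_eq)
      moreover have "0 \<le> (\<Sum>k\<in>B j. g i k) / real (card (B j))"
        using g[OF i] BX[OF jJ] by (intro divide_nonneg_nonneg sum_nonneg) (auto simp: X_def)
      ultimately show "0 \<le> ((\<Sum>k\<in>B j. g i k) / real (card (B j))) powr (\<theta> i * t i) \<and>
        ((\<Sum>k\<in>B j. g i k) / real (card (B j))) powr (\<theta> i * t i) \<le> (G i k powr t i) powr \<theta> i"
        using \<theta>(1)[OF i] t[OF i] by (auto simp: powr_powr mult.commute intro!: powr_mono2)
    qed
    then have "(\<Sum>k\<in>E j. P) \<le> (\<Sum>k\<in>E j. \<Prod>i\<in>I. (G i k powr t i) powr \<theta> i)"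
      using E(1)[OF j] by (intro sum_mono) auto
    moreover have "real (card (B j)) * P \<le> 2 * real (card (E j)) * P"
      using E(2)[OF j] by (intro mult_right_mono P0) linarith
    ultimately show ?thesis by (simp add: y_def P_def)
  qed
  have EX: "\<Union> (E ` S) \<subseteq> X" using E(1) BX S(1) by blast
  have "(\<Sum>j\<in>S. y j) \<le> (\<Sum>j\<in>S. 2 * (\<Sum>k\<in>E j. \<Prod>i\<in>I. (G i k powr t i) powr \<theta> i))"
    by (intro sum_mono yE)
  also have "\<dots> = 2 * (\<Sum>k\<in>\<Union> (E ` S). \<Prod>i\<in>I. (G i k powr t i) powr \<theta> i)"
    using S(2) finS finite_subset[OF E(1) finB]
    by (subst sum.UNION_disjoint) (auto simp: disjoint_family_on_def sum_distrib_left)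
  also have "\<dots> \<le> 2 * (\<Sum>k\<in>X. \<Prod>i\<in>I. (G i k powr t i) powr \<theta> i)"
    using EX by (intro mult_left_mono sum_mono2) (auto simp: X_def intro!: prod_nonneg)
  also have "\<dots> \<le> 2 * (\<Prod>i\<in>I. (\<Sum>k\<in>X. G i k powr t i) powr \<theta> i)"
    by (intro mult_left_mono Hoelder_sum I \<theta>) (auto simp: X_def)
  also have "\<dots> \<le> 2 * (\<Prod>i\<in>I. (A_maximal_const (t i) 1 ^ CARD('n) * (\<Sum>k\<in>X. g i k powr t i)) powr \<theta> i)"
    using G \<theta>(1) by (intro mult_left_mono prod_mono) (auto intro!: powr_mono2 sum_nonneg simp: less_imp_le)
  also have "\<dots> = 2 * (\<Prod>i\<in>I. (A_maximal_const (t i) 1 ^ CARD('n)) powr \<theta> i) * (\<Prod>i\<in>I. (\<Sum>k\<in>X. g i k powr t i) powr \<theta> i)"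
    by (simp add: powr_mult A_maximal_const_nonneg sum_nonneg prod.distrib)
  finally have ysum: "(\<Sum>j\<in>S. y j) \<le> \<dots>" .
  have "(\<Sum>k\<in>X. F k powr q * v k) \<le> C * (\<Sum>j\<in>S. (L * y j) powr (q / p))"
    using Fle test S(1) C0 unfolding y_def B_def
    by (elim order_trans) (intro mult_left_mono sum_mono, auto)
  also have "\<dots> \<le> C * (\<Sum>j\<in>S. L * y j) powr (q / p)"
    using C0 L y0 p pq by (intro mult_left_mono sum_powr_le_powr_sum finS) auto
  also have "\<dots> \<le> C * (L * (2 * (\<Prod>i\<in>I. (A_maximal_const (t i) 1 ^ CARD('n)) powr \<theta> i) *
      (\<Prod>i\<in>I. (\<Sum>k\<in>X. g i k powr t i) powr \<theta> i))) powr (q / p)"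
    unfolding sum_distrib_left[symmetric]
    using L y0 p q ysum C0 by (intro mult_left_mono powr_mono2) (auto intro!: mult_nonneg_nonneg sum_nonneg)
  also have "\<dots> = C * ((2 * (\<Prod>i\<in>I. (A_maximal_const (t i) 1 ^ CARD('n)) powr \<theta> i)) *
      (L * (\<Prod>i\<in>I. (\<Sum>k\<in>X. g i k powr t i) powr \<theta> i))) powr (q / p)"
    by (simp only: mult_ac)
  also have "\<dots> = C * ((2 * (\<Prod>i\<in>I. (A_maximal_const (t i) 1 ^ CARD('n)) powr \<theta> i)) powr (q / p) *
      (L * (\<Prod>i\<in>I. (\<Sum>k\<in>X. g i k powr t i) powr \<theta> i)) powr (q / p))"
    using L by (subst powr_mult) (auto intro!: prod_nonneg)
  finally show ?thesis by (simp add: C_def X_def mult.assoc)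
qed

section \<open>Grids in Euclidean space\<close>

definition grid :: "nat \<Rightarrow> real ^ 'n \<Rightarrow> 'n \<Rightarrow> int" where
  "grid D x = (\<lambda>i. \<lfloor>real D * x $ i\<rfloor>)"

text \<open>Half-open, so that the cells \<open>gridbox D k k\<close> partition the space exactly
  and integrals over boxes are finite sums over cells.\<close>

definition gridbox :: "nat \<Rightarrow> ('n \<Rightarrow> int) \<Rightarrow> ('n \<Rightarrow> int) \<Rightarrow> (real ^ 'n) set" where
  "gridbox D a b = {x. grid D x \<in> {a..b}}"

text \<open>The closed version, which belongs to \<open>rectangles\<close> and differs from the grid
  box by a null set. The \<open>+ 1\<close> appears because b indexes the last cell, not its right
  end.\<close>

definition gridrect :: "nat \<Rightarrow> ('n \<Rightarrow> int) \<Rightarrow> ('n \<Rightarrow> int) \<Rightarrow> (real ^ 'n) set" where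
  "gridrect D a b = cbox (\<chi> i. real_of_int (a i) / real D) (\<chi> i. real_of_int (b i + 1) / real D)"

lemma mem_gridbox:
  assumes "0 < D"
  shows "x \<in> gridbox D a b \<longleftrightarrow> (\<forall>i. real_of_int (a i) / real D \<le> x $ i \<and> x $ i < real_of_int (b i + 1) / real D)"
proof -
  have "a i \<le> \<lfloor>real D * x $ i\<rfloor> \<longleftrightarrow> real_of_int (a i) / real D \<le> x $ i" for i
    using assms by (simp add: le_floor_iff pos_divide_le_eq mult.commute)
  moreover have "\<lfloor>real D * x $ i\<rfloor> \<le> b i \<longleftrightarrow> x $ i < real_of_int (b i + 1) / real D" for i
    using assms by (simp add: floor_le_iff pos_less_divide_eq mult.commute)
  ultimately show ?thesis by (auto simp: gridbox_def grid_def le_fun_def)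
qed

lemma gridrect_sides:
  assumes "0 < D" "a \<le> b"
  shows "real_of_int (a i) / real D < real_of_int (b i + 1) / real D"
proof -
  have "real_of_int (a i) < real_of_int (b i + 1)" using le_funD[OF assms(2), of i] by linarith
  then show ?thesis using assms(1) by (simp add: divide_strict_right_mono)
qed

lemma gridrect_in_rectangles:
  assumes "0 < D" "a \<le> b"
  shows "gridrect D a b \<in> rectangles"
proof -
  have "\<forall>i. (\<chi> i. real_of_int (a i) / real D) $ i < (\<chi> i. real_of_int (b i + 1) / real D) $ i"
    unfolding vec_lambda_beta using gridrect_sides[OF assms] by blast
  then show ?thesis unfolding gridrect_def rectangles_def by blast
qed

lemma sets_gridbox [measurable]: "0 < D \<Longrightarrow> gridbox D a b \<in> sets lebesgue"
proof -
  assume D: "0 < D"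
  have "gridbox D a b = (\<Inter>i. {x. real_of_int (a i) / real D \<le> x $ i} \<inter> {x. x $ i < real_of_int (b i + 1) / real D})"
    using D by (auto simp: mem_gridbox)
  moreover have "{x::real^'a. real_of_int (a i) / real D \<le> x $ i} \<in> sets lebesgue" for i
    by (intro sets_completionI_sets) (auto intro!: borel_closed closed_halfspace_component_ge_cart)
  moreover have "{x::real^'a. x $ i < real_of_int (b i + 1) / real D} \<in> sets lebesgue" for i
    by (intro sets_completionI_sets) (auto intro!: borel_open open_halfspace_component_lt_cart)
  ultimately show ?thesis by (auto intro!: sets.finite_INT)
qed

lemma AE_gridbox_eq_gridrect:
  assumes "0 < D"
  shows "AE x in lebesgue. x \<in> gridbox D a b \<longleftrightarrow> x \<in> gridrect D a b"
proof (rule AE_I')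
  let ?l = "\<chi> i. real_of_int (a i) / real D" and ?u = "\<chi> i. real_of_int (b i + 1) / real D"
  show "cbox ?l ?u - box ?l ?u \<in> null_sets lebesgue"
    using negligible_frontier_interval negligible_iff_null_sets by blast
  show "{x \<in> space lebesgue. \<not> (x \<in> gridbox D a b \<longleftrightarrow> x \<in> gridrect D a b)} \<subseteq> cbox ?l ?u - box ?l ?u"
    using assms by (auto simp: mem_gridbox gridrect_def mem_box_cart less_imp_le)
qed

lemma nn_integral_gridbox_eq:
  assumes "0 < D"
  shows "(\<integral>\<^sup>+x\<in>gridbox D a b. h x \<partial>lebesgue) = (\<integral>\<^sup>+x\<in>gridrect D a b. h x \<partial>lebesgue)"
proof (rule nn_integral_cong_AE)
  show "AE x in lebesgue. h x * indicator (gridbox D a b) x = h x * indicator (gridrect D a b) x"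
    using AE_gridbox_eq_gridrect[OF assms, of a b] by eventually_elim (auto simp: indicator_def)
qed

lemma card_fun_atLeastAtMost_real:
  fixes a b :: "'n::finite \<Rightarrow> int"
  assumes "a \<le> b"
  shows "real (card {a..b}) = (\<Prod>i\<in>UNIV. real_of_int (b i + 1 - a i))"
proof -
  have "real (nat (b i - a i + 1)) = real_of_int (b i + 1 - a i)" for i
    using le_funD[OF assms, of i] by simp
  then show ?thesis by (simp add: card_fun_atLeastAtMost)
qed

lemma emeasure_rectangle:
  fixes l u :: "real ^ 'n"
  assumes "\<forall>i. l $ i < u $ i"
  shows "emeasure lebesgue (cbox l u) = ennreal (\<Prod>i\<in>UNIV. u $ i - l $ i)" "0 < (\<Prod>i\<in>UNIV. u $ i - l $ i)"
proof -
  have "cbox l u \<noteq> {}" using assms by (auto simp: interval_ne_empty_cart less_imp_le)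
  then have "measure lborel (cbox l u) = (\<Prod>i\<in>UNIV. u $ i - l $ i)" by (rule content_cbox_cart)
  moreover have "emeasure lebesgue (cbox l u) = ennreal (measure lborel (cbox l u))"
    using emeasure_lborel_cbox_finite[of l u] by (simp add: emeasure_eq_ennreal_measure)
  ultimately show "emeasure lebesgue (cbox l u) = ennreal (\<Prod>i\<in>UNIV. u $ i - l $ i)" by simp
  show "0 < (\<Prod>i\<in>UNIV. u $ i - l $ i)" using assms by (intro prod_pos) auto
qed

lemma emeasure_gridrect:
  fixes a b :: "'n::finite \<Rightarrow> int"
  assumes "0 < D" "a \<le> b"
  shows "emeasure lebesgue (gridrect D a b) = ennreal (real (card {a..b}) / real D ^ CARD('n))"
proof -
  have "emeasure lebesgue (gridrect D a b) = ennreal (\<Prod>i\<in>UNIV. real_of_int (b i + 1) / real D - real_of_int (a i) / real D)"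
    unfolding gridrect_def using assms
    by (subst emeasure_rectangle) (simp_all only: vec_lambda_beta gridrect_sides simp_thms)
  also have "(\<Prod>i\<in>UNIV. real_of_int (b i + 1) / real D - real_of_int (a i) / real D)
      = (\<Prod>i\<in>(UNIV::'n set). real_of_int (b i + 1 - a i) / real D)"
    by (intro prod.cong) (auto simp: diff_divide_distrib)
  also have "\<dots> = real (card {a..b}) / real D ^ CARD('n)"
    unfolding card_fun_atLeastAtMost_real[OF assms(2)] by (simp add: prod_dividef)
  finally show ?thesis .
qed

lemma nn_integral_gridbox_sum:
  fixes a b :: "'n::finite \<Rightarrow> int"
  assumes "0 < D" "h \<in> borel_measurable lebesgue"
  shows "(\<integral>\<^sup>+x\<in>gridbox D a b. h x \<partial>lebesgue) = (\<Sum>k\<in>{a..b}. \<integral>\<^sup>+x\<in>gridbox D k k. h x \<partial>lebesgue)"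
proof -
  have "h x * indicator (gridbox D a b) x = (\<Sum>k\<in>{a..b}. h x * indicator (gridbox D k k) x)" for x
  proof (cases "grid D x \<in> {a..b}")
    case True
    have "(\<Sum>k\<in>{a..b}. h x * indicator (gridbox D k k) x) = (\<Sum>k\<in>{grid D x}. h x * indicator (gridbox D k k) x)"
      using True by (intro sum.mono_neutral_right) (auto simp: gridbox_def indicator_def)
    then show ?thesis using True by (simp add: gridbox_def)
  next
    case False
    then have "(\<Sum>k\<in>{a..b}. h x * indicator (gridbox D k k) x) = 0"
      by (intro sum.neutral) (auto simp: gridbox_def)
    then show ?thesis using False by (simp add: gridbox_def)
  qed
  then have "(\<integral>\<^sup>+x\<in>gridbox D a b. h x \<partial>lebesgue)
      = (\<integral>\<^sup>+x. (\<Sum>k\<in>{a..b}. h x * indicator (gridbox D k k) x) \<partial>lebesgue)"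
    by (intro nn_integral_cong)
  also have "\<dots> = (\<Sum>k\<in>{a..b}. \<integral>\<^sup>+x\<in>gridbox D k k. h x \<partial>lebesgue)"
    using assms by (intro nn_integral_sum borel_measurable_times_ennreal borel_measurable_indicator sets_gridbox)
  finally show ?thesis .
qed

text \<open>Young's inequality for f/A and g/B, integrated. If A or B is 0, that function vanishes
  a.e. and so does the product.\<close>

lemma nn_integral_Hoelder:
  fixes f g :: "'a \<Rightarrow> real"
  assumes [measurable]: "f \<in> borel_measurable M" "g \<in> borel_measurable M"
    and nonneg: "\<And>x. 0 \<le> f x" "\<And>x. 0 \<le> g x" and \<theta>: "0 < \<theta>" "\<theta> < 1"
    and f: "(\<integral>\<^sup>+x. ennreal (f x) \<partial>M) = ennreal A" and g: "(\<integral>\<^sup>+x. ennreal (g x) \<partial>M) = ennreal B"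
    and AB: "0 \<le> A" "0 \<le> B"
  shows "(\<integral>\<^sup>+x. ennreal (f x powr \<theta> * g x powr (1 - \<theta>)) \<partial>M) \<le> ennreal (A powr \<theta> * B powr (1 - \<theta>))"
proof (cases "A = 0 \<or> B = 0")
  case True
  then have "(AE x in M. f x = 0) \<or> (AE x in M. g x = 0)"
    using f g nonneg by (auto simp: nn_integral_0_iff_AE ennreal_eq_0_iff order_antisym_conv)
  then have "AE x in M. ennreal (f x powr \<theta> * g x powr (1 - \<theta>)) = 0"
    by (auto elim: eventually_mono)
  then have "(\<integral>\<^sup>+x. ennreal (f x powr \<theta> * g x powr (1 - \<theta>)) \<partial>M) = 0"
    by (subst nn_integral_0_iff_AE) auto
  then show ?thesis by simp
next
  case False
  then have A: "0 < A" and B: "0 < B" using AB by auto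
  have young: "f x powr \<theta> * g x powr (1 - \<theta>) \<le> A powr \<theta> * B powr (1 - \<theta>) * (\<theta> / A * f x + (1 - \<theta>) / B * g x)" for x
  proof -
    have "(f x / A) powr \<theta> * (g x / B) powr (1 - \<theta>) \<le> \<theta> * (f x / A) + (1 - \<theta>) * (g x / B)"
      using weighted_arith_geom_mean[of "UNIV :: bool set" "\<lambda>i. if i then f x / A else g x / B" "\<lambda>i. if i then \<theta> else 1 - \<theta>"]
        nonneg A B \<theta> by (auto simp: UNIV_bool mult_ac add_ac)
    then have "A powr \<theta> * B powr (1 - \<theta>) * ((f x / A) powr \<theta> * (g x / B) powr (1 - \<theta>))
      \<le> A powr \<theta> * B powr (1 - \<theta>) * (\<theta> * (f x / A) + (1 - \<theta>) * (g x / B))"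
      by (intro mult_left_mono) auto
    then show ?thesis using A B nonneg by (simp add: powr_divide)
  qed
  have "(\<integral>\<^sup>+x. ennreal (f x powr \<theta> * g x powr (1 - \<theta>)) \<partial>M)
    \<le> (\<integral>\<^sup>+x. ennreal (A powr \<theta> * B powr (1 - \<theta>)) * (ennreal (\<theta> / A) * ennreal (f x) + ennreal ((1 - \<theta>) / B) * ennreal (g x)) \<partial>M)"
    using A B \<theta> nonneg young
    by (intro nn_integral_mono) (simp flip: ennreal_mult ennreal_plus)
  also have "\<dots> = ennreal (A powr \<theta> * B powr (1 - \<theta>)) * (ennreal (\<theta> / A) * ennreal A + ennreal ((1 - \<theta>) / B) * ennreal B)"
    by (simp add: nn_integral_cmult nn_integral_add f g)
  also have "ennreal (\<theta> / A) * ennreal A + ennreal ((1 - \<theta>) / B) * ennreal B = 1"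
    using A B \<theta> by (simp flip: ennreal_mult ennreal_plus)
  finally show ?thesis by simp
qed

section \<open>Positivity of the weights\<close>

lemma epowr_ennreal: "0 < x \<or> (0 \<le> x \<and> 0 < a) \<Longrightarrow> ennreal x epowr a = ennreal (x powr a)"
  by (auto simp: epowr_def powr_def less_imp_le)

lemma epowr_eq_top_iff: "0 < a \<Longrightarrow> x epowr a = \<infinity> \<longleftrightarrow> x = \<infinity>"
  by (auto simp: epowr_def)

lemma epowr_eq_0_iff: "0 < a \<Longrightarrow> x epowr a = 0 \<longleftrightarrow> x = 0"
  by (auto simp: epowr_def ennreal_eq_0_iff enn2real_eq_0_iff)

lemma rectangleE:
  fixes R :: "(real ^ 'n) set"
  assumes "R \<in> rectangles"
  obtains h where "0 < h" "emeasure lebesgue R = ennreal h" "R \<in> sets lebesgue"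
proof -
  obtain l u where R: "R = cbox l u" and lu: "\<forall>i. l $ i < u $ i"
    using assms unfolding rectangles_def by blast
  show ?thesis
    by (rule that[OF emeasure_rectangle(2)[OF lu]]) (simp_all add: R emeasure_rectangle(1)[OF lu, simplified])
qed

lemma set_nn_integral_0_iff_AE:
  fixes u :: "'a \<Rightarrow> real"
  assumes [measurable]: "u \<in> borel_measurable M" "R \<in> sets M" and nonneg: "\<And>x. 0 \<le> u x"
  shows "(\<integral>\<^sup>+x\<in>R. ennreal (u x) \<partial>M) = 0 \<longleftrightarrow> (AE x in M. x \<in> R \<longrightarrow> u x = 0)"
proof -
  have "(\<integral>\<^sup>+x\<in>R. ennreal (u x) \<partial>M) = 0 \<longleftrightarrow> (AE x in M. ennreal (u x) * indicator R x = 0)"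
    by (rule nn_integral_0_iff_AE) measurable
  also have "\<dots> \<longleftrightarrow> (AE x in M. x \<in> R \<longrightarrow> u x = 0)"
    using nonneg by (intro AE_cong) (auto simp: ennreal_eq_0_iff order_antisym_conv indicator_def)
  finally show ?thesis .
qed

lemma set_nn_integral_pos:
  fixes u :: "'a \<Rightarrow> real"
  assumes [measurable]: "u \<in> borel_measurable M" "R \<in> sets M"
    and pos: "AE x in M. 0 < u x" and R: "emeasure M R \<noteq> 0"
  shows "(\<integral>\<^sup>+x\<in>R. ennreal (u x) \<partial>M) \<noteq> 0"
proof
  assume 0: "(\<integral>\<^sup>+x\<in>R. ennreal (u x) \<partial>M) = 0"
  have "AE x in M. ennreal (u x) * indicator R x = 0"
    by (subst nn_integral_0_iff_AE[symmetric]) (use 0 in auto)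
  with pos have "AE x in M. x \<notin> R"
    by eventually_elim (auto simp: indicator_def ennreal_eq_0_iff split: if_splits)
  then show False using R AE_iff_null_sets[of R M] assms(2) by (auto simp: null_sets_def)
qed

lemma set_nn_integral_powr_cong:
  fixes u :: "'a \<Rightarrow> real"
  assumes "AE x in M. 0 < u x"
  shows "(\<integral>\<^sup>+x\<in>R. ennreal (u x) epowr a \<partial>M) = (\<integral>\<^sup>+x\<in>R. ennreal (u x powr a) \<partial>M)"
  by (rule nn_integral_cong_AE) (use assms in eventually_elim, simp add: epowr_ennreal)

text \<open>A negative \<open>epowr\<close> of 0 is infinite, so a finite integral excludes zeros of
  u up to a null set.\<close>

lemma AE_pos_of_powr_integrable:
  fixes u :: "'a \<Rightarrow> real"
  assumes "\<And>x. 0 \<le> u x" "a < 0" "(\<lambda>x. ennreal (u x) epowr a) \<in> borel_measurable M" "R \<in> sets M"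
    and "(\<integral>\<^sup>+x\<in>R. ennreal (u x) epowr a \<partial>M) \<noteq> \<infinity>"
  shows "AE x in M. x \<in> R \<longrightarrow> 0 < u x"
proof -
  have "AE x in M. ennreal (u x) epowr a * indicator R x \<noteq> \<infinity>"
    by (rule nn_integral_noteq_infinite) (use assms in auto)
  then show ?thesis
  proof eventually_elim
    case (elim x)
    then show ?case using assms(1)[of x] assms(2) by (cases "u x = 0") (auto simp: epowr_def)
  qed
qed

lemma borel_measurable_epowr [measurable]: "(\<lambda>x. x epowr a) \<in> borel_measurable borel"
  unfolding epowr_def by measurable

text \<open>Centred cubes exhaust the space. Starting at an arbitrary \<open>N\<close> matters for
  A_s weights, where information is first available only on cubes that carry mass.\<close>

lemma AE_of_large_rectangles:
  fixes Q :: "real ^ 'n \<Rightarrow> bool"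
  assumes "\<And>M. N \<le> M \<Longrightarrow> AE x in lebesgue. x \<in> cbox (\<chi> i. - real (Suc M)) (\<chi> i. real (Suc M)) \<longrightarrow> Q x"
  shows "AE x in lebesgue. Q x"
proof -
  have "AE x in lebesgue. \<forall>M. x \<in> cbox (\<chi> i. - real (Suc (N + M))) (\<chi> i. real (Suc (N + M))) \<longrightarrow> Q x"
    unfolding AE_all_countable by (intro allI assms) simp
  then show ?thesis
  proof eventually_elim
    case (elim x)
    obtain M where M: "norm x \<le> real M" using real_arch_simple by blast
    have "x \<in> cbox (\<chi> i. - real (Suc (N + M))) (\<chi> i. real (Suc (N + M)))"
      unfolding mem_box_cart
    proof
      fix i show "(\<chi> i. - real (Suc (N + M))) $ i \<le> x $ i \<and> x $ i \<le> (\<chi> i. real (Suc (N + M))) $ i"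
        using component_le_norm_cart[of x i] M by auto
    qed
    then show ?case using elim by blast
  qed
qed

lemma large_rectangle: "cbox (\<chi> i. - real (Suc M)) (\<chi> i. real (Suc M)) \<in> (rectangles :: (real ^ 'n) set set)"
  unfolding rectangles_def by (auto intro!: exI)

text \<open>An A_s weight is a.e. zero or a.e. positive. In \<open>ennreal\<close> the product of 0
  and infinity is 0, so a cube without v-mass says nothing about the dual average; but once some
  cube has mass, every larger one does too, its dual average must be finite, and v > 0 a.e.
  there.\<close>

lemma A_class_pos:
  fixes v :: "real ^ 'n \<Rightarrow> real"
  assumes s: "1 < s" and v: "v \<in> A_class s" and nz: "\<not> (AE x in lebesgue. v x = 0)"
  shows "AE x in lebesgue. 0 < v x"
proof -
  define R where "R M = (cbox (\<chi> i. - real (Suc M)) (\<chi> i. real (Suc M)) :: (real ^ 'n) set)" for M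
  have R: "R M \<in> rectangles" for M unfolding R_def by (rule large_rectangle)
  have Rmono: "R N \<subseteq> R M" if "N \<le> M" for N M
    using that by (auto simp: R_def mem_box_cart) (smt (verit) of_nat_mono)+
  have vm [measurable]: "v \<in> borel_measurable lebesgue" and v0: "\<And>x. 0 \<le> v x"
    using v by (auto simp: A_class_def is_weight_def)
  have Rs [measurable]: "R M \<in> sets lebesgue" for M using R rectangleE by metis
  obtain N where N: "(\<integral>\<^sup>+x\<in>R N. ennreal (v x) \<partial>lebesgue) \<noteq> 0"
  proof (rule ccontr)
    assume "\<not> thesis"
    then have 0: "(\<integral>\<^sup>+x\<in>R M. ennreal (v x) \<partial>lebesgue) = 0" for M using that by blast
    have "AE x in lebesgue. x \<in> R M \<longrightarrow> v x = 0" for M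
      using 0[of M] set_nn_integral_0_iff_AE[OF vm Rs v0] by blast
    then have "AE x in lebesgue. v x = 0"
      unfolding R_def by - (rule AE_of_large_rectangles[of 0])
    then show False using nz by blast
  qed
  show ?thesis
  proof (rule AE_of_large_rectangles[of N])
    fix M assume NM: "N \<le> M"
    obtain h where h: "0 < h" "emeasure lebesgue (R M) = ennreal h" using R rectangleE by metis
    let ?V = "\<integral>\<^sup>+x\<in>R M. ennreal (v x) \<partial>lebesgue" and ?a = "1 - conj_exp s"
    let ?S = "\<integral>\<^sup>+x\<in>R M. ennreal (v x) epowr ?a \<partial>lebesgue"
    have a: "?a < 0" and e: "0 < s / conj_exp s" using s by (auto simp: conj_exp_def field_simps)
    have "(\<integral>\<^sup>+x\<in>R N. ennreal (v x) \<partial>lebesgue) \<le> ?V"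
      using Rmono[OF NM] by (intro nn_integral_mono) (auto simp: indicator_def)
    then have "?V \<noteq> 0" using N by auto
    then have V: "average (R M) (\<lambda>x. ennreal (v x)) \<noteq> 0"
      using h by (simp add: average_def ennreal_divide_eq_0_iff)
    have "average (R M) (\<lambda>x. ennreal (v x)) * (average (R M) (\<lambda>x. ennreal (v x) epowr ?a)) epowr (s / conj_exp s) < \<infinity>"
      using v R[of M] by (auto simp: A_class_def elim!: le_less_trans[rotated] intro: SUP_upper)
    then have "(average (R M) (\<lambda>x. ennreal (v x) epowr ?a)) epowr (s / conj_exp s) \<noteq> \<infinity>"
      using V by (auto simp: ennreal_mult_eq_top_iff)
    then have "average (R M) (\<lambda>x. ennreal (v x) epowr ?a) \<noteq> \<infinity>"
      using epowr_eq_top_iff[OF e] by blast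
    then have "?S \<noteq> \<infinity>" using h by (auto simp: average_def ennreal_top_divide)
    then have "AE x in lebesgue. x \<in> R M \<longrightarrow> 0 < v x"
      by (intro AE_pos_of_powr_integrable[OF v0 a]) auto
    then show "AE x in lebesgue. x \<in> cbox (\<chi> i. - real (Suc M)) (\<chi> i. real (Suc M)) \<longrightarrow> 0 < v x"
      unfolding R_def .
  qed
qed

section \<open>Discretisation of the weights\<close>

definition grid_integrable :: "(real ^ 'n \<Rightarrow> real) \<Rightarrow> bool" where
  "grid_integrable u \<longleftrightarrow> u \<in> borel_measurable lebesgue \<and> (\<forall>x. 0 \<le> u x) \<and>
    (\<forall>D a b. 0 < D \<longrightarrow> a \<le> b \<longrightarrow> (\<integral>\<^sup>+x\<in>gridbox D a b. ennreal (u x) \<partial>lebesgue) < \<infinity>)"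

text \<open>\<open>enn2real\<close> sends infinity to 0, so the value is meaningful only for
  functions that are \<open>grid_integrable\<close>; that predicate exists to make all further work
  real-valued.\<close>

definition box_int :: "nat \<Rightarrow> ('n \<Rightarrow> int) \<Rightarrow> ('n \<Rightarrow> int) \<Rightarrow> (real ^ 'n \<Rightarrow> real) \<Rightarrow> real" where
  "box_int D a b u = enn2real (\<integral>\<^sup>+x\<in>gridbox D a b. ennreal (u x) \<partial>lebesgue)"

lemma box_int_nonneg: "0 \<le> box_int D a b u"
  by (simp add: box_int_def)

lemma nn_integral_eq_box_int:
  assumes "grid_integrable u" "0 < D" "a \<le> b"
  shows "(\<integral>\<^sup>+x\<in>gridbox D a b. ennreal (u x) \<partial>lebesgue) = ennreal (box_int D a b u)"
  using assms unfolding box_int_def grid_integrable_def by simp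

lemma box_int_sum:
  fixes a b :: "'n::finite \<Rightarrow> int"
  assumes u: "grid_integrable u" and D: "0 < D" and ab: "a \<le> b"
  shows "box_int D a b u = (\<Sum>k\<in>{a..b}. box_int D k k u)"
proof -
  have "ennreal (box_int D a b u) = (\<Sum>k\<in>{a..b}. \<integral>\<^sup>+x\<in>gridbox D k k. ennreal (u x) \<partial>lebesgue)"
    unfolding nn_integral_eq_box_int[OF assms, symmetric]
    using u by (intro nn_integral_gridbox_sum D) (auto simp: grid_integrable_def)
  also have "\<dots> = (\<Sum>k\<in>{a..b}. ennreal (box_int D k k u))"
    by (intro sum.cong nn_integral_eq_box_int u D) auto
  also have "\<dots> = ennreal (\<Sum>k\<in>{a..b}. box_int D k k u)"
    by (intro sum_ennreal box_int_nonneg)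
  finally show ?thesis by (simp add: box_int_nonneg sum_nonneg)
qed

lemma emeasure_gridbox:
  fixes a b :: "'n::finite \<Rightarrow> int"
  assumes "0 < D" "a \<le> b"
  shows "emeasure lebesgue (gridbox D a b) = ennreal (real (card {a..b}) / real D ^ CARD('n))"
proof -
  have "emeasure lebesgue (gridbox D a b) = (\<integral>\<^sup>+x\<in>gridbox D a b. 1 \<partial>lebesgue)"
    using nn_integral_indicator[OF sets_gridbox[OF assms(1)], of a b] by simp
  also have "\<dots> = (\<integral>\<^sup>+x\<in>gridrect D a b. 1 \<partial>lebesgue)"
    by (rule nn_integral_gridbox_eq[OF assms(1)])
  also have "\<dots> = emeasure lebesgue (gridrect D a b)"
    by (simp add: gridrect_def)
  finally show ?thesis by (simp only: emeasure_gridrect[OF assms])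
qed

lemma gridbox_measure_pos:
  fixes a b :: "'n::finite \<Rightarrow> int"
  assumes "0 < D" "a \<le> b"
  shows "0 < real (card {a..b}) / real D ^ CARD('n)"
proof -
  have "card {a..b} > 0" by (subst card_gt_0_iff) (use assms(2) in auto)
  then show ?thesis using assms(1) by simp
qed

lemma box_int_pos:
  fixes a b :: "'n::finite \<Rightarrow> int"
  assumes u: "grid_integrable u" and D: "0 < D" and ab: "a \<le> b" and pos: "AE x in lebesgue. 0 < u x"
  shows "0 < box_int D a b u"
proof -
  have "(\<integral>\<^sup>+x\<in>gridbox D a b. ennreal (u x) \<partial>lebesgue) \<noteq> 0"
  proof (rule set_nn_integral_pos[OF _ _ pos])
    show "emeasure lebesgue (gridbox D a b) \<noteq> 0"
      unfolding emeasure_gridbox[OF D ab] using gridbox_measure_pos[OF D ab] by (simp add: ennreal_eq_0_iff)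
  qed (use u sets_gridbox[OF D] in \<open>auto simp: grid_integrable_def\<close>)
  then show ?thesis unfolding nn_integral_eq_box_int[OF u D ab]
    using box_int_nonneg[of D a b u] by (auto simp: ennreal_eq_0_iff)
qed

lemma grid_integrableI:
  assumes "u \<in> borel_measurable lebesgue" "\<And>x. 0 \<le> u x"
    and "\<And>R. R \<in> rectangles \<Longrightarrow> (\<integral>\<^sup>+x\<in>R. ennreal (u x) \<partial>lebesgue) < \<infinity>"
  shows "grid_integrable u"
  unfolding grid_integrable_def using assms
  by (auto simp: nn_integral_gridbox_eq gridrect_in_rectangles)

lemma is_weight_grid_integrable: "is_weight w \<Longrightarrow> grid_integrable w"
  by (rule grid_integrableI) (auto simp: is_weight_def)

lemma box_int_Hoelder:
  assumes f: "grid_integrable f" and g: "grid_integrable g" and D: "0 < D" and ab: "a \<le> b"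
    and \<theta>: "0 < \<theta>" "\<theta> < 1"
  shows "(\<integral>\<^sup>+x\<in>gridbox D a b. ennreal (f x powr \<theta> * g x powr (1 - \<theta>)) \<partial>lebesgue)
    \<le> ennreal (box_int D a b f powr \<theta> * box_int D a b g powr (1 - \<theta>))"
proof -
  let ?i = "indicat_real (gridbox D a b)"
  have [measurable]: "f \<in> borel_measurable lebesgue" "g \<in> borel_measurable lebesgue" "gridbox D a b \<in> sets lebesgue"
    using f g sets_gridbox[OF D] by (auto simp: grid_integrable_def)
  have int: "(\<integral>\<^sup>+x. ennreal (u x * ?i x) \<partial>lebesgue) = ennreal (box_int D a b u)" if "grid_integrable u" for u
    unfolding nn_integral_eq_box_int[OF that D ab, symmetric]
    by (intro nn_integral_cong) (auto simp: indicator_def)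
  have "(\<integral>\<^sup>+x\<in>gridbox D a b. ennreal (f x powr \<theta> * g x powr (1 - \<theta>)) \<partial>lebesgue)
      = (\<integral>\<^sup>+x. ennreal ((f x * ?i x) powr \<theta> * (g x * ?i x) powr (1 - \<theta>)) \<partial>lebesgue)"
    by (intro nn_integral_cong) (auto simp: indicator_def)
  also have "\<dots> \<le> ennreal (box_int D a b f powr \<theta> * box_int D a b g powr (1 - \<theta>))"
    by (rule nn_integral_Hoelder[OF _ _ _ _ \<theta> int[OF f] int[OF g] box_int_nonneg box_int_nonneg])
      (use f g in \<open>auto simp: grid_integrable_def\<close>)
  finally show ?thesis .
qed

text \<open>As v > 0 a.e., its average over a rectangle is nonzero, so the finite A_s product makes
  the dual weight locally integrable. The exponents simplify by 1 - s' = -1/(s-1) and s/s' = s -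
  1.\<close>

lemma A_class_grid_integrable_dual:
  fixes v :: "real ^ 'n \<Rightarrow> real"
  assumes s: "1 < s" and v: "v \<in> A_class s" and pos: "AE x in lebesgue. 0 < v x"
  obtains K where "0 < K" "grid_integrable (\<lambda>x. v x powr (- 1 / (s - 1)))"
    "\<And>D a b. \<lbrakk>0 < D; a \<le> b\<rbrakk> \<Longrightarrow>
      box_int D a b v * box_int D a b (\<lambda>x. v x powr (- 1 / (s - 1))) powr (s - 1)
        \<le> K * (real (card {a..b}) / real D ^ CARD('n)) powr s"
proof -
  define \<sigma> where "\<sigma> x = v x powr (- 1 / (s - 1))" for x
  have w: "is_weight v" using v by (simp add: A_class_def)
  have vm [measurable]: "v \<in> borel_measurable lebesgue" and v0: "\<And>x. 0 \<le> v x"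
    using w by (auto simp: is_weight_def)
  have exps: "1 - conj_exp s = - 1 / (s - 1)" "s / conj_exp s = s - 1"
    using s by (auto simp: conj_exp_def field_simps)
  define M where "M = (SUP R \<in> rectangles. average R (\<lambda>x. ennreal (v x)) *
        (average R (\<lambda>x. ennreal (v x) epowr (1 - conj_exp s))) epowr (s / conj_exp s))"
  have M: "M < \<infinity>" using v by (simp add: A_class_def M_def)
  have RA: "average R (\<lambda>x. ennreal (v x)) * (average R (\<lambda>x. ennreal (\<sigma> x))) epowr (s - 1) \<le> M"
    if R: "R \<in> rectangles" for R
  proof -
    have "average R (\<lambda>x. ennreal (v x)) * (average R (\<lambda>x. ennreal (v x) epowr (1 - conj_exp s))) epowr (s / conj_exp s) \<le> M"
      unfolding M_def using R by (rule SUP_upper)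
    then show ?thesis
      unfolding average_def set_nn_integral_powr_cong[OF pos] exps \<sigma>_def .
  qed
  have sm: "\<sigma> \<in> borel_measurable lebesgue" unfolding \<sigma>_def by measurable
  have spos: "AE x in lebesgue. 0 < \<sigma> x"
    using pos by eventually_elim (simp add: \<sigma>_def)
  have gi: "grid_integrable \<sigma>"
  proof (rule grid_integrableI[OF sm])
    fix R :: "(real ^ 'n) set" assume R: "R \<in> rectangles"
    obtain h where h: "0 < h" "emeasure lebesgue R = ennreal h" and [measurable]: "R \<in> sets lebesgue"
      using R by (rule rectangleE)
    have "(\<integral>\<^sup>+x\<in>R. ennreal (v x) \<partial>lebesgue) \<noteq> 0"
      by (rule set_nn_integral_pos[OF _ _ pos]) (use h in auto)
    then have V: "average R (\<lambda>x. ennreal (v x)) \<noteq> 0"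
      using h by (simp add: average_def ennreal_divide_eq_0_iff)
    have "(average R (\<lambda>x. ennreal (\<sigma> x))) epowr (s - 1) \<noteq> \<infinity>"
      using V RA[OF R] M by (auto simp: ennreal_mult_eq_top_iff top_unique)
    then have "average R (\<lambda>x. ennreal (\<sigma> x)) \<noteq> \<infinity>"
      using epowr_eq_top_iff[of "s - 1"] s by auto
    then show "(\<integral>\<^sup>+x\<in>R. ennreal (\<sigma> x) \<partial>lebesgue) < \<infinity>"
      using h by (auto simp: average_def ennreal_top_divide less_top[symmetric])
  qed (simp add: \<sigma>_def)
  have giv: "grid_integrable v" using w by (rule is_weight_grid_integrable)
  show ?thesis
  \<comment> \<open>Adding 1 to the supremum gives a constant that is positive by
    construction.\<close>
  proof (rule that[of "enn2real M + 1"])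
    fix D :: nat and a b :: "'n \<Rightarrow> int" assume D: "0 < D" and ab: "a \<le> b"
    define h where "h = real (card {a..b}) / real D ^ CARD('n)"
    have h: "0 < h" unfolding h_def by (rule gridbox_measure_pos[OF D ab])
    have V: "0 < box_int D a b v" by (rule box_int_pos[OF giv D ab pos])
    have S: "0 < box_int D a b \<sigma>" by (rule box_int_pos[OF gi D ab spos])
    have "average (gridrect D a b) (\<lambda>x. ennreal (u x)) = ennreal (box_int D a b u / h)"
      if "grid_integrable u" for u
      unfolding average_def nn_integral_gridbox_eq[OF D, symmetric] nn_integral_eq_box_int[OF that D ab]
        emeasure_gridrect[OF D ab] h_def[symmetric] using h by (simp add: divide_ennreal box_int_nonneg)
    then have "ennreal (box_int D a b v / h) * ennreal (box_int D a b \<sigma> / h) epowr (s - 1) \<le> M"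
      using RA[OF gridrect_in_rectangles[OF D ab]] gi giv by simp
    then have "ennreal (box_int D a b v / h) * ennreal ((box_int D a b \<sigma> / h) powr (s - 1)) \<le> M"
      using h S by (subst (asm) epowr_ennreal) auto
    then have "ennreal (box_int D a b v / h * (box_int D a b \<sigma> / h) powr (s - 1)) \<le> M"
      using h V by (subst ennreal_mult) auto
    also have "M = ennreal (enn2real M)" using M by simp
    finally have "box_int D a b v / h * (box_int D a b \<sigma> / h) powr (s - 1) \<le> enn2real M"
      by (simp add: ennreal_le_iff)
    also have "box_int D a b v / h * (box_int D a b \<sigma> / h) powr (s - 1)
        = box_int D a b v * box_int D a b \<sigma> powr (s - 1) / h powr s"
      using h S by (simp add: powr_divide powr_mult_base[symmetric] powr_diff)
    finally have "box_int D a b v * box_int D a b \<sigma> powr (s - 1) \<le> enn2real M * h powr s"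
      using h by (simp add: pos_divide_le_eq)
    also have "\<dots> \<le> (enn2real M + 1) * h powr s" by (intro mult_right_mono) auto
    finally show "box_int D a b v * box_int D a b (\<lambda>x. v x powr (- 1 / (s - 1))) powr (s - 1)
        \<le> (enn2real M + 1) * (real (card {a..b}) / real D ^ CARD('n)) powr s"
      by (simp add: \<sigma>_def[abs_def] h_def)
  qed (use gi in \<open>simp_all add: \<sigma>_def[abs_def] add_nonneg_pos\<close>)
qed

text \<open>The lattice condition involves powers of the cell integrals of v rather than cell
  integrals of \<sigma>. Hoelder bounds the former by h^(-s') times the latter, h being the cell
  volume, and the powers of h cancel through h^(-s) (N h)^s = N^s. Hence one K serves every
  mesh.\<close>

lemma A_class_grid:
  fixes v :: "real ^ 'n \<Rightarrow> real"
  assumes s: "1 < s" and v: "v \<in> A_class s" and pos: "AE x in lebesgue. 0 < v x"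
  obtains K where "0 < K"
    "\<And>D a b. \<lbrakk>0 < D; a \<le> b\<rbrakk> \<Longrightarrow>
      (\<Sum>k\<in>{a..b}. box_int D k k v) * (\<Sum>k\<in>{a..b}. box_int D k k v powr (- 1 / (s - 1))) powr (s - 1)
        \<le> K * real (card {a..b}) powr s"
proof -
  define \<sigma> where "\<sigma> x = v x powr (- 1 / (s - 1))" for x
  obtain K where K: "0 < K" and gi: "grid_integrable \<sigma>"
    and A: "\<And>D a b. \<lbrakk>0 < D; a \<le> b\<rbrakk> \<Longrightarrow>
      box_int D a b v * box_int D a b \<sigma> powr (s - 1) \<le> K * (real (card {a..b}) / real D ^ CARD('n)) powr s"
    unfolding \<sigma>_def using A_class_grid_integrable_dual[OF assms] by metis
  have giv: "grid_integrable v" using v by (auto intro: is_weight_grid_integrable simp: A_class_def)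
  have spos: "AE x in lebesgue. 0 < \<sigma> x"
    using pos by eventually_elim (simp add: \<sigma>_def)
  show ?thesis
  proof (rule that[OF K])
    fix D :: nat and a b :: "'n \<Rightarrow> int" assume D: "0 < D" and ab: "a \<le> b"
    define h where "h = 1 / real D ^ CARD('n)"
    have h: "0 < h" using D by (simp add: h_def)
    (* Hoelder on one cell Q: |Q|^s <= v(Q) sigma(Q)^(s-1). *)
    have cell: "box_int D k k v powr (- 1 / (s - 1)) \<le> h powr (- s / (s - 1)) * box_int D k k \<sigma>" for k
    proof -
      have V: "0 < box_int D k k v" by (rule box_int_pos[OF giv D order_refl pos])
      have S: "0 < box_int D k k \<sigma>" by (rule box_int_pos[OF gi D order_refl spos])
      have "ennreal h = (\<integral>\<^sup>+x\<in>gridbox D k k. 1 \<partial>lebesgue)"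
        using emeasure_gridbox[OF D, of k k] sets_gridbox[OF D, of k k] by (simp add: h_def)
      also have "\<dots> = (\<integral>\<^sup>+x\<in>gridbox D k k. ennreal (v x powr (1 / s) * \<sigma> x powr (1 - 1 / s)) \<partial>lebesgue)"
      proof (rule nn_integral_cong_AE)
        have "- 1 / (s - 1) * (1 - 1 / s) = - 1 / s" using s by (simp add: field_simps)
        then have "v x powr (1 / s) * \<sigma> x powr (1 - 1 / s) = 1" if "0 < v x" for x
          using that by (simp add: \<sigma>_def powr_powr flip: powr_add)
        with pos show "AE x in lebesgue. 1 * indicator (gridbox D k k) x =
           ennreal (v x powr (1 / s) * \<sigma> x powr (1 - 1 / s)) * indicator (gridbox D k k) x"
          by (auto elim!: eventually_mono)
      qed
      also have "\<dots> \<le> ennreal (box_int D k k v powr (1 / s) * box_int D k k \<sigma> powr (1 - 1 / s))"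
        using s by (intro box_int_Hoelder giv gi D order_refl) auto
      finally have "h \<le> box_int D k k v powr (1 / s) * box_int D k k \<sigma> powr (1 - 1 / s)"
        by (subst (asm) ennreal_le_iff) auto
      then have "h powr (s / (s - 1)) \<le> (box_int D k k v powr (1 / s) * box_int D k k \<sigma> powr (1 - 1 / s)) powr (s / (s - 1))"
        using s h by (intro powr_mono2) auto
      also have "\<dots> = box_int D k k v powr (1 / (s - 1)) * box_int D k k \<sigma>"
      proof -
        have "(1 - 1 / s) * (s / (s - 1)) = 1" "1 / s * (s / (s - 1)) = 1 / (s - 1)"
          using s by (auto simp: field_simps)
        moreover have "(box_int D k k v powr (1 / s) * box_int D k k \<sigma> powr (1 - 1 / s)) powr (s / (s - 1))
          = box_int D k k v powr (1 / s * (s / (s - 1))) * box_int D k k \<sigma> powr ((1 - 1 / s) * (s / (s - 1)))"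
          by (subst powr_mult) (simp_all only: powr_powr powr_ge_zero)
        ultimately show ?thesis using S by (simp only: powr_one less_imp_le)
      qed
      finally show ?thesis using V S h by (simp add: powr_minus field_simps)
    qed
    have "(\<Sum>k\<in>{a..b}. box_int D k k v) * (\<Sum>k\<in>{a..b}. box_int D k k v powr (- 1 / (s - 1))) powr (s - 1)
      \<le> (\<Sum>k\<in>{a..b}. box_int D k k v) * (\<Sum>k\<in>{a..b}. h powr (- s / (s - 1)) * box_int D k k \<sigma>) powr (s - 1)"
      using s by (intro mult_left_mono powr_mono2 sum_mono cell sum_nonneg box_int_nonneg) auto
    also have "\<dots> = box_int D a b v * (h powr (- s / (s - 1)) * box_int D a b \<sigma>) powr (s - 1)"
      by (simp add: box_int_sum[OF giv D ab] box_int_sum[OF gi D ab] sum_distrib_left)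
    also have "\<dots> = h powr (- s) * (box_int D a b v * box_int D a b \<sigma> powr (s - 1))"
      using s by (simp add: powr_mult box_int_nonneg powr_powr)
    also have "\<dots> \<le> h powr (- s) * (K * (real (card {a..b}) / real D ^ CARD('n)) powr s)"
      by (intro mult_left_mono A D ab) auto
    also have "real (card {a..b}) / real D ^ CARD('n) = real (card {a..b}) * h" by (simp add: h_def)
    also have "h powr (- s) * (K * (real (card {a..b}) * h) powr s) = K * real (card {a..b}) powr s"
      using h by (simp add: powr_mult powr_minus)
    finally show "(\<Sum>k\<in>{a..b}. box_int D k k v) * (\<Sum>k\<in>{a..b}. box_int D k k v powr (- 1 / (s - 1))) powr (s - 1)
        \<le> K * real (card {a..b}) powr s" .
  qed
qed

section \<open>The bump condition and the splitting of f on the grid\<close>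

lemma prod_ennreal_not_top:
  fixes f :: "'i \<Rightarrow> ennreal"
  assumes "finite I" "\<And>i. i \<in> I \<Longrightarrow> f i \<noteq> 0" "prod f I \<noteq> \<infinity>" "j \<in> I"
  shows "f j \<noteq> \<infinity>"
proof
  assume "f j = \<infinity>"
  moreover have "prod f I = f j * prod f (I - {j})" using assms(1,4) by (rule prod.remove)
  moreover have "prod f (I - {j}) \<noteq> 0" using assms(1,2) by simp
  ultimately show False using assms(3) by (simp add: ennreal_mult_eq_top_iff)
qed

lemma average_gridrect:
  fixes a b :: "'n::finite \<Rightarrow> int"
  assumes "grid_integrable u" "0 < D" "a \<le> b"
  shows "average (gridrect D a b) (\<lambda>x. ennreal (u x))
    = ennreal (box_int D a b u / (real (card {a..b}) / real D ^ CARD('n)))"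
  unfolding average_def nn_integral_gridbox_eq[OF assms(2), symmetric] nn_integral_eq_box_int[OF assms]
    emeasure_gridrect[OF assms(2,3)]
  by (rule divide_ennreal[OF box_int_nonneg gridbox_measure_pos[OF assms(2,3)]])

text \<open>All factors of the bump expression are nonzero once v > 0 a.e., so finiteness of the
  product passes to each factor: the powers of w_i are locally integrable and w_i > 0 a.e. Only then
  can the condition be stated with real numbers. The exponents \<tau> and \<kappa> stand for (1 -
  p_i')r and 1/(r p_i').\<close>

lemma bump_grid:
  fixes w :: "'i \<Rightarrow> real ^ 'n \<Rightarrow> real" and v :: "real ^ 'n \<Rightarrow> real" and \<tau> \<kappa> :: "'i \<Rightarrow> real"
  assumes I: "finite I" and \<tau>: "\<And>i. i \<in> I \<Longrightarrow> \<tau> i < 0" and \<kappa>: "\<And>i. i \<in> I \<Longrightarrow> 0 < \<kappa> i" and q: "0 < q"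
    and w: "\<And>i. i \<in> I \<Longrightarrow> is_weight (w i)" and v: "is_weight v" and vpos: "AE x in lebesgue. 0 < v x"
    and fin: "(SUP R \<in> rectangles. (emeasure lebesgue R) epowr e * (average R (\<lambda>x. ennreal (v x))) epowr (1 / q) *
       (\<Prod>i\<in>I. (average R (\<lambda>x. ennreal (w i x) epowr \<tau> i)) epowr \<kappa> i)) < \<infinity>"
  obtains K where "0 < K" "\<And>i. i \<in> I \<Longrightarrow> AE x in lebesgue. 0 < w i x"
    "\<And>i. i \<in> I \<Longrightarrow> grid_integrable (\<lambda>x. w i x powr \<tau> i)"
    "\<And>D a b. \<lbrakk>0 < D; a \<le> b\<rbrakk> \<Longrightarrow> (let h = real (card {a..b}) / real D ^ CARD('n) in
      h powr e * (box_int D a b v / h) powr (1 / q) *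
      (\<Prod>i\<in>I. (box_int D a b (\<lambda>x. w i x powr \<tau> i) / h) powr \<kappa> i) \<le> K)"
proof -
  define M where "M = (SUP R \<in> rectangles. (emeasure lebesgue R) epowr e * (average R (\<lambda>x. ennreal (v x))) epowr (1 / q) *
       (\<Prod>i\<in>I. (average R (\<lambda>x. ennreal (w i x) epowr \<tau> i)) epowr \<kappa> i))"
  have M: "M < \<infinity>" using fin by (simp only: M_def)
  have RM: "(emeasure lebesgue R) epowr e * (average R (\<lambda>x. ennreal (v x))) epowr (1 / q) *
       (\<Prod>i\<in>I. (average R (\<lambda>x. ennreal (w i x) epowr \<tau> i)) epowr \<kappa> i) \<le> M"
    if "R \<in> rectangles" for R unfolding M_def using that by (rule SUP_upper)
  have wm [measurable]: "w i \<in> borel_measurable lebesgue" and w0: "0 \<le> w i x" if "i \<in> I" for i x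
    using w[OF that] by (auto simp: is_weight_def)
  have [measurable]: "v \<in> borel_measurable lebesgue" using v by (simp add: is_weight_def)
  have wint: "(\<integral>\<^sup>+x\<in>R. ennreal (w i x) epowr \<tau> i \<partial>lebesgue) \<noteq> \<infinity>"
    if i: "i \<in> I" and R: "R \<in> rectangles" for i R
  proof -
    obtain h where h: "0 < h" "emeasure lebesgue R = ennreal h" and [measurable]: "R \<in> sets lebesgue"
      using R by (rule rectangleE)
    have "(\<integral>\<^sup>+x\<in>R. ennreal (v x) \<partial>lebesgue) \<noteq> 0"
      by (rule set_nn_integral_pos[OF _ _ vpos]) (use h in auto)
    then have "average R (\<lambda>x. ennreal (v x)) \<noteq> 0"
      using h by (simp add: average_def ennreal_divide_eq_0_iff)
    then have V: "average R (\<lambda>x. ennreal (v x)) epowr (1 / q) \<noteq> 0"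
      using q by (simp add: epowr_eq_0_iff)
    have hh: "emeasure lebesgue R epowr e \<noteq> 0"
      using h by (simp add: epowr_ennreal ennreal_eq_0_iff)
    \<comment> \<open>A negative power of w j vanishes nowhere, because w j is real-valued and so
      never infinite.\<close>
    have W: "(average R (\<lambda>x. ennreal (w j x) epowr \<tau> j)) epowr \<kappa> j \<noteq> 0" if j: "j \<in> I" for j
    proof -
      have pos: "ennreal (w j x) epowr \<tau> j \<noteq> 0" for x
        using w0[OF j, of x] \<tau>[OF j] by (auto simp: epowr_def ennreal_eq_0_iff)
      have "(\<integral>\<^sup>+x\<in>R. ennreal (w j x) epowr \<tau> j \<partial>lebesgue) \<noteq> 0"
      proof
        assume "(\<integral>\<^sup>+x\<in>R. ennreal (w j x) epowr \<tau> j \<partial>lebesgue) = 0"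
        then have "AE x in lebesgue. ennreal (w j x) epowr \<tau> j * indicator R x = 0"
          using wm[OF j] by (subst (asm) nn_integral_0_iff_AE) auto
        then have "AE x in lebesgue. x \<notin> R" using pos by (auto simp: indicator_def elim!: eventually_mono split: if_splits)
        then show False using h AE_iff_null_sets[of R lebesgue] \<open>R \<in> sets lebesgue\<close>
          by (auto simp: null_sets_def)
      qed
      then show ?thesis using h \<kappa>[OF j] by (simp add: epowr_eq_0_iff average_def ennreal_divide_eq_0_iff)
    qed
    have "(\<Prod>i\<in>I. (average R (\<lambda>x. ennreal (w i x) epowr \<tau> i)) epowr \<kappa> i) \<noteq> \<infinity>"
      using RM[OF R] M V hh by (auto simp: ennreal_mult_eq_top_iff top_unique)
    then have "(average R (\<lambda>x. ennreal (w i x) epowr \<tau> i)) epowr \<kappa> i \<noteq> \<infinity>"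
      by (rule prod_ennreal_not_top[OF I _ _ i, rotated]) (rule W)
    then have "average R (\<lambda>x. ennreal (w i x) epowr \<tau> i) \<noteq> \<infinity>"
      using epowr_eq_top_iff[OF \<kappa>[OF i]] by blast
    then show ?thesis using h by (auto simp: average_def ennreal_top_divide)
  qed
  have wpos: "AE x in lebesgue. 0 < w i x" if i: "i \<in> I" for i
  proof (rule AE_of_large_rectangles[of 0])
    fix M :: nat
    let ?R = "cbox (\<chi> i. - real (Suc M)) (\<chi> i. real (Suc M)) :: (real ^ 'n) set"
    show "AE x in lebesgue. x \<in> ?R \<longrightarrow> 0 < w i x"
      by (rule AE_pos_of_powr_integrable[OF w0[OF i] \<tau>[OF i] _ _ wint[OF i large_rectangle]])
        (use wm[OF i] in auto)
  qed
  have gi: "grid_integrable (\<lambda>x. w i x powr \<tau> i)" if i: "i \<in> I" for i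
  proof (rule grid_integrableI)
    fix R :: "(real ^ 'n) set" assume R: "R \<in> rectangles"
    show "(\<integral>\<^sup>+x\<in>R. ennreal (w i x powr \<tau> i) \<partial>lebesgue) < \<infinity>"
      using wint[OF i R] unfolding set_nn_integral_powr_cong[OF wpos[OF i]] by (simp add: less_top)
  qed (use wm[OF i] in auto)
  have giv: "grid_integrable v" using v by (rule is_weight_grid_integrable)
  show ?thesis
  proof (rule that[of "enn2real M + 1"])
    fix D :: nat and a b :: "'n \<Rightarrow> int" assume D: "0 < D" and ab: "a \<le> b"
    define h where "h = real (card {a..b}) / real D ^ CARD('n)"
    have h: "0 < h" unfolding h_def by (rule gridbox_measure_pos[OF D ab])
    have V: "0 < box_int D a b v" by (rule box_int_pos[OF giv D ab vpos])
    have av: "average (gridrect D a b) (\<lambda>x. ennreal (w i x) epowr \<tau> i) epowr \<kappa> i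
        = ennreal ((box_int D a b (\<lambda>x. w i x powr \<tau> i) / h) powr \<kappa> i)" if i: "i \<in> I" for i
    proof -
      have "average (gridrect D a b) (\<lambda>x. ennreal (w i x) epowr \<tau> i) = average (gridrect D a b) (\<lambda>x. ennreal (w i x powr \<tau> i))"
        unfolding average_def set_nn_integral_powr_cong[OF wpos[OF i]] ..
      then show ?thesis
        unfolding average_gridrect[OF gi[OF i] D ab] h_def[symmetric]
        using h \<kappa>[OF i] by (simp add: epowr_ennreal box_int_nonneg)
    qed
    have "(emeasure lebesgue (gridrect D a b)) epowr e = ennreal (h powr e)"
      unfolding emeasure_gridrect[OF D ab] h_def[symmetric] using h by (simp add: epowr_ennreal)
    moreover have "(average (gridrect D a b) (\<lambda>x. ennreal (v x))) epowr (1 / q) = ennreal ((box_int D a b v / h) powr (1 / q))"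
      unfolding average_gridrect[OF giv D ab] h_def[symmetric] using h V by (simp add: epowr_ennreal)
    moreover have "(\<Prod>i\<in>I. (average (gridrect D a b) (\<lambda>x. ennreal (w i x) epowr \<tau> i)) epowr \<kappa> i)
       = ennreal (\<Prod>i\<in>I. (box_int D a b (\<lambda>x. w i x powr \<tau> i) / h) powr \<kappa> i)"
      by (subst prod_ennreal[symmetric]) (auto intro!: prod.cong av)
    ultimately have "ennreal (h powr e) * ennreal ((box_int D a b v / h) powr (1 / q)) *
      ennreal (\<Prod>i\<in>I. (box_int D a b (\<lambda>x. w i x powr \<tau> i) / h) powr \<kappa> i) \<le> M"
      using RM[OF gridrect_in_rectangles[OF D ab]] by simp
    then have "ennreal (h powr e * (box_int D a b v / h) powr (1 / q) *
      (\<Prod>i\<in>I. (box_int D a b (\<lambda>x. w i x powr \<tau> i) / h) powr \<kappa> i)) \<le> M"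
      by (subst ennreal_mult, simp, simp add: prod_nonneg, subst ennreal_mult) auto
    also have "M = ennreal (enn2real M)" using M by simp
    finally have "h powr e * (box_int D a b v / h) powr (1 / q) *
      (\<Prod>i\<in>I. (box_int D a b (\<lambda>x. w i x powr \<tau> i) / h) powr \<kappa> i) \<le> enn2real M"
      by (simp add: ennreal_le_iff)
    then show "let h = real (card {a..b}) / real D ^ CARD('n) in
      h powr e * (box_int D a b v / h) powr (1 / q) *
      (\<Prod>i\<in>I. (box_int D a b (\<lambda>x. w i x powr \<tau> i) / h) powr \<kappa> i) \<le> enn2real M + 1"
      by (simp add: Let_def h_def)
  qed (use wpos gi in \<open>auto simp: add_nonneg_pos\<close>)
qed

text \<open>Where w > 0, |f| = g^(1-\<kappa>) u^\<kappa>, and g^t = |f|^P w with t = P(1-\<kappa>).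
  Thus u carries the bumped weight, g carries the L^P(w) norm, and t > 1 is the exponent left for
  the maximal theorem.\<close>

lemma weighted_Hoelder_grid:
  fixes f w :: "real ^ 'n \<Rightarrow> real" and P \<kappa> N :: real
  defines "g \<equiv> \<lambda>x. (\<bar>f x\<bar> * w x powr (1 / P)) powr (1 / (1 - \<kappa>))"
    and "u \<equiv> \<lambda>x. w x powr (- 1 / (P * \<kappa>))"
  assumes f [measurable]: "f \<in> borel_measurable lebesgue" and w [measurable]: "w \<in> borel_measurable lebesgue"
    and w0: "\<And>x. 0 \<le> w x" and wpos: "AE x in lebesgue. 0 < w x" and P: "1 < P"
    and \<kappa>: "0 < \<kappa>" "\<kappa> < 1" "1 < P * (1 - \<kappa>)" and u: "grid_integrable u"
    and N: "(\<integral>\<^sup>+x. ennreal (\<bar>f x\<bar> powr P * w x) \<partial>lebesgue) = ennreal N" "0 \<le> N"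
  shows "grid_integrable g" "grid_integrable (\<lambda>x. \<bar>f x\<bar>)"
    "\<And>D a b. \<lbrakk>0 < D; a \<le> b\<rbrakk> \<Longrightarrow> box_int D a b (\<lambda>x. \<bar>f x\<bar>) \<le> box_int D a b g powr (1 - \<kappa>) * box_int D a b u powr \<kappa>"
    "\<And>D a b. \<lbrakk>0 < D; a \<le> b\<rbrakk> \<Longrightarrow>
      1 / real D ^ CARD('n) * (\<Sum>k\<in>{a..b}. (box_int D k k g / (1 / real D ^ CARD('n))) powr (P * (1 - \<kappa>))) \<le> N"
proof -
  define t where "t = P * (1 - \<kappa>)"
  have t: "1 < t" using \<kappa> by (simp add: t_def)
  have gm [measurable]: "g \<in> borel_measurable lebesgue" unfolding g_def by measurable
  have gt: "g x powr t = \<bar>f x\<bar> powr P * w x" for x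
  proof -
    have "g x powr t = (\<bar>f x\<bar> * w x powr (1 / P)) powr P"
      using \<kappa> by (simp add: g_def powr_powr t_def)
    also have "\<dots> = \<bar>f x\<bar> powr P * w x" using P w0[of x] by (simp add: powr_mult powr_powr)
    finally show ?thesis .
  qed
  have git: "grid_integrable (\<lambda>x. g x powr t)"
    unfolding grid_integrable_def
  proof (intro conjI allI impI)
    fix D a b
    have "(\<integral>\<^sup>+x\<in>gridbox D a b. ennreal (g x powr t) \<partial>lebesgue) \<le> ennreal N"
      unfolding N(1)[symmetric] gt by (intro nn_integral_mono) (auto simp: indicator_def)
    then show "(\<integral>\<^sup>+x\<in>gridbox D a b. ennreal (g x powr t) \<partial>lebesgue) < \<infinity>"
      by (rule le_less_trans) simp
  qed auto
  have gi1: "grid_integrable (\<lambda>x::real^'n. 1)"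
    by (rule grid_integrableI) (auto elim!: rectangleE)
  show gi: "grid_integrable g"
    unfolding grid_integrable_def
  proof (intro conjI allI impI)
    fix D :: nat and a b :: "'n \<Rightarrow> int" assume D: "0 < D" and ab: "a \<le> b"
    note [measurable] = sets_gridbox[OF D]
    \<comment> \<open>Local integrability of g follows from that of g^t and of constants, since t >
      1.\<close>
    have "g x \<le> 1 + g x powr t" for x
    proof (cases "g x \<le> 1")
      case False
      then have "g x powr 1 \<le> g x powr t" using t by (intro powr_mono) auto
      then show ?thesis using False by simp
    qed (simp add: add_increasing2)
    then have "ennreal (g x) \<le> ennreal (1 + g x powr t)" for x
      by (rule ennreal_leI)
    then have "ennreal (g x) \<le> ennreal 1 + ennreal (g x powr t)" for x
      by (subst (asm) ennreal_plus) auto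
    then have "(\<integral>\<^sup>+x\<in>gridbox D a b. ennreal (g x) \<partial>lebesgue)
      \<le> (\<integral>\<^sup>+x. ennreal 1 * indicator (gridbox D a b) x + ennreal (g x powr t) * indicator (gridbox D a b) x \<partial>lebesgue)"
      by (intro nn_integral_mono) (auto simp: indicator_def)
    also have "\<dots> = (\<integral>\<^sup>+x\<in>gridbox D a b. ennreal 1 \<partial>lebesgue) + (\<integral>\<^sup>+x\<in>gridbox D a b. ennreal (g x powr t) \<partial>lebesgue)"
      by (intro nn_integral_add) measurable
    also have "\<dots> < \<infinity>"
      using git gi1 D ab by (auto simp: grid_integrable_def)
    finally show "(\<integral>\<^sup>+x\<in>gridbox D a b. ennreal (g x) \<partial>lebesgue) < \<infinity>" .
  qed (auto simp: g_def)
  have fgu: "(\<integral>\<^sup>+x\<in>gridbox D a b. ennreal \<bar>f x\<bar> \<partial>lebesgue)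
      \<le> ennreal (box_int D a b g powr (1 - \<kappa>) * box_int D a b u powr \<kappa>)"
    if D: "0 < D" and ab: "a \<le> b" for D a b
  proof -
    \<comment> \<open>At w x = 0 the real \<open>powr\<close> would make the left side 0, hence the
      appeal to positivity almost everywhere.\<close>
    have "g x powr (1 - \<kappa>) * u x powr (1 - (1 - \<kappa>)) = \<bar>f x\<bar>" if "0 < w x" for x
    proof -
      have "g x powr (1 - \<kappa>) = \<bar>f x\<bar> * w x powr (1 / P)" using \<kappa> by (simp add: g_def powr_powr)
      moreover have "u x powr \<kappa> = w x powr (- 1 / P)" using \<kappa> by (simp add: u_def powr_powr)
      ultimately show ?thesis using that by (simp add: mult.assoc flip: powr_add)
    qed
    then have "(\<integral>\<^sup>+x\<in>gridbox D a b. ennreal \<bar>f x\<bar> \<partial>lebesgue)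
      = (\<integral>\<^sup>+x\<in>gridbox D a b. ennreal (g x powr (1 - \<kappa>) * u x powr (1 - (1 - \<kappa>))) \<partial>lebesgue)"
      using wpos by (intro nn_integral_cong_AE) (auto elim!: eventually_mono)
    also have "\<dots> \<le> ennreal (box_int D a b g powr (1 - \<kappa>) * box_int D a b u powr (1 - (1 - \<kappa>)))"
      using \<kappa> by (intro box_int_Hoelder gi u D ab) auto
    finally show ?thesis by simp
  qed
  show gif: "grid_integrable (\<lambda>x. \<bar>f x\<bar>)"
    unfolding grid_integrable_def
  proof (intro conjI allI impI)
    fix D :: nat and a b :: "'n \<Rightarrow> int" assume "0 < D" "a \<le> b"
    then show "(\<integral>\<^sup>+x\<in>gridbox D a b. ennreal \<bar>f x\<bar> \<partial>lebesgue) < \<infinity>"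
      by (rule fgu[THEN le_less_trans]) simp
  qed auto
  show "box_int D a b (\<lambda>x. \<bar>f x\<bar>) \<le> box_int D a b g powr (1 - \<kappa>) * box_int D a b u powr \<kappa>"
    if D: "0 < D" and ab: "a \<le> b" for D a b
    using fgu[OF that] unfolding nn_integral_eq_box_int[OF gif that]
    by (subst (asm) ennreal_le_iff) auto
  fix D :: nat and a b :: "'n \<Rightarrow> int" assume D: "0 < D" and ab: "a \<le> b"
  define h where "h = 1 / real D ^ CARD('n)"
  have h: "0 < h" using D by (simp add: h_def)
  have one: "box_int D k k (\<lambda>x::real^'n. 1) = h" for k
    using emeasure_gridbox[OF D, of k k] nn_integral_indicator[OF sets_gridbox[OF D], of k k] by (simp add: box_int_def h_def)
  \<comment> \<open>Jensen's inequality on one cell, obtained from Hoelder against the constant 1: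
    replacing g by its cell average does not increase the integral of g^t.\<close>
  have cell: "h * (box_int D k k g / h) powr t \<le> box_int D k k (\<lambda>x. g x powr t)" for k
  proof -
    have g0: "0 \<le> g x" for x by (simp add: g_def)
    have "ennreal (box_int D k k g) = (\<integral>\<^sup>+x\<in>gridbox D k k. ennreal ((g x powr t) powr (1 / t) * 1 powr (1 - 1 / t)) \<partial>lebesgue)"
      unfolding nn_integral_eq_box_int[OF gi D order_refl, symmetric]
      using t g0 by (intro nn_integral_cong) (simp add: powr_powr)
    also have "\<dots> \<le> ennreal (box_int D k k (\<lambda>x. g x powr t) powr (1 / t) * box_int D k k (\<lambda>x::real^'n. 1) powr (1 - 1 / t))"
      using t by (intro box_int_Hoelder git gi1 D order_refl) auto
    finally have "box_int D k k g \<le> box_int D k k (\<lambda>x. g x powr t) powr (1 / t) * h powr (1 - 1 / t)"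
      unfolding one by (subst (asm) ennreal_le_iff) auto
    then have "box_int D k k g powr t \<le> (box_int D k k (\<lambda>x. g x powr t) powr (1 / t) * h powr (1 - 1 / t)) powr t"
      using t by (intro powr_mono2) (auto simp: box_int_nonneg)
    also have "\<dots> = box_int D k k (\<lambda>x. g x powr t) powr (1 / t * t) * h powr ((1 - 1 / t) * t)"
      by (subst powr_mult) (simp_all only: powr_powr powr_ge_zero)
    also have "(1 - 1 / t) * t = t - 1" using t by (simp add: field_simps)
    also have "box_int D k k (\<lambda>x. g x powr t) powr (1 / t * t) = box_int D k k (\<lambda>x. g x powr t)"
      using t by (simp add: box_int_nonneg)
    also have "h powr (t - 1) = h powr t / h" using h by (simp add: powr_diff)
    finally show ?thesis using h by (simp add: powr_divide box_int_nonneg field_simps)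
  qed
  have "h * (\<Sum>k\<in>{a..b}. (box_int D k k g / h) powr t) = (\<Sum>k\<in>{a..b}. h * (box_int D k k g / h) powr t)"
    by (simp add: sum_distrib_left)
  also have "\<dots> \<le> (\<Sum>k\<in>{a..b}. box_int D k k (\<lambda>x. g x powr t))" by (intro sum_mono cell)
  also have "\<dots> = box_int D a b (\<lambda>x. g x powr t)" by (rule box_int_sum[OF git D ab, symmetric])
  also have "\<dots> \<le> N"
  proof -
    have "ennreal (box_int D a b (\<lambda>x. g x powr t)) \<le> ennreal N"
      unfolding nn_integral_eq_box_int[OF git D ab, symmetric] N(1)[symmetric]
      unfolding gt
      by (intro nn_integral_mono) (auto simp: indicator_def)
    then show ?thesis using N(2) by simp
  qed
  finally show "1 / real D ^ CARD('n) * (\<Sum>k\<in>{a..b}. (box_int D k k g / (1 / real D ^ CARD('n))) powr (P * (1 - \<kappa>))) \<le> N"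
    unfolding h_def t_def .
qed

section \<open>Discretisation of the maximal operator\<close>

text \<open>With cells of side 1/D the indices from -D^2 to D^2 fill the cube from -D to D + 1/D, so
  one parameter refines the mesh and enlarges the window together.\<close>

definition grid_lo :: "nat \<Rightarrow> 'n \<Rightarrow> int" where "grid_lo D = (\<lambda>_. - (int D)\<^sup>2)"
definition grid_hi :: "nat \<Rightarrow> 'n \<Rightarrow> int" where "grid_hi D = (\<lambda>_. (int D)\<^sup>2)"

definition grid_val :: "nat \<Rightarrow> real \<Rightarrow> nat \<Rightarrow> (nat \<Rightarrow> real ^ 'n \<Rightarrow> real) \<Rightarrow> ('n \<Rightarrow> int) \<Rightarrow> ('n \<Rightarrow> int) \<Rightarrow> real" where
  "grid_val D \<beta> m f a b =
    (\<Prod>i = 1..m. box_int D a b (\<lambda>x. \<bar>f i x\<bar>) / (real (card {a..b}) / real D ^ CARD('n)) powr \<beta>)"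

text \<open>The inserted 0 keeps the \<open>Max\<close> well defined for k outside the window, where
  no box qualifies; a positive value is therefore attained by a box.\<close>

definition grid_max :: "nat \<Rightarrow> real \<Rightarrow> nat \<Rightarrow> (nat \<Rightarrow> real ^ 'n \<Rightarrow> real) \<Rightarrow> ('n \<Rightarrow> int) \<Rightarrow> real" where
  "grid_max D \<beta> m f k = Max (insert 0 ((\<lambda>(a, b). grid_val D \<beta> m f a b) `
    {(a, b). grid_lo D \<le> a \<and> a \<le> k \<and> k \<le> b \<and> b \<le> grid_hi D}))"

lemma grid_val_nonneg: "0 \<le> grid_val D \<beta> m f a b"
  unfolding grid_val_def by (intro prod_nonneg ballI divide_nonneg_nonneg box_int_nonneg) auto

lemma finite_grid_pairs:
  fixes lo hi :: "'n::finite \<Rightarrow> int"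
  shows "finite {(a, b). lo \<le> a \<and> a \<le> b \<and> b \<le> hi}"
  by (rule finite_subset[of _ "{lo..hi} \<times> {lo..hi}"]) (auto intro: order_trans)

lemma finite_grid_pairs_through:
  fixes lo hi k :: "'n::finite \<Rightarrow> int"
  shows "finite {(a, b). lo \<le> a \<and> a \<le> k \<and> k \<le> b \<and> b \<le> hi}"
  by (rule finite_subset[OF _ finite_grid_pairs[of lo hi]]) (auto intro: order_trans)

lemma grid_max_nonneg: "0 \<le> grid_max D \<beta> m f k"
  unfolding grid_max_def by (intro Max_ge) (auto intro: finite_grid_pairs_through)

lemma grid_val_le_grid_max:
  "\<lbrakk>grid_lo D \<le> a; a \<le> k; k \<le> b; b \<le> grid_hi D\<rbrakk> \<Longrightarrow> grid_val D \<beta> m f a b \<le> grid_max D \<beta> m f k"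
  unfolding grid_max_def by (intro Max_ge) (auto intro: finite_grid_pairs_through)

lemma grid_max_attained:
  assumes "0 < grid_max D \<beta> m f k"
  obtains a b where "grid_lo D \<le> a" "a \<le> k" "k \<le> b" "b \<le> grid_hi D" "grid_max D \<beta> m f k = grid_val D \<beta> m f a b"
proof -
  have "grid_max D \<beta> m f k \<in> insert 0 ((\<lambda>(a, b). grid_val D \<beta> m f a b) `
    {(a, b). grid_lo D \<le> a \<and> a \<le> k \<and> k \<le> b \<and> b \<le> grid_hi D})"
    unfolding grid_max_def by (intro Max_in) (auto intro: finite_grid_pairs_through)
  then show ?thesis using assms that by auto
qed

text \<open>\<open>discrete_two_weight_bound\<close> for cell averages of the g i, with \<theta> i =
  p/P i, t i = P i (1 - \<kappa> i) and L = K^p hc, where hc is the cell volume. The right side is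
  free of D, as the limit requires.\<close>

lemma grid_max_bound:
  fixes w f :: "nat \<Rightarrow> real ^ 'n \<Rightarrow> real" and v :: "real ^ 'n \<Rightarrow> real"
    and P \<kappa> N :: "nat \<Rightarrow> real" and m D :: nat and \<alpha> p q s A K :: real
  defines "n \<equiv> CARD('n)"
  defines "\<beta> \<equiv> 1 - \<alpha> / (real m * real n)"
  assumes P: "\<And>i. i \<in> {1..m} \<Longrightarrow> 1 < P i"
    and \<kappa>: "\<And>i. i \<in> {1..m} \<Longrightarrow> 0 < \<kappa> i \<and> \<kappa> i < 1 \<and> 1 < P i * (1 - \<kappa> i)"
    and p: "1 / p = (\<Sum>i = 1..m. 1 / P i)" "0 < p" "p \<le> q" and m: "0 < m"
    and wm: "\<And>i. i \<in> {1..m} \<Longrightarrow> w i \<in> borel_measurable lebesgue" and w0: "\<And>i x. i \<in> {1..m} \<Longrightarrow> 0 \<le> w i x"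
    and wpos: "\<And>i. i \<in> {1..m} \<Longrightarrow> AE x in lebesgue. 0 < w i x"
    and u: "\<And>i. i \<in> {1..m} \<Longrightarrow> grid_integrable (\<lambda>x. w i x powr (- 1 / (P i * \<kappa> i)))"
    and v: "grid_integrable v" "AE x in lebesgue. 0 < v x"
    and s: "1 < s" and A: "0 < A"
    and Aw: "\<And>a b. a \<le> b \<Longrightarrow>
      (\<Sum>k\<in>{a..b}. box_int D k k v) * (\<Sum>k\<in>{a..b}. box_int D k k v powr (- 1 / (s - 1))) powr (s - 1)
        \<le> A * real (card {a..b}) powr s"
    and K: "0 < K"
    and bump: "\<And>a b. a \<le> b \<Longrightarrow> (let h = real (card {a..b}) / real D ^ CARD('n) in
      h powr (\<alpha> / real n + 1 / q - 1 / p) * (box_int D a b v / h) powr (1 / q) *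
      (\<Prod>i = 1..m. (box_int D a b (\<lambda>x. w i x powr (- 1 / (P i * \<kappa> i))) / h) powr \<kappa> i) \<le> K)"
    and D: "0 < D"
    and f: "\<And>i. i \<in> {1..m} \<Longrightarrow> f i \<in> borel_measurable lebesgue"
    and N: "\<And>i. i \<in> {1..m} \<Longrightarrow> (\<integral>\<^sup>+x. ennreal (\<bar>f i x\<bar> powr P i * w i x) \<partial>lebesgue) = ennreal (N i) \<and> 0 \<le> N i"
  shows "(\<Sum>k\<in>{grid_lo D..grid_hi D}. grid_max D \<beta> m f k powr q * box_int D k k v) \<le>
    2 powr s * A_maximal_const s A ^ n *
      (2 * (\<Prod>i = 1..m. (A_maximal_const (P i * (1 - \<kappa> i)) 1 ^ n) powr (p / P i))) powr (q / p) *
      (K powr p * (\<Prod>i = 1..m. N i powr (p / P i))) powr (q / p)"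
proof -
  define g where "g i x = (\<bar>f i x\<bar> * w i x powr (1 / P i)) powr (1 / (1 - \<kappa> i))" for i x
  define U where "U i x = w i x powr (- 1 / (P i * \<kappa> i))" for i x
  define hc where "hc = 1 / real D ^ n"
  have hc: "0 < hc" using D by (simp add: hc_def)
  define t where "t i = P i * (1 - \<kappa> i)" for i
  define \<theta> where "\<theta> i = p / P i" for i
  have q: "0 < q" using p by simp
  have "sum \<theta> {1..m} = p * (\<Sum>i = 1..m. 1 / P i)" by (simp add: \<theta>_def sum_distrib_left)
  then have \<theta>1: "sum \<theta> {1..m} = 1" unfolding p(1)[symmetric] using p(2) by simp
  have gi: "grid_integrable (g i)" and fi: "grid_integrable (\<lambda>x. \<bar>f i x\<bar>)"
    and fg: "\<And>a b. a \<le> b \<Longrightarrow> box_int D a b (\<lambda>x. \<bar>f i x\<bar>) \<le> box_int D a b (g i) powr (1 - \<kappa> i) * box_int D a b (U i) powr \<kappa> i"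
    and gN: "\<And>a b. a \<le> b \<Longrightarrow> hc * (\<Sum>k\<in>{a..b}. (box_int D k k (g i) / hc) powr t i) \<le> N i"
    if i: "i \<in> {1..m}" for i
  proof -
    note H = weighted_Hoelder_grid[OF f[OF i] wm[OF i] w0[OF i] wpos[OF i] P[OF i], of "\<kappa> i" "N i"]
    show "grid_integrable (g i)" unfolding g_def by (rule H(1)) (use \<kappa>[OF i] u[OF i] N[OF i] in auto)
    show "grid_integrable (\<lambda>x. \<bar>f i x\<bar>)" by (rule H(2)) (use \<kappa>[OF i] u[OF i] N[OF i] in auto)
    show "box_int D a b (\<lambda>x. \<bar>f i x\<bar>) \<le> box_int D a b (g i) powr (1 - \<kappa> i) * box_int D a b (U i) powr \<kappa> i"
      if "a \<le> b" for a b unfolding g_def U_def by (rule H(3)) (use \<kappa>[OF i] u[OF i] N[OF i] D that in auto)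
    show "hc * (\<Sum>k\<in>{a..b}. (box_int D k k (g i) / hc) powr t i) \<le> N i"
      if "a \<le> b" for a b unfolding g_def hc_def t_def n_def
      by (rule H(4)) (use \<kappa>[OF i] u[OF i] N[OF i] D that in auto)
  qed
  define J where "J = {(a, b). grid_lo D \<le> a \<and> a \<le> b \<and> b \<le> (grid_hi D :: 'n \<Rightarrow> int)}"
  define c where "c j = grid_val D \<beta> m f (fst j) (snd j)" for j
  have lohi: "grid_lo D \<le> (grid_hi D :: 'n \<Rightarrow> int)" by (simp add: grid_lo_def grid_hi_def le_fun_def)
  have "(\<Sum>k\<in>{grid_lo D..grid_hi D}. grid_max D \<beta> m f k powr q * box_int D k k v) \<le>
    2 powr s * A_maximal_const s A ^ CARD('n) *
      (2 * (\<Prod>i\<in>{1..m}. (A_maximal_const (t i) 1 ^ CARD('n)) powr \<theta> i)) powr (q / p) *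
      (K powr p * hc * (\<Prod>i\<in>{1..m}. (\<Sum>k\<in>{grid_lo D..grid_hi D}. (box_int D k k (g i) / hc) powr t i) powr \<theta> i)) powr (q / p)"
  proof (rule discrete_two_weight_bound[where J = J and a = fst and b = snd and c = c])
    show "finite J" unfolding J_def by (rule finite_grid_pairs)
    show "0 < box_int D k k v" for k by (rule box_int_pos[OF v(1) D order_refl v(2)])
    show "sum \<theta> {1..m} = 1" by (rule \<theta>1)
    fix k :: "'n \<Rightarrow> int" assume "0 < grid_max D \<beta> m f k"
    then obtain a b where ab: "grid_lo D \<le> a" "a \<le> k" "k \<le> b" "b \<le> grid_hi D" "grid_max D \<beta> m f k = grid_val D \<beta> m f a b"
      by (rule grid_max_attained)
    then show "\<exists>j\<in>J. k \<in> {fst j..snd j} \<and> grid_max D \<beta> m f k \<le> c j"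
      by (intro bexI[of _ "(a, b)"]) (auto simp: c_def J_def intro: order_trans)
  next
    fix j assume j: "j \<in> J"
    define a where "a = fst j"
    define b where "b = snd j"
    have ab: "a \<le> b" using j by (auto simp: J_def a_def b_def)
    define h where "h = real (card {a..b}) / real D ^ CARD('n)"
    have h: "0 < h" unfolding h_def by (rule gridbox_measure_pos[OF D ab])
    have hN: "h = real (card {a..b}) * hc" by (simp add: h_def hc_def n_def)
    define G' where "G' i = (box_int D a b (g i) / h) powr (1 - \<kappa> i)" for i
    define U' where "U' i = (box_int D a b (U i) / h) powr \<kappa> i" for i
    define V where "V = box_int D a b v"
    have V: "0 < V" unfolding V_def by (rule box_int_pos[OF v(1) D ab v(2)])
    have "c j \<le> (\<Prod>i = 1..m. h powr (1 - \<beta>) * (G' i * U' i))"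
      unfolding c_def grid_val_def a_def[symmetric] b_def[symmetric] h_def[symmetric]
    proof (rule prod_mono)
      fix i assume i: "i \<in> {1..m}"
      have "h powr (1 - \<kappa> i) * h powr \<kappa> i = h" using h by (simp flip: powr_add)
      then have "box_int D a b (g i) powr (1 - \<kappa> i) * box_int D a b (U i) powr \<kappa> i = h * (G' i * U' i)"
        using h by (simp add: G'_def U'_def powr_divide box_int_nonneg field_simps)
      then have "box_int D a b (\<lambda>x. \<bar>f i x\<bar>) / h powr \<beta> \<le> h * (G' i * U' i) / h powr \<beta>"
        using fg[OF i ab] by (simp add: divide_right_mono)
      also have "\<dots> = h powr (1 - \<beta>) * (G' i * U' i)" using h by (simp add: powr_diff)
      finally show "0 \<le> box_int D a b (\<lambda>x. \<bar>f i x\<bar>) / h powr \<beta> \<and>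
        box_int D a b (\<lambda>x. \<bar>f i x\<bar>) / h powr \<beta> \<le> h powr (1 - \<beta>) * (G' i * U' i)"
        by (simp add: box_int_nonneg)
    qed
    also have "\<dots> = (h powr (1 - \<beta>)) ^ m * ((\<Prod>i = 1..m. G' i) * (\<Prod>i = 1..m. U' i))"
      by (simp add: prod.distrib)
    \<comment> \<open>The m factors each lack \<alpha>/(mn) of a full power of the volume, together
      \<alpha>/n.\<close>
    also have "(h powr (1 - \<beta>)) ^ m = h powr (\<alpha> / real n)"
    proof -
      have "(1 - \<beta>) * real m = \<alpha> / real n" using m by (simp add: \<beta>_def)
      then show ?thesis using h by (simp add: powr_powr flip: powr_realpow)
    qed
    finally have c: "c j \<le> h powr (\<alpha> / real n) * ((\<Prod>i = 1..m. G' i) * (\<Prod>i = 1..m. U' i))" .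
    have G0: "0 \<le> (\<Prod>i = 1..m. G' i)" by (simp add: G'_def prod_nonneg)
    have c0: "0 \<le> c j" by (simp add: c_def grid_val_nonneg)
    have "c j * V powr (1 / q) \<le> h powr (\<alpha> / real n) * ((\<Prod>i = 1..m. G' i) * (\<Prod>i = 1..m. U' i)) * V powr (1 / q)"
      by (intro mult_right_mono c) auto
    also have "\<dots>
      = (h powr (\<alpha> / real n) * h powr (1 / q)) * (V / h) powr (1 / q) * (\<Prod>i = 1..m. U' i) * (\<Prod>i = 1..m. G' i)"
      using V h by (simp add: powr_divide)
    \<comment> \<open>Splitting off h^(1/p) leaves exactly the expression of the bump condition;
      raised to the power p it becomes the volume h, which is what the sets E_R can absorb.\<close>
    also have "h powr (\<alpha> / real n) * h powr (1 / q) = h powr (1 / p) * h powr (\<alpha> / real n + 1 / q - 1 / p)"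
      by (simp flip: powr_add)
    also have "h powr (1 / p) * h powr (\<alpha> / real n + 1 / q - 1 / p) * (V / h) powr (1 / q) * (\<Prod>i = 1..m. U' i) * (\<Prod>i = 1..m. G' i)
      = (h powr (1 / p) * (\<Prod>i = 1..m. G' i)) * (h powr (\<alpha> / real n + 1 / q - 1 / p) * (V / h) powr (1 / q) * (\<Prod>i = 1..m. U' i))"
      by (simp only: mult_ac)
    also have "\<dots> \<le> (h powr (1 / p) * (\<Prod>i = 1..m. G' i)) * K"
      using bump[OF ab] G0 by (intro mult_left_mono) (simp_all add: Let_def h_def V_def U'_def U_def[abs_def])
    finally have cV: "c j * V powr (1 / q) \<le> (h powr (1 / p) * (\<Prod>i = 1..m. G' i)) * K" .
    have "c j powr q * V = (c j * V powr (1 / q)) powr q"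
      using c0 V q by (simp add: powr_mult powr_powr)
    also have "\<dots> \<le> ((h powr (1 / p) * (\<Prod>i = 1..m. G' i)) * K) powr q"
      using cV c0 q by (intro powr_mono2) auto
    also have "\<dots> = (((h powr (1 / p) * (\<Prod>i = 1..m. G' i)) * K) powr p) powr (q / p)"
      using p(2) by (simp add: powr_powr)
    also have "((h powr (1 / p) * (\<Prod>i = 1..m. G' i)) * K) powr p = h * (\<Prod>i = 1..m. G' i powr p) * K powr p"
      using h G0 K p(2) by (simp add: powr_mult powr_powr prod_powr_distrib G'_def)
    also have "\<dots> = K powr p * hc * (real (card {a..b}) * (\<Prod>i = 1..m. G' i powr p))"
      by (simp add: hN)
    also have "(\<Prod>i = 1..m. G' i powr p)
      = (\<Prod>i\<in>{1..m}. ((\<Sum>k\<in>{a..b}. box_int D k k (g i) / hc) / real (card {a..b})) powr (\<theta> i * t i))"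
    proof (intro prod.cong refl)
      fix i assume i: "i \<in> {1..m}"
      have "(\<Sum>k\<in>{a..b}. box_int D k k (g i) / hc) / real (card {a..b}) = box_int D a b (g i) / h"
        unfolding box_int_sum[OF gi[OF i] D ab] hN by (simp add: sum_divide_distrib mult.commute)
      moreover have "\<theta> i * t i = (1 - \<kappa> i) * p" using P[OF i] by (simp add: \<theta>_def t_def)
      ultimately show "G' i powr p = ((\<Sum>k\<in>{a..b}. box_int D k k (g i) / hc) / real (card {a..b})) powr (\<theta> i * t i)"
        by (simp add: G'_def powr_powr)
    qed
    finally show "c j powr q * (\<Sum>k\<in>{fst j..snd j}. box_int D k k v)
      \<le> (K powr p * hc * (real (card {fst j..snd j}) * (\<Prod>i\<in>{1..m}. ((\<Sum>k\<in>{fst j..snd j}. box_int D k k (g i) / hc) / real (card {fst j..snd j})) powr (\<theta> i * t i)))) powr (q / p)"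
      by (simp only: V_def box_int_sum[OF v(1) D ab]) (simp only: a_def b_def)
  next
    fix i assume i: "i \<in> {1..m}"
    show "0 < \<theta> i" using P[OF i] p(2) by (simp add: \<theta>_def)
  next
    show "\<And>j. j \<in> J \<Longrightarrow> grid_lo D \<le> fst j \<and> fst j \<le> snd j \<and> snd j \<le> grid_hi D" by (auto simp: J_def)
  qed (use s A Aw p P \<kappa> hc in \<open>auto simp: c_def grid_val_nonneg grid_max_nonneg \<theta>_def t_def box_int_nonneg divide_nonneg_pos intro!: divide_pos_pos elim: less_trans[OF zero_less_one]\<close>)
  also have "\<dots> \<le> 2 powr s * A_maximal_const s A ^ CARD('n) *
      (2 * (\<Prod>i\<in>{1..m}. (A_maximal_const (t i) 1 ^ CARD('n)) powr \<theta> i)) powr (q / p) *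
      (K powr p * (\<Prod>i = 1..m. N i powr (p / P i))) powr (q / p)"
  proof (intro mult_left_mono powr_mono2 mult_nonneg_nonneg)
    \<comment> \<open>As the \<theta> i sum to 1, hc is the product of its powers hc^(\<theta> i).
      Moved inside, it turns each sum of cell averages into an integral bounded by N i.\<close>
    have "hc * (\<Prod>i\<in>{1..m}. (\<Sum>k\<in>{grid_lo D..grid_hi D}. (box_int D k k (g i) / hc) powr t i) powr \<theta> i)
      = (\<Prod>i\<in>{1..m}. hc powr \<theta> i) * (\<Prod>i\<in>{1..m}. (\<Sum>k\<in>{grid_lo D..grid_hi D}. (box_int D k k (g i) / hc) powr t i) powr \<theta> i)"
      using hc \<theta>1 by (simp add: powr_sum[symmetric])
    also have "\<dots> = (\<Prod>i = 1..m. (hc * (\<Sum>k\<in>{grid_lo D..grid_hi D}. (box_int D k k (g i) / hc) powr t i)) powr \<theta> i)"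
      using hc by (simp add: prod.distrib[symmetric] powr_mult sum_nonneg)
    also have "\<dots> \<le> (\<Prod>i = 1..m. N i powr (p / P i))"
      unfolding \<theta>_def
    proof (intro prod_mono conjI powr_mono2 gN lohi)
      fix i assume "i \<in> {1..m}"
      then show "0 \<le> p / P i" using P[of i] p by simp
    qed (use hc in \<open>auto intro!: mult_nonneg_nonneg sum_nonneg\<close>)
    finally show "K powr p * hc * (\<Prod>i\<in>{1..m}. (\<Sum>k\<in>{grid_lo D..grid_hi D}. (box_int D k k (g i) / hc) powr t i) powr \<theta> i)
      \<le> K powr p * (\<Prod>i = 1..m. N i powr (p / P i))"
      by (simp add: mult.assoc mult_left_mono)
  qed (use hc p q in \<open>auto intro!: prod_nonneg simp: A_maximal_const_nonneg\<close>)
  finally show ?thesis unfolding t_def \<theta>_def n_def .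
qed

section \<open>Passage from the grids to the maximal operator on R^n\<close>

text \<open>Absorbs the error of enlarging a rectangle to a grid box, a factor tending to 1.
  Multiplying by the inverse factor works also for infinite z.\<close>

lemma le_liminf_scaled:
  fixes \<Phi> :: "nat \<Rightarrow> ennreal" and \<rho> :: "nat \<Rightarrow> real"
  assumes \<rho>: "\<rho> \<longlonglongrightarrow> 1" "\<And>n. 0 < \<rho> n" and le: "\<forall>\<^sub>F n in sequentially. z \<le> ennreal (\<rho> n) * \<Phi> n"
  shows "z \<le> liminf \<Phi>"
proof -
  have "(\<lambda>n. inverse (\<rho> n)) \<longlonglongrightarrow> inverse 1" by (intro tendsto_inverse \<rho>) auto
  then have "(\<lambda>n. ennreal (inverse (\<rho> n))) \<longlonglongrightarrow> ennreal 1" by (intro tendsto_ennrealI) simp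
  then have "(\<lambda>n. z * ennreal (inverse (\<rho> n))) \<longlonglongrightarrow> z * ennreal 1"
    by (intro tendsto_mult_ennreal tendsto_const) auto
  then have "liminf (\<lambda>n. z * ennreal (inverse (\<rho> n))) = z"
    by (intro lim_imp_Liminf) auto
  moreover have "liminf (\<lambda>n. z * ennreal (inverse (\<rho> n))) \<le> liminf \<Phi>"
  proof (rule Liminf_mono)
    show "\<forall>\<^sub>F n in sequentially. z * ennreal (inverse (\<rho> n)) \<le> \<Phi> n"
      using le
    proof eventually_elim
      case (elim n)
      have "z * ennreal (inverse (\<rho> n)) \<le> ennreal (\<rho> n) * \<Phi> n * ennreal (inverse (\<rho> n))"
        by (intro mult_right_mono elim) auto
      also have "\<dots> = (ennreal (\<rho> n) * ennreal (inverse (\<rho> n))) * \<Phi> n" by (simp only: mult_ac)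
      also have "ennreal (\<rho> n) * ennreal (inverse (\<rho> n)) = 1"
        using \<rho>(2)[of n] by (simp flip: ennreal_mult)
      finally show ?case by simp
    qed
  qed
  ultimately show ?thesis by simp
qed

lemma epowr_le_ennreal:
  assumes "x \<le> ennreal y" "0 \<le> y" "0 < q"
  shows "x epowr q \<le> ennreal (y powr q)"
proof -
  obtain z where z: "x = ennreal z" "0 \<le> z" "z \<le> y"
    using assms(1,2) by (cases x) (auto simp: top_unique)
  then show ?thesis using assms by (simp add: epowr_ennreal powr_mono2 ennreal_leI)
qed

lemma SUP_epowr_le:
  fixes F :: "'a \<Rightarrow> ennreal"
  assumes q: "0 < q" and le: "\<And>x. x \<in> X \<Longrightarrow> F x epowr q \<le> z"
  shows "(SUP x\<in>X. F x) epowr q \<le> z"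
proof (cases z)
  case (real y)
  have "F x \<le> ennreal (y powr (1 / q))" if x: "x \<in> X" for x
  proof (cases "F x")
    case (real a)
    then have "a powr q \<le> y" using le[OF x] \<open>z = ennreal y\<close> \<open>0 \<le> y\<close> q by (simp add: epowr_ennreal)
    then have "(a powr q) powr (1 / q) \<le> y powr (1 / q)" using q by (intro powr_mono2) auto
    then show ?thesis using real q by (simp add: powr_powr ennreal_leI)
  next
    case top
    then show ?thesis using le[OF x] real q by (simp add: epowr_def top_unique)
  qed
  then have "(SUP x\<in>X. F x) \<le> ennreal (y powr (1 / q))" by (rule SUP_least)
  then have "(SUP x\<in>X. F x) epowr q \<le> ennreal ((y powr (1 / q)) powr q)"
    using q by (intro epowr_le_ennreal) auto
  then show ?thesis using real q by (simp add: powr_powr)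
qed simp

text \<open>A step function, zero outside the window, that already contains the power q. Fatou's
  lemma is applied to these finite, measurable sums; the maximal function enters only through
  monotonicity of the integral.\<close>

definition grid_max_fun :: "real \<Rightarrow> nat \<Rightarrow> (nat \<Rightarrow> real ^ 'n \<Rightarrow> real) \<Rightarrow> real \<Rightarrow> nat \<Rightarrow> real ^ 'n \<Rightarrow> ennreal" where
  "grid_max_fun \<beta> m f q D x =
    (\<Sum>k\<in>{grid_lo D..grid_hi D}. ennreal (grid_max D \<beta> m f k powr q) * indicator (gridbox D k k) x)"

lemma grid_max_fun_eq:
  assumes "grid D x \<in> {grid_lo D..grid_hi D}"
  shows "grid_max_fun \<beta> m f q D x = ennreal (grid_max D \<beta> m f (grid D x) powr q)"
proof -
  have "grid_max_fun \<beta> m f q D x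
    = (\<Sum>k\<in>{grid D x}. ennreal (grid_max D \<beta> m f k powr q) * indicator (gridbox D k k) x)"
    unfolding grid_max_fun_def
    using assms by (intro sum.mono_neutral_right) (auto simp: gridbox_def indicator_def)
  then show ?thesis by (simp add: gridbox_def)
qed

lemma borel_measurable_grid_max_fun:
  "0 < D \<Longrightarrow> grid_max_fun \<beta> m f q D \<in> borel_measurable lebesgue"
  unfolding grid_max_fun_def
  by (intro borel_measurable_sum borel_measurable_times_ennreal borel_measurable_indicator sets_gridbox) auto

lemma nn_integral_grid_max_fun:
  assumes v: "grid_integrable v" and D: "0 < D"
  shows "(\<integral>\<^sup>+x. grid_max_fun \<beta> m f q D x * ennreal (v x) \<partial>lebesgue)
    = ennreal (\<Sum>k\<in>{grid_lo D..grid_hi D}. grid_max D \<beta> m f k powr q * box_int D k k v)"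
proof -
  have vm: "(\<lambda>x. ennreal (v x)) \<in> borel_measurable lebesgue" using v by (auto simp: grid_integrable_def)
  have "(\<integral>\<^sup>+x. grid_max_fun \<beta> m f q D x * ennreal (v x) \<partial>lebesgue)
    = (\<integral>\<^sup>+x. (\<Sum>k\<in>{grid_lo D..grid_hi D}. ennreal (grid_max D \<beta> m f k powr q) * (ennreal (v x) * indicator (gridbox D k k) x)) \<partial>lebesgue)"
    unfolding grid_max_fun_def sum_distrib_right by (intro nn_integral_cong sum.cong refl) (simp only: mult_ac)
  also have "\<dots> = (\<Sum>k\<in>{grid_lo D..grid_hi D}. ennreal (grid_max D \<beta> m f k powr q) * (\<integral>\<^sup>+x\<in>gridbox D k k. ennreal (v x) \<partial>lebesgue))"
  proof -
    have meas: "(\<lambda>x. ennreal (v x) * indicator (gridbox D k k) x) \<in> borel_measurable lebesgue" for k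
      by (intro borel_measurable_times_ennreal vm borel_measurable_indicator sets_gridbox D)
    have "(\<lambda>x. ennreal (grid_max D \<beta> m f k powr q) * (ennreal (v x) * indicator (gridbox D k k) x))
        \<in> borel_measurable lebesgue" for k
      by (rule borel_measurable_times_ennreal[OF borel_measurable_const meas])
    then show ?thesis
      by (simp only: nn_integral_sum nn_integral_cmult[OF meas])
  qed
  also have "\<dots> = (\<Sum>k\<in>{grid_lo D..grid_hi D}. ennreal (grid_max D \<beta> m f k powr q * box_int D k k v))"
    by (intro sum.cong refl) (simp add: nn_integral_eq_box_int[OF v D order_refl] ennreal_mult box_int_nonneg)
  also have "\<dots> = ennreal (\<Sum>k\<in>{grid_lo D..grid_hi D}. grid_max D \<beta> m f k powr q * box_int D k k v)"
    by (intro sum_ennreal mult_nonneg_nonneg box_int_nonneg) auto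
  finally show ?thesis .
qed

text \<open>A rectangle containing x lies in the box of all cells between those of its corners,
  whose sides are longer by at most 2/D. The integrals grow, and the change of volume costs a factor
  tending to 1; this uses \<beta> > 0. Passing to the supremum afterwards is possible because the
  liminf does not depend on the rectangle.\<close>

lemma frac_strong_max_epowr_le_liminf:
  fixes f :: "nat \<Rightarrow> real ^ 'n \<Rightarrow> real" and m :: nat and \<alpha> q :: real
  defines "\<beta> \<equiv> 1 - \<alpha> / (real m * real CARD('n))"
  assumes f: "\<And>i. i \<in> {1..m} \<Longrightarrow> grid_integrable (\<lambda>x. \<bar>f i x\<bar>)" and q: "0 < q" and \<beta>: "0 < \<beta>"
  shows "frac_strong_max \<alpha> m f x epowr q \<le> liminf (\<lambda>N. grid_max_fun \<beta> m f q (Suc N) x)"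
  unfolding frac_strong_max_def \<beta>_def[symmetric]
proof (rule SUP_epowr_le[OF q])
  fix R :: "(real ^ 'n) set" assume "R \<in> {R \<in> rectangles. x \<in> R}"
  then obtain l u where R: "R = cbox l u" and lu: "\<forall>i. l $ i < u $ i" and xR: "x \<in> cbox l u"
    by (auto simp: rectangles_def)
  define H where "H = (\<Prod>i\<in>UNIV. u $ i - l $ i)"
  have H: "0 < H" "emeasure lebesgue R = ennreal H"
    unfolding H_def R using emeasure_rectangle[OF lu] by auto
  \<comment> \<open>The volume ratio for sides enlarged by 2/D with D = Suc N, in the powers with
    which volume enters: \<beta> for each of m factors, then q.\<close>
  define \<rho> where "\<rho> N = ((((\<Prod>i\<in>UNIV. u $ i - l $ i + 2 / real (Suc N)) / H) powr \<beta>) ^ m) powr q" for N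
  have "(\<lambda>N. \<Prod>i\<in>UNIV. u $ i - l $ i + 2 / real (Suc N)) \<longlonglongrightarrow> (\<Prod>i\<in>UNIV. u $ i - l $ i + 0)"
    by (intro tendsto_prod tendsto_add tendsto_const LIMSEQ_Suc[OF lim_const_over_n])
  then have "\<rho> \<longlonglongrightarrow> (((H / H) powr \<beta>) ^ m) powr q"
    unfolding \<rho>_def H_def[symmetric] add_0_right
    using H(1) by (intro tendsto_powr tendsto_power tendsto_divide tendsto_const) auto
  then have \<rho>1: "\<rho> \<longlonglongrightarrow> 1" using H(1) by simp
  have prodpos: "0 < (\<Prod>i\<in>UNIV. u $ i - l $ i + 2 / real (Suc N))" for N
    using lu by (intro prod_pos ballI add_pos_pos) auto
  have \<rho>0: "0 < \<rho> N" for N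
  proof -
    have "0 < ((y powr \<beta>) ^ m) powr q" if "0 < y" for y :: real using that by simp
    then show ?thesis unfolding \<rho>_def using divide_pos_pos[OF prodpos[of N] H(1)] by blast
  qed
  obtain M where M: "norm l \<le> real M" "norm u \<le> real M"
  proof -
    obtain M where "max (norm l) (norm u) \<le> real M" using real_arch_simple by blast
    then show thesis by (intro that) auto
  qed
  show "(\<Prod>i = 1..m. (\<integral>\<^sup>+y\<in>R. ennreal \<bar>f i y\<bar> \<partial>lebesgue) / emeasure lebesgue R epowr \<beta>) epowr q
     \<le> liminf (\<lambda>N. grid_max_fun \<beta> m f q (Suc N) x)"
  proof (rule le_liminf_scaled[OF \<rho>1 \<rho>0])
    show "\<forall>\<^sub>F N in sequentially. (\<Prod>i = 1..m. (\<integral>\<^sup>+y\<in>R. ennreal \<bar>f i y\<bar> \<partial>lebesgue) / emeasure lebesgue R epowr \<beta>) epowr q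
      \<le> ennreal (\<rho> N) * grid_max_fun \<beta> m f q (Suc N) x"
      \<comment> \<open>Once N \<ge> M the corners of R have coordinates of size at most D, so the
        enclosing box fits into the window.\<close>
      using eventually_ge_at_top[of M]
    proof eventually_elim
      case (elim N)
      define D where "D = Suc N"
      have D: "0 < D" "real M \<le> real D" using elim by (auto simp: D_def)
      define a where "a = grid D l"
      define b where "b = grid D u"
      have mono: "grid D y \<le> grid D z" if "\<forall>i. y $ i \<le> z $ i" for y z
        unfolding grid_def le_fun_def using that D by (auto intro!: floor_mono mult_left_mono)
      have between: "a \<le> grid D y" "grid D y \<le> b" if "y \<in> cbox l u" for y
        unfolding a_def b_def using that by (auto simp: mem_box_cart intro!: mono)
      have ab: "a \<le> b" unfolding a_def b_def using lu by (intro mono) (auto intro: less_imp_le)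
      have lo: "grid_lo D \<le> a"
        unfolding grid_lo_def a_def grid_def le_fun_def
      proof
        fix i
        have "- real D \<le> l $ i" using component_le_norm_cart[of l i] M D by linarith
        then have "real D * (- real D) \<le> real D * l $ i" by (intro mult_left_mono) auto
        then show "- (int D)\<^sup>2 \<le> \<lfloor>real D * l $ i\<rfloor>" by (simp add: le_floor_iff power2_eq_square)
      qed
      have hi: "b \<le> grid_hi D"
        unfolding grid_hi_def b_def grid_def le_fun_def
      proof
        fix i
        have "u $ i \<le> real D" using component_le_norm_cart[of u i] M D by linarith
        then have "real D * u $ i \<le> real D * real D" by (intro mult_left_mono) auto
        then show "\<lfloor>real D * u $ i\<rfloor> \<le> (int D)\<^sup>2" by (simp add: floor_le_iff power2_eq_square)
      qed
      have sub: "R \<subseteq> gridbox D a b" unfolding R gridbox_def using between by auto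
      define h where "h = real (card {a..b}) / real D ^ CARD('n)"
      have h: "0 < h" unfolding h_def by (rule gridbox_measure_pos[OF D(1) ab])
      define L where "L = (\<Prod>i\<in>UNIV. u $ i - l $ i + 2 / real D)"
      have hL: "h \<le> L"
      proof -
        have "h = (\<Prod>i\<in>(UNIV::'n set). real_of_int (b i + 1 - a i) / real D)"
          unfolding h_def card_fun_atLeastAtMost_real[OF ab] by (simp add: prod_dividef)
        also have "\<dots> \<le> L"
          unfolding L_def
        proof (rule prod_mono)
          fix i
          \<comment> \<open>Rounding down at l and completing the cell of u each add at most one
            cell, hence the 2 below.\<close>
          have "real_of_int (b i) \<le> real D * u $ i" "real D * l $ i - 1 \<le> real_of_int (a i)"
            unfolding a_def b_def grid_def by linarith+
          then have "real_of_int (b i + 1 - a i) \<le> real D * (u $ i - l $ i) + 2"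
            by (simp add: algebra_simps)
          then have "real_of_int (b i + 1 - a i) / real D \<le> (real D * (u $ i - l $ i) + 2) / real D"
            by (intro divide_right_mono) auto
          also have "\<dots> = u $ i - l $ i + 2 / real D" using D by (simp add: add_divide_distrib)
          finally show "0 \<le> real_of_int (b i + 1 - a i) / real D \<and> real_of_int (b i + 1 - a i) / real D \<le> u $ i - l $ i + 2 / real D"
            using le_funD[OF ab, of i] by simp
        qed
        finally show ?thesis .
      qed
      have "(\<Prod>i = 1..m. (\<integral>\<^sup>+y\<in>R. ennreal \<bar>f i y\<bar> \<partial>lebesgue) / emeasure lebesgue R epowr \<beta>)
        \<le> (\<Prod>i = 1..m. ennreal (box_int D a b (\<lambda>x. \<bar>f i x\<bar>) / H powr \<beta>))"
      proof (intro prod_mono_ennreal)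
        fix i assume i: "i \<in> {1..m}"
        have "(\<integral>\<^sup>+y\<in>R. ennreal \<bar>f i y\<bar> \<partial>lebesgue) \<le> (\<integral>\<^sup>+y\<in>gridbox D a b. ennreal \<bar>f i y\<bar> \<partial>lebesgue)"
          using sub by (intro nn_integral_mono) (auto simp: indicator_def)
        also have "\<dots> = ennreal (box_int D a b (\<lambda>x. \<bar>f i x\<bar>))"
          by (rule nn_integral_eq_box_int[OF f[OF i] D(1) ab])
        finally have "(\<integral>\<^sup>+y\<in>R. ennreal \<bar>f i y\<bar> \<partial>lebesgue) / emeasure lebesgue R epowr \<beta>
          \<le> ennreal (box_int D a b (\<lambda>x. \<bar>f i x\<bar>)) / emeasure lebesgue R epowr \<beta>"
          by (rule divide_right_mono_ennreal)
        also have "\<dots> = ennreal (box_int D a b (\<lambda>x. \<bar>f i x\<bar>) / H powr \<beta>)"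
          unfolding H(2) using H(1) by (simp add: epowr_ennreal divide_ennreal box_int_nonneg)
        finally show "(\<integral>\<^sup>+y\<in>R. ennreal \<bar>f i y\<bar> \<partial>lebesgue) / emeasure lebesgue R epowr \<beta>
          \<le> ennreal (box_int D a b (\<lambda>x. \<bar>f i x\<bar>) / H powr \<beta>)" .
      qed
      also have "\<dots> = ennreal (\<Prod>i = 1..m. box_int D a b (\<lambda>x. \<bar>f i x\<bar>) / H powr \<beta>)"
        by (intro prod_ennreal) (auto simp: box_int_nonneg)
      also have "(\<Prod>i = 1..m. box_int D a b (\<lambda>x. \<bar>f i x\<bar>) / H powr \<beta>)
        = (\<Prod>i = 1..m. (h / H) powr \<beta> * (box_int D a b (\<lambda>x. \<bar>f i x\<bar>) / h powr \<beta>))"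
        using h H(1) by (intro prod.cong refl) (simp add: powr_divide)
      also have "\<dots> = ((h / H) powr \<beta>) ^ m * grid_val D \<beta> m f a b"
        unfolding grid_val_def h_def[symmetric] prod.distrib by simp
      finally have "(\<Prod>i = 1..m. (\<integral>\<^sup>+y\<in>R. ennreal \<bar>f i y\<bar> \<partial>lebesgue) / emeasure lebesgue R epowr \<beta>)
        \<le> ennreal (((h / H) powr \<beta>) ^ m * grid_val D \<beta> m f a b)" .
      also have "\<dots> \<le> ennreal (((L / H) powr \<beta>) ^ m * grid_max D \<beta> m f (grid D x))"
      proof (intro ennreal_leI mult_mono)
        show "((h / H) powr \<beta>) ^ m \<le> ((L / H) powr \<beta>) ^ m"
          using h H(1) hL \<beta> by (intro power_mono powr_mono2 divide_right_mono) auto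
        show "grid_val D \<beta> m f a b \<le> grid_max D \<beta> m f (grid D x)"
          by (rule grid_val_le_grid_max[OF lo between(1)[OF xR] between(2)[OF xR] hi])
      qed (auto simp: grid_val_nonneg)
      finally have "(\<Prod>i = 1..m. (\<integral>\<^sup>+y\<in>R. ennreal \<bar>f i y\<bar> \<partial>lebesgue) / emeasure lebesgue R epowr \<beta>) epowr q
        \<le> ennreal ((((L / H) powr \<beta>) ^ m * grid_max D \<beta> m f (grid D x)) powr q)"
        using q by (intro epowr_le_ennreal) (auto simp: grid_max_nonneg)
      also have "(((L / H) powr \<beta>) ^ m * grid_max D \<beta> m f (grid D x)) powr q = \<rho> N * grid_max D \<beta> m f (grid D x) powr q"
        by (subst powr_mult) (auto simp: grid_max_nonneg \<rho>_def L_def D_def)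
      also have "ennreal (\<rho> N * grid_max D \<beta> m f (grid D x) powr q) = ennreal (\<rho> N) * grid_max_fun \<beta> m f q D x"
      proof -
        have "grid D x \<in> {grid_lo D..grid_hi D}"
          using order_trans[OF lo between(1)[OF xR]] order_trans[OF between(2)[OF xR] hi] by simp
        then show ?thesis using less_imp_le[OF \<rho>0[of N]] by (simp add: grid_max_fun_eq ennreal_mult)
      qed
      finally show ?case by (simp only: D_def)
    qed
  qed
qed

section \<open>The two-weight inequality\<close>

text \<open>Needed when some norm on the right is 0: the product is then 0 even if another norm is
  infinite, so the left side has to vanish as well.\<close>

lemma frac_strong_max_eq_0:
  fixes f :: "nat \<Rightarrow> real ^ 'n \<Rightarrow> real"
  assumes i: "i \<in> {1..m}" and 0: "AE x in lebesgue. f i x = 0"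
  shows "frac_strong_max \<alpha> m f x = 0"
proof -
  have prod0: "(\<Prod>i = 1..m. (\<integral>\<^sup>+y\<in>R. ennreal \<bar>f i y\<bar> \<partial>lebesgue) / e) = 0" for R :: "(real ^ 'n) set" and e
  proof (rule prod_zero)
    have "(\<integral>\<^sup>+y\<in>R. ennreal \<bar>f i y\<bar> \<partial>lebesgue) = (\<integral>\<^sup>+y. 0 \<partial>(lebesgue :: (real ^ 'n) measure))"
      by (intro nn_integral_cong_AE) (use 0 in eventually_elim, simp)
    then show "\<exists>i\<in>{1..m}. (\<integral>\<^sup>+y\<in>R. ennreal \<bar>f i y\<bar> \<partial>lebesgue) / e = 0"
      using i by (intro bexI[of _ i]) auto
  qed simp
  have "frac_strong_max \<alpha> m f x \<le> 0"
    unfolding frac_strong_max_def by (intro SUP_least) (simp only: prod0 order_refl)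
  then show ?thesis by simp
qed

text \<open>Fatou's lemma with respect to the measure v dx; putting v into a density keeps it out of
  the liminf.\<close>

lemma frac_strong_max_grid_bound:
  fixes w f :: "nat \<Rightarrow> real ^ 'n \<Rightarrow> real" and v :: "real ^ 'n \<Rightarrow> real"
  assumes v: "grid_integrable v" and q: "0 < q" and \<beta>: "0 < 1 - \<alpha> / (real m * real CARD('n))"
    and f: "\<And>i. i \<in> {1..m} \<Longrightarrow> grid_integrable (\<lambda>x. \<bar>f i x\<bar>)"
    and bound: "\<And>D. 0 < D \<Longrightarrow> (\<Sum>k\<in>{grid_lo D..grid_hi D}.
      grid_max D (1 - \<alpha> / (real m * real CARD('n))) m f k powr q * box_int D k k v) \<le> B"
  shows "(\<integral>\<^sup>+x. frac_strong_max \<alpha> m f x epowr q * ennreal (v x) \<partial>lebesgue) \<le> ennreal B"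
proof -
  define \<beta> where "\<beta> = 1 - \<alpha> / (real m * real CARD('n))"
  let ?\<Psi> = "\<lambda>N. grid_max_fun \<beta> m f q (Suc N)"
  have vm [measurable]: "v \<in> borel_measurable lebesgue" using v by (simp add: grid_integrable_def)
  have \<Psi>m [measurable]: "?\<Psi> N \<in> borel_measurable lebesgue" for N
    by (rule borel_measurable_grid_max_fun) simp
  let ?\<nu> = "density lebesgue (\<lambda>x. ennreal (v x))"
  have le: "frac_strong_max \<alpha> m f x epowr q \<le> liminf (\<lambda>N. ?\<Psi> N x)" for x
    unfolding \<beta>_def by (rule frac_strong_max_epowr_le_liminf[OF _ q \<beta>]) (rule f)
  have "(\<integral>\<^sup>+x. frac_strong_max \<alpha> m f x epowr q * ennreal (v x) \<partial>lebesgue)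
    \<le> (\<integral>\<^sup>+x. liminf (\<lambda>N. ?\<Psi> N x) * ennreal (v x) \<partial>lebesgue)"
    by (intro nn_integral_mono mult_right_mono le) simp
  also have "\<dots> = (\<integral>\<^sup>+x. liminf (\<lambda>N. ?\<Psi> N x) \<partial>?\<nu>)"
    by (subst nn_integral_density) (auto simp: mult.commute)
  also have "\<dots> \<le> liminf (\<lambda>N. \<integral>\<^sup>+x. ?\<Psi> N x \<partial>?\<nu>)"
    by (intro nn_integral_liminf) simp
  also have "\<dots> \<le> liminf (\<lambda>N. ennreal B)"
  proof (intro Liminf_mono always_eventually allI)
    fix N
    have "(\<integral>\<^sup>+x. ?\<Psi> N x \<partial>?\<nu>) = (\<integral>\<^sup>+x. ?\<Psi> N x * ennreal (v x) \<partial>lebesgue)"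
      by (subst nn_integral_density) (auto simp: mult.commute)
    also have "\<dots> \<le> ennreal B"
      unfolding nn_integral_grid_max_fun[OF v zero_less_Suc] \<beta>_def by (intro ennreal_leI bound) simp
    finally show "(\<integral>\<^sup>+x. ?\<Psi> N x \<partial>?\<nu>) \<le> ennreal B" .
  qed
  also have "\<dots> = ennreal B" by (intro lim_imp_Liminf) auto
  finally show ?thesis .
qed

theorem theorem2p4:
  fixes m :: nat and \<alpha> p q r :: real and P :: "nat \<Rightarrow> real"
    and w :: "nat \<Rightarrow> real ^ 'n \<Rightarrow> real" and v :: "real ^ 'n \<Rightarrow> real"
  assumes "0 \<le> \<alpha>" and "\<alpha> < real m * real CARD('n)"
    and "\<forall>i \<in> {1..m}. 1 < P i"
    and "1 / p = (\<Sum>i = 1..m. 1 / P i)"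
    and "0 < p" and "p \<le> q"
    and "\<forall>i \<in> {1..m}. is_weight (w i)"
    and "is_weight v" and "v \<in> A_infty"
    and "1 < r"
    and "(SUP R \<in> rectangles.
            (emeasure lebesgue R) epowr (\<alpha> / real CARD('n) + 1 / q - 1 / p) *
            (average R (\<lambda>x. ennreal (v x))) epowr (1 / q) *
            (\<Prod>i = 1..m.
               (average R (\<lambda>x. ennreal (w i x) epowr ((1 - conj_exp (P i)) * r)))
                 epowr (1 / (r * conj_exp (P i))))) < \<infinity>"
  shows "\<exists>C::real. C > 0 \<and>
    (\<forall>f :: nat \<Rightarrow> real ^ 'n \<Rightarrow> real.
       (\<forall>i \<in> {1..m}. f i \<in> borel_measurable lebesgue) \<longrightarrow>
       weighted_norm q v (frac_strong_max \<alpha> m f) \<le>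
         ennreal C * (\<Prod>i = 1..m. weighted_norm (P i) (w i) (\<lambda>x. ennreal \<bar>f i x\<bar>)))"
proof (cases "AE x in lebesgue. v x = 0")
  \<comment> \<open>The zero weight satisfies the A_s conditions because 0 times infinity is 0 in
    \<open>ennreal\<close>; here the left side is 0 and nothing is known about the w i.\<close>
  case True
  have q: "0 < q" using assms(5,6) by simp
  have "weighted_norm q v g = 0" for g :: "real ^ 'n \<Rightarrow> ennreal"
  proof -
    have "(\<integral>\<^sup>+x. g x epowr q * ennreal (v x) \<partial>lebesgue) = (\<integral>\<^sup>+x. 0 \<partial>(lebesgue :: (real ^ 'n) measure))"
      by (intro nn_integral_cong_AE) (use True in eventually_elim, simp)
    then show ?thesis using q by (simp add: weighted_norm_def epowr_eq_0_iff)
  qed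
  then show ?thesis by (intro exI[of _ 1]) simp
next
  case False
  have q: "0 < q" using assms(5,6) by simp
  \<comment> \<open>For m = 0 the sum of the 1/P i would be 0, contradicting 0 < p.\<close>
  have m: "0 < m" using assms(4,5) by (cases m) auto
  \<comment> \<open>This makes (1 - p_i')r equal to -1/(P i \<kappa> i), and P i \<kappa> i = (P i -
    1)/r < P i - 1 is the strict gain from r > 1.\<close>
  define \<kappa> where "\<kappa> i = 1 / (r * conj_exp (P i))" for i
  have P: "1 < P i" if "i \<in> {1..m}" for i using assms(3) that by blast
  have \<kappa>_eq: "\<kappa> i = (P i - 1) / (r * P i)" for i by (simp add: \<kappa>_def conj_exp_def)
  have \<kappa>: "0 < \<kappa> i \<and> \<kappa> i < 1 \<and> 1 < P i * (1 - \<kappa> i)" and \<tau>: "(1 - conj_exp (P i)) * r = - 1 / (P i * \<kappa> i)"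
    and \<tau>0: "(1 - conj_exp (P i)) * r < 0" if i: "i \<in> {1..m}" for i
  proof -
    have Pi: "1 < P i" using P[OF i] .
    have r: "1 < r" by fact
    have rP: "0 < r * P i" using Pi r by simp
    have lt: "(P i - 1) / r < P i - 1" using Pi r by (simp add: divide_less_eq)
    have eq: "P i * \<kappa> i = (P i - 1) / r" using Pi r by (simp add: \<kappa>_eq)
    have "P i * \<kappa> i < P i * 1" unfolding eq using lt Pi by linarith
    then have "\<kappa> i < 1" using Pi by simp
    moreover have "0 < \<kappa> i" using Pi r by (simp add: \<kappa>_eq)
    moreover have "1 < P i * (1 - \<kappa> i)" using eq lt by (simp add: right_diff_distrib)
    ultimately show "0 < \<kappa> i \<and> \<kappa> i < 1 \<and> 1 < P i * (1 - \<kappa> i)" by blast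
    have cj: "1 - conj_exp (P i) = - 1 / (P i - 1)" using Pi by (simp add: conj_exp_def field_simps)
    show "(1 - conj_exp (P i)) * r = - 1 / (P i * \<kappa> i)" unfolding eq cj by simp
    show "(1 - conj_exp (P i)) * r < 0" unfolding cj using Pi r by simp
  qed
  obtain s where s: "1 < s" and vs: "v \<in> A_class s" using assms(9) by (auto simp: A_infty_def)
  have vpos: "AE x in lebesgue. 0 < v x" by (rule A_class_pos[OF s vs False])
  have giv: "grid_integrable v" using assms(8) by (rule is_weight_grid_integrable)
  obtain A where A: "0 < A" and Aw: "\<And>D a b. \<lbrakk>0 < D; a \<le> b\<rbrakk> \<Longrightarrow>
      (\<Sum>k\<in>{a..b}. box_int D k k v) * (\<Sum>k\<in>{a..b}. box_int D k k v powr (- 1 / (s - 1))) powr (s - 1)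
        \<le> A * real (card {a..b}) powr s"
    by (rule A_class_grid[OF s vs vpos], rule that)
  obtain K where K: "0 < K" and wpos: "\<And>i. i \<in> {1..m} \<Longrightarrow> AE x in lebesgue. 0 < w i x"
    and u: "\<And>i. i \<in> {1..m} \<Longrightarrow> grid_integrable (\<lambda>x. w i x powr ((1 - conj_exp (P i)) * r))"
    and bump: "\<And>D a b. \<lbrakk>0 < D; a \<le> b\<rbrakk> \<Longrightarrow> (let h = real (card {a..b}) / real D ^ CARD('n) in
      h powr (\<alpha> / real CARD('n) + 1 / q - 1 / p) * (box_int D a b v / h) powr (1 / q) *
      (\<Prod>i = 1..m. (box_int D a b (\<lambda>x. w i x powr ((1 - conj_exp (P i)) * r)) / h) powr \<kappa> i) \<le> K)"
    by (rule bump_grid[of "{1..m}" "\<lambda>i. (1 - conj_exp (P i)) * r" \<kappa> q w v "\<alpha> / real CARD('n) + 1 / q - 1 / p"])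
      (use \<tau>0 \<kappa> q assms(7,8,11) vpos that in \<open>auto simp: \<kappa>_def\<close>)
  have bump': "(let h = real (card {a..b}) / real D ^ CARD('n) in
      h powr (\<alpha> / real CARD('n) + 1 / q - 1 / p) * (box_int D a b v / h) powr (1 / q) *
      (\<Prod>i = 1..m. (box_int D a b (\<lambda>x. w i x powr (- 1 / (P i * \<kappa> i))) / h) powr \<kappa> i) \<le> K)"
    if "0 < D" "a \<le> b" for D and a b :: "'n \<Rightarrow> int"
  proof -
    have "(\<Prod>i = 1..m. (box_int D a b (\<lambda>x. w i x powr (- 1 / (P i * \<kappa> i))) / h) powr \<kappa> i)
      = (\<Prod>i = 1..m. (box_int D a b (\<lambda>x. w i x powr ((1 - conj_exp (P i)) * r)) / h) powr \<kappa> i)" for h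
      by (intro prod.cong refl) (simp only: \<tau>)
    then show ?thesis using bump[OF that] by (simp only: Let_def)
  qed
  have wm: "w i \<in> borel_measurable lebesgue" and w0: "0 \<le> w i x" if "i \<in> {1..m}" for i x
    using assms(7) that by (auto simp: is_weight_def)
  have \<beta>: "0 < 1 - \<alpha> / (real m * real CARD('n))"
    using assms(2) m by (simp add: divide_less_eq)
  define c where "c = 2 powr s * A_maximal_const s A ^ CARD('n) *
      (2 * (\<Prod>i = 1..m. (A_maximal_const (P i * (1 - \<kappa> i)) 1 ^ CARD('n)) powr (p / P i))) powr (q / p)"
  have c0: "0 \<le> c" by (simp add: c_def A_maximal_const_nonneg)
  \<comment> \<open>The q-th root of the grid bound yields c^(1/q) K; the added 1 ensures a positive
    constant.\<close>
  define C where "C = c powr (1 / q) * K + 1"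
  have C: "0 < C" using K by (simp add: C_def add_nonneg_pos)
  show ?thesis
  proof (intro exI[of _ C] conjI C allI impI)
    fix f :: "nat \<Rightarrow> real ^ 'n \<Rightarrow> real"
    assume f: "\<forall>i\<in>{1..m}. f i \<in> borel_measurable lebesgue"
    define W where "W i = (\<integral>\<^sup>+x. ennreal (\<bar>f i x\<bar> powr P i * w i x) \<partial>lebesgue)" for i
    have fm: "f i \<in> borel_measurable lebesgue" if "i \<in> {1..m}" for i using f that by blast
    have Wm: "(\<lambda>x. \<bar>f i x\<bar> powr P i * w i x) \<in> borel_measurable lebesgue" if "i \<in> {1..m}" for i
      using fm[OF that] wm[OF that] by measurable
    have norm: "weighted_norm (P i) (w i) (\<lambda>x. ennreal \<bar>f i x\<bar>) = W i epowr (1 / P i)" if i: "i \<in> {1..m}" for i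
    proof -
      have "ennreal \<bar>f i x\<bar> epowr P i * ennreal (w i x) = ennreal (\<bar>f i x\<bar> powr P i * w i x)" for x
        using P[OF i] w0[OF i] by (subst epowr_ennreal) (auto simp: ennreal_mult)
      then show ?thesis by (simp add: weighted_norm_def W_def)
    qed
    have norms: "(\<Prod>i = 1..m. weighted_norm (P i) (w i) (\<lambda>x. ennreal \<bar>f i x\<bar>)) = (\<Prod>i = 1..m. W i epowr (1 / P i))"
      by (intro prod.cong refl norm)
    show "weighted_norm q v (frac_strong_max \<alpha> m f) \<le>
      ennreal C * (\<Prod>i = 1..m. weighted_norm (P i) (w i) (\<lambda>x. ennreal \<bar>f i x\<bar>))"
    proof (cases "\<exists>i\<in>{1..m}. W i = 0")
      \<comment> \<open>Vanishing norms come first, since a product with a factor 0 and a factor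
        infinity is 0. With w i > 0 a.e. a zero norm means f i = 0 a.e.; afterwards an infinite norm
        makes the right side infinite.\<close>
      case True
      then obtain i where i: "i \<in> {1..m}" "W i = 0" by blast
      have "AE x in lebesgue. ennreal (\<bar>f i x\<bar> powr P i * w i x) = 0"
        using i(2) Wm[OF i(1)] unfolding W_def by (subst (asm) nn_integral_0_iff_AE) auto
      then have "AE x in lebesgue. f i x = 0"
        using wpos[OF i(1)] by eventually_elim (auto simp: ennreal_eq_0_iff mult_le_0_iff)
      then have "frac_strong_max \<alpha> m f x = 0" for x by (rule frac_strong_max_eq_0[OF i(1)])
      then have "weighted_norm q v (frac_strong_max \<alpha> m f) = 0"
        using q by (simp add: weighted_norm_def epowr_def)
      then show ?thesis by simp
    next
      case nz: False
      show ?thesis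
      proof (cases "\<exists>i\<in>{1..m}. W i = \<infinity>")
        case True
        then obtain i where i: "i \<in> {1..m}" "W i = \<infinity>" by blast
        have "W j epowr (1 / P j) \<noteq> 0" if "j \<in> {1..m}" for j
          using nz that P[OF that] by (simp add: epowr_eq_0_iff)
        moreover have "W i epowr (1 / P i) = \<infinity>" using i P[OF i(1)] by (simp add: epowr_def)
        ultimately have "(\<Prod>i = 1..m. W i epowr (1 / P i)) = \<infinity>"
          using prod_ennreal_not_top[of "{1..m}" "\<lambda>i. W i epowr (1 / P i)" i] i(1) by auto
        then show ?thesis unfolding norms using C by (simp add: ennreal_mult_top)
      next
        case fin: False
        define N where "N i = enn2real (W i)" for i
        have N: "(\<integral>\<^sup>+x. ennreal (\<bar>f i x\<bar> powr P i * w i x) \<partial>lebesgue) = ennreal (N i) \<and> 0 \<le> N i" if "i \<in> {1..m}" for i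
          using fin that by (simp add: N_def W_def less_top)
        have fi: "grid_integrable (\<lambda>x. \<bar>f i x\<bar>)" if i: "i \<in> {1..m}" for i
          by (rule weighted_Hoelder_grid(2)[OF fm[OF i] wm[OF i] w0[OF i] wpos[OF i] P[OF i], of "\<kappa> i" "N i"])
            (use \<kappa>[OF i] u[OF i] N[OF i] \<tau>[OF i] in auto)
        define T where "T = (\<Prod>i = 1..m. N i powr (p / P i))"
        have T: "0 \<le> T" by (simp add: T_def prod_nonneg)
        have "(\<Sum>k\<in>{grid_lo D..grid_hi D}.
          grid_max D (1 - \<alpha> / (real m * real CARD('n))) m f k powr q * box_int D k k v) \<le> c * (K powr p * T) powr (q / p)"
          if D: "0 < D" for D
          unfolding c_def T_def
        \<comment> \<open>The bound is the same for all D > 0, so it survives the limit.\<close>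
        proof (rule grid_max_bound[where w = w and P = P and \<kappa> = \<kappa> and m = m])
          show "grid_integrable (\<lambda>x. w i x powr (- 1 / (P i * \<kappa> i)))" if "i \<in> {1..m}" for i
            using u[OF that] \<tau>[OF that] by simp
        qed (use P \<kappa> assms(4,5,6) m wm w0 wpos giv vpos s A Aw[OF D] K bump'[OF D] D fm N in auto)
        from frac_strong_max_grid_bound[OF giv q \<beta> fi this]
        have "(\<integral>\<^sup>+x. frac_strong_max \<alpha> m f x epowr q * ennreal (v x) \<partial>lebesgue) \<le> ennreal (c * (K powr p * T) powr (q / p))"
          by simp
        then have "weighted_norm q v (frac_strong_max \<alpha> m f) \<le> ennreal ((c * (K powr p * T) powr (q / p)) powr (1 / q))"
          unfolding weighted_norm_def using c0 q by (intro epowr_le_ennreal) auto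
        also have "(c * (K powr p * T) powr (q / p)) powr (1 / q) = c powr (1 / q) * (K powr p * T) powr (1 / p)"
          using c0 q by (simp add: powr_mult powr_powr)
        also have "(K powr p * T) powr (1 / p) = K * (\<Prod>i = 1..m. N i powr (1 / P i))"
          using K T assms(5) by (simp add: powr_mult powr_powr T_def prod_powr_distrib)
        also have "ennreal (c powr (1 / q) * (K * (\<Prod>i = 1..m. N i powr (1 / P i))))
          \<le> ennreal (C * (\<Prod>i = 1..m. N i powr (1 / P i)))"
          unfolding C_def mult.assoc[symmetric] by (intro ennreal_leI mult_right_mono prod_nonneg) auto
        also have "\<dots> = ennreal C * (\<Prod>i = 1..m. W i epowr (1 / P i))"
        proof -
          have "(\<Prod>i = 1..m. W i epowr (1 / P i)) = (\<Prod>i = 1..m. ennreal (N i powr (1 / P i)))"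
          proof (intro prod.cong refl)
            fix i assume i: "i \<in> {1..m}"
            have "W i = ennreal (N i)" "0 \<le> N i" using N[OF i] by (auto simp: W_def)
            then show "W i epowr (1 / P i) = ennreal (N i powr (1 / P i))"
              using P[OF i] by (simp add: epowr_ennreal)
          qed
          then show ?thesis using C by (simp add: prod_ennreal ennreal_mult prod_nonneg)
        qed
        finally show ?thesis unfolding norms .
      qed
    qed
  qed
qed

end
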